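(* Let $1\le m<n$ and let $\mu, \nu$ be finite nonzero Borel measures on $\mathbb{R}^n$ with compact support such that $I_m(\mu)<\infty$ and $I_{m}(\nu)<\infty$. Then $$\int_{G(n,m)}\int_V P_{V\sharp}\mu(v)\, P_{V\sharp}\nu(v)\, d\mathcal H^mv\,d\gamma_{n,m}V>0$$ and $$\gamma_{n,m}\left(\{V\in G(n,m): \mathcal H^m\left(P_V(\operatorname{spt}\mu)\cap P_V(\operatorname{spt}\nu)\right)>0\}\right)>0.$$
   Context: For a Borel measure $\mu$ on $\mathbb{R}^n$, $I_s(\mu)=\iint|x-y|^{-s}\,d\mu x\,d\mu y$ is its $s$-energy and $\operatorname{spt}\mu$ its support. $G(n,m)$ is the Grassmannian of $m$-dimensional linear subspaces of $\mathbb{R}^n$, $\gamma_{n,m}$ its orthogonally invariant Borel probability measure, $P_V$ the orthogonal projection onto $V$, and $\mathcal H^m$ the $m$-dimensional Hausdorff (Lebesgue) measure on $V$. If $I_m(\mu)<\infty$, then for $\gamma_{n,m}$ almost all $V$ the image measure $P_{V\sharp}\mu$ is absolutely continuous with respect to $\mathcal H^m$ on $V$ with density in $L^2(V)$; this density is also denoted $P_{V\sharp}\mu$. *)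

theory Defs
  imports "HOL-Probability.Probability"
begin

definition spt :: "'a::metric_space measure \<Rightarrow> 'a set" where
  "spt \<mu> = {x. \<forall>e>0. emeasure \<mu> (ball x e) > 0}"

definition energy :: "real \<Rightarrow> 'a::metric_space measure \<Rightarrow> ennreal" where
  "energy s \<mu> = (\<integral>\<^sup>+ x. (\<integral>\<^sup>+ y. (if x = y then \<infinity> else ennreal (dist x y powr (- s))) \<partial>\<mu>) \<partial>\<mu>)"

definition Grass :: "nat \<Rightarrow> 'a::euclidean_space set set" where
  "Grass m = {V. subspace V \<and> dim V = m}"

definition proj :: "'a::euclidean_space set \<Rightarrow> 'a \<Rightarrow> 'a" where
  "proj V x = (THE v. v \<in> V \<and> (\<forall>w\<in>V. (x - v) \<bullet> w = 0))"

text \<open>Borel structure on G(n,m), induced by the embedding V \<mapsto> P_V into the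
  (finite-dimensional normed) space of linear maps.\<close>
definition Grass_sets :: "nat \<Rightarrow> 'a::euclidean_space set measure" where
  "Grass_sets m = vimage_algebra (Grass m) (\<lambda>V. Blinfun (proj V)) borel"

definition invariant_grass_measure :: "nat \<Rightarrow> 'a::euclidean_space set measure \<Rightarrow> bool" where
  "invariant_grass_measure m \<gamma> \<longleftrightarrow>
     prob_space \<gamma> \<and> sets \<gamma> = sets (Grass_sets m) \<and>
     (\<forall>T. orthogonal_transformation T \<longrightarrow>
        (\<forall>A\<in>sets \<gamma>. emeasure \<gamma> {V\<in>Grass m. T ` V \<in> A} = emeasure \<gamma> A))"

definition onb :: "'a::euclidean_space set \<Rightarrow> nat \<Rightarrow> 'a" where
  "onb V = (SOME e. (\<forall>i<dim V. e i \<in> V) \<and>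
                    (\<forall>i<dim V. \<forall>j<dim V. e i \<bullet> e j = (if i = j then 1 else 0)) \<and>
                    span (e ` {..<dim V}) = V)"

text \<open>Lebesgue (= dim V-dimensional Hausdorff) measure on the subspace V, as a measure on
  the ambient space: image of Lebesgue measure on R^(dim V) under the isometry
  t \<mapsto> sum_i t_i e_i onto V.\<close>
definition lebV :: "'a::euclidean_space set \<Rightarrow> 'a measure" where
  "lebV V = distr (PiM {..<dim V} (\<lambda>_. lborel)) borel
                  (\<lambda>t. \<Sum>i<dim V. t i *\<^sub>R onb V i)"

definition proj_density :: "'a::euclidean_space set \<Rightarrow> 'a measure \<Rightarrow> 'a \<Rightarrow> ennreal" where
  "proj_density V \<mu> = RN_deriv (lebV V) (distr \<mu> borel (proj V))"

end

theory Submission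
  imports Defs
begin

text \<open>Let \<open>A\<^sub>k(\<mu>, \<nu>)(V)\<close> be \<open>(k+1)\<^sup>m\<close> times the \<open>\<mu> \<times> \<nu>\<close>-mass of the pairs
  \<open>(x, y)\<close> with \<open>|P\<^sub>V (x - y)| \<le> 1/(k+1)\<close>. By invariance, the \<open>\<gamma>\<close>-measure of the planes with
  \<open>|P\<^sub>V z| \<le> d\<close> is comparable to \<open>(d / |z|)\<^sup>m\<close>. Hence the averages over \<open>V\<close> of \<open>A\<^sub>k(\<mu>, \<mu>)\<close>
  are bounded by the energy, while those of \<open>A\<^sub>k(\<mu>, \<nu>)\<close> stay away from zero. By Fatou,
  \<open>W(V) = liminf A\<^sub>k(\<mu>, \<mu>)(V)\<close> is integrable. Where it is finite, the projection of \<open>\<mu>\<close> to \<open>V\<close>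
  has a density whose squared \<open>L\<^sup>2\<close> norm is at most a multiple of \<open>W(V)\<close>, and likewise for \<open>\<nu>\<close>.
  So \<open>A\<^sub>k(\<mu>, \<nu>)\<close> is dominated by an integrable function, and its limsup is at most a multiple of
  the integral of the product of the two densities; reverse Fatou gives positivity.

  The second claim needs the set of planes to be measurable: the overlap has positive
  \<open>m\<close>-dimensional measure in \<open>V\<close> iff its preimage under \<open>P\<^sub>V\<close> has positive Lebesgue measure in
  the ambient space, which is a measurable condition on \<open>V\<close>.\<close>

section \<open>Orthonormal coordinates and Lebesgue measure\<close>

text \<open>Coincidence masses make sense for arbitrary finite measures and are jointly measurable
  in the plane, which densities are not visibly. The passage between masses and densities uses no
  differentiation theorem and no Fourier transform: only two-sided bounds of order d^m for the
  measure of balls, and the fact that the averaged squared oscillation of an L^2 function at scale d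
  tends to zero with d. Crude constants suffice, since only finiteness and positivity are at stake,
  but they have to be the same for all planes.

  The obstacle is measurability in V. Both \<open>lebV V\<close> and \<open>proj_density V\<close>
  rest on choices made separately for each V. For the first claim this is harmless: the nonnegative
  integral, a supremum over simple functions below the integrand, is monotone for arbitrary
  functions, so a measurable minorant with positive integral is enough. The second claim has no such
  escape, because \<open>emeasure\<close> assigns 0 to every set that is not measurable.\<close>

definition orthonormal_seq :: "(nat \<Rightarrow> 'a::euclidean_space) \<Rightarrow> nat \<Rightarrow> bool" where
  "orthonormal_seq e k \<longleftrightarrow> (\<forall>i<k. \<forall>j<k. e i \<bullet> e j = (if i = j then 1 else 0))"

text \<open>Two instances matter: with \<open>onb V\<close> and \<open>dim V\<close> it is
  \<open>lebV V\<close>, and with a full orthonormal basis it is Lebesgue measure of the whole space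
  up to a constant. Keeping the sequence arbitrary lets the same box estimates serve both.\<close>

definition coord_measure :: "(nat \<Rightarrow> 'a::euclidean_space) \<Rightarrow> nat \<Rightarrow> 'a measure" where
  "coord_measure e k = distr (PiM {..<k} (\<lambda>_. lborel)) borel (\<lambda>t. \<Sum>i<k. t i *\<^sub>R e i)"

abbreviation coord_space :: "nat \<Rightarrow> (nat \<Rightarrow> real) measure" where
  "coord_space k \<equiv> PiM {..<k} (\<lambda>_. lborel)"

lemma sets_coord_measure [simp, measurable_cong]: "sets (coord_measure e k) = sets borel"
  by (simp add: coord_measure_def)

lemma space_coord_measure [simp]: "space (coord_measure e k) = UNIV"
  by (simp add: coord_measure_def)

lemma measurable_synthesis [measurable]:
  "(\<lambda>t. \<Sum>i<k. t i *\<^sub>R (e i :: 'a::euclidean_space)) \<in> borel_measurable (coord_space k)"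
  by measurable

lemma inner_synthesis:
  assumes "orthonormal_seq e k" "j < k"
  shows "(\<Sum>i<k. t i *\<^sub>R e i) \<bullet> e j = t j"
proof -
  have "(\<Sum>i<k. t i *\<^sub>R e i) \<bullet> e j = (\<Sum>i<k. t i * (e i \<bullet> e j))"
    by (simp add: inner_sum_left)
  also have "\<dots> = (\<Sum>i<k. if i = j then t i else 0)"
    using assms by (intro sum.cong) (auto simp: orthonormal_seq_def)
  finally show ?thesis using assms by simp
qed

lemma norm_synthesis:
  assumes "orthonormal_seq e k"
  shows "norm (\<Sum>i<k. t i *\<^sub>R e i) = sqrt (\<Sum>i<k. (t i)\<^sup>2)"
proof -
  have "(\<Sum>i<k. t i *\<^sub>R e i) \<bullet> (\<Sum>i<k. t i *\<^sub>R e i) = (\<Sum>j<k. t j * ((\<Sum>i<k. t i *\<^sub>R e i) \<bullet> e j))"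
    by (simp add: inner_sum_right[of "\<Sum>i<k. t i *\<^sub>R e i" "\<lambda>i. t i *\<^sub>R e i"] del: inner_sum_left)
  also have "\<dots> = (\<Sum>i<k. (t i)\<^sup>2)"
    by (intro sum.cong) (auto simp: inner_synthesis[OF assms] power2_eq_square)
  finally show ?thesis by (simp add: norm_eq_sqrt_inner)
qed

lemma norm_orthonormal_seq: "orthonormal_seq e k \<Longrightarrow> i < k \<Longrightarrow> norm (e i) = 1"
  by (simp add: orthonormal_seq_def norm_eq_sqrt_inner)

lemma emeasure_coord_box:
  assumes "\<And>i. i < k \<Longrightarrow> a i \<le> b i"
  shows "emeasure (coord_space k) (\<Pi>\<^sub>E i\<in>{..<k}. {a i..b i}) = ennreal (\<Prod>i<k. b i - a i)"
proof -
  interpret product_sigma_finite "\<lambda>_::nat. lborel :: real measure"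
    by (unfold_locales)
  have "emeasure (coord_space k) (\<Pi>\<^sub>E i\<in>{..<k}. {a i..b i}) = (\<Prod>i<k. emeasure lborel {a i..b i})"
    by (intro emeasure_PiM) auto
  also have "\<dots> = (\<Prod>i<k. ennreal (b i - a i))"
    using assms by (intro prod.cong) auto
  also have "\<dots> = ennreal (\<Prod>i<k. b i - a i)"
    using assms by (intro prod_ennreal) auto
  finally show ?thesis .
qed

lemma emeasure_coord_measure:
  "A \<in> sets borel \<Longrightarrow> emeasure (coord_measure e k) A =
    emeasure (coord_space k) {t\<in>space (coord_space k). (\<Sum>i<k. t i *\<^sub>R e i) \<in> A}"
  unfolding coord_measure_def
  by (subst emeasure_distr) (auto intro!: arg_cong[where f="emeasure _"])

lemma coord_measure_le_box:
  assumes A: "A \<in> sets borel"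
    and le: "\<And>i. i < k \<Longrightarrow> a i \<le> b i"
    and sub: "\<And>t. (\<Sum>i<k. t i *\<^sub>R e i) \<in> A \<Longrightarrow> \<forall>i<k. t i \<in> {a i..b i}"
  shows "emeasure (coord_measure e k) A \<le> ennreal (\<Prod>i<k. b i - a i)"
proof -
  have "emeasure (coord_measure e k) A \<le> emeasure (coord_space k) (\<Pi>\<^sub>E i\<in>{..<k}. {a i..b i})"
    unfolding emeasure_coord_measure[OF A] using sub
    by (intro emeasure_mono sets_PiM_I_finite) (auto simp: space_PiM PiE_iff extensional_def)
  then show ?thesis using emeasure_coord_box[of k a b] le by simp
qed

lemma coord_measure_ge_box:
  assumes A: "A \<in> sets borel"
    and le: "\<And>i. i < k \<Longrightarrow> a i \<le> b i"
    and sub: "\<And>t. (\<forall>i<k. t i \<in> {a i..b i}) \<Longrightarrow> (\<Sum>i<k. t i *\<^sub>R e i) \<in> A"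
  shows "ennreal (\<Prod>i<k. b i - a i) \<le> emeasure (coord_measure e k) A"
proof -
  have "emeasure (coord_space k) (\<Pi>\<^sub>E i\<in>{..<k}. {a i..b i}) \<le> emeasure (coord_measure e k) A"
    unfolding emeasure_coord_measure[OF A]
  proof (intro emeasure_mono)
    show "(\<Pi>\<^sub>E i\<in>{..<k}. {a i..b i}) \<subseteq> {t \<in> space (coord_space k). (\<Sum>i<k. t i *\<^sub>R e i) \<in> A}"
    proof
      fix t assume "t \<in> (\<Pi>\<^sub>E i\<in>{..<k}. {a i..b i})"
      then have "t \<in> space (coord_space k)" "\<forall>i<k. t i \<in> {a i..b i}"
        unfolding space_PiM by (simp_all add: PiE_iff)
      then show "t \<in> {t \<in> space (coord_space k). (\<Sum>i<k. t i *\<^sub>R e i) \<in> A}"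
        using sub[of t] by blast
    qed
    show "{t \<in> space (coord_space k). (\<Sum>i<k. t i *\<^sub>R e i) \<in> A} \<in> sets (coord_space k)"
      using A by measurable
  qed
  then show ?thesis using emeasure_coord_box[of k a b] le by simp
qed

text \<open>By Cauchy-Schwarz each coordinate of a point of the ball differs from that of the centre
  by at most \<open>r\<close>, so the ball pulls back into a cube of side \<open>2 * r\<close>. The
  centre may lie off the span.\<close>

lemma coord_measure_cball_le:
  assumes e: "orthonormal_seq e k" and r: "r \<ge> 0"
  shows "emeasure (coord_measure e k) (cball x r) \<le> ennreal ((2 * r) ^ k)"
proof -
  have "emeasure (coord_measure e k) (cball x r)
      \<le> ennreal (\<Prod>i<k. (x \<bullet> e i + r) - (x \<bullet> e i - r))"
  proof (rule coord_measure_le_box)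
    fix t assume t: "(\<Sum>i<k. t i *\<^sub>R e i) \<in> cball x r"
    show "\<forall>i<k. t i \<in> {x \<bullet> e i - r..x \<bullet> e i + r}"
    proof (intro allI impI)
      fix j assume j: "j < k"
      have "\<bar>((\<Sum>i<k. t i *\<^sub>R e i) - x) \<bullet> e j\<bar> \<le> norm ((\<Sum>i<k. t i *\<^sub>R e i) - x) * norm (e j)"
        by (rule Cauchy_Schwarz_ineq2)
      then have "\<bar>t j - x \<bullet> e j\<bar> \<le> r"
        using t norm_orthonormal_seq[OF e j]
        by (simp add: inner_diff_left inner_synthesis[OF e j] dist_norm norm_minus_commute)
      then show "t j \<in> {x \<bullet> e j - r..x \<bullet> e j + r}" by (auto simp: abs_le_iff)
    qed
  qed (use r in auto)
  then show ?thesis by simp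
qed

lemma norm_synthesis_le_sum:
  assumes e: "orthonormal_seq e k"
  shows "norm (\<Sum>i<k. t i *\<^sub>R e i) \<le> (\<Sum>i<k. \<bar>t i\<bar>)"
proof -
  have "norm (\<Sum>i<k. t i *\<^sub>R e i) \<le> (\<Sum>i<k. norm (t i *\<^sub>R e i))" by (rule norm_sum)
  also have "\<dots> = (\<Sum>i<k. \<bar>t i\<bar>)"
    by (intro sum.cong) (auto simp: norm_orthonormal_seq[OF e])
  finally show ?thesis .
qed

text \<open>The norm is at most the sum of the absolute values of the \<open>k\<close> coordinates,
  so a cube of side \<open>2 * r / k\<close> about the coordinates of the centre stays inside the
  ball. Here the centre lies in the span; a ball about a distant point can have measure
  zero.\<close>

lemma coord_measure_cball_ge:
  assumes e: "orthonormal_seq e k" and r: "r \<ge> 0" and x: "x = (\<Sum>i<k. s i *\<^sub>R e i)" and k: "k > 0"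
  shows "ennreal ((2 * r / k) ^ k) \<le> emeasure (coord_measure e k) (cball x r)"
proof -
  have "ennreal (\<Prod>i<k. (s i + r / k) - (s i - r / k)) \<le> emeasure (coord_measure e k) (cball x r)"
  proof (rule coord_measure_ge_box)
    fix t assume t: "\<forall>i<k. t i \<in> {s i - r / k..s i + r / k}"
    have "norm (\<Sum>i<k. (t i - s i) *\<^sub>R e i) \<le> (\<Sum>i<k. \<bar>t i - s i\<bar>)"
      by (rule norm_synthesis_le_sum[OF e])
    also have "\<dots> \<le> (\<Sum>i<k. r / k)"
      using t by (intro sum_mono) (auto simp: abs_le_iff algebra_simps)
    also have "\<dots> = r" using k by simp
    finally show "(\<Sum>i<k. t i *\<^sub>R e i) \<in> cball x r"
      by (simp add: x dist_norm norm_minus_commute scaleR_diff_left sum_subtractf)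
  qed (use r in auto)
  then show ?thesis by simp
qed

lemma coord_space_translate:
  "distr (coord_space k) (coord_space k) (\<lambda>t. \<lambda>i\<in>{..<k}. s i + t i) = coord_space k"
proof -
  interpret product_sigma_finite "\<lambda>_::nat. lborel :: real measure"
    by (unfold_locales)
  show ?thesis
  proof (rule PiM_eqI)
    fix A :: "nat \<Rightarrow> real set" assume A: "\<And>i. i \<in> {..<k} \<Longrightarrow> A i \<in> sets lborel"
    have m: "(\<lambda>t. \<lambda>i\<in>{..<k}. s i + t i) \<in> measurable (coord_space k) (coord_space k)"
      by measurable
    have S: "{x. s i + x \<in> A i} \<in> sets borel" if "i < k" for i
    proof -
      have [measurable]: "A i \<in> sets borel" using A that by auto
      show ?thesis by measurable
    qed
    have "emeasure (distr (coord_space k) (coord_space k) (\<lambda>t. \<lambda>i\<in>{..<k}. s i + t i)) (Pi\<^sub>E {..<k} A)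
        = emeasure (coord_space k) ((\<lambda>t. \<lambda>i\<in>{..<k}. s i + t i) -` (Pi\<^sub>E {..<k} A) \<inter> space (coord_space k))"
      using m A by (intro emeasure_distr sets_PiM_I_finite) auto
    also have "(\<lambda>t. \<lambda>i\<in>{..<k}. s i + t i) -` (Pi\<^sub>E {..<k} A) \<inter> space (coord_space k)
        = (\<Pi>\<^sub>E i\<in>{..<k}. {x. s i + x \<in> A i})"
      unfolding space_PiM set_eq_iff by (simp add: PiE_iff Ball_def)
    also have "emeasure (coord_space k) \<dots> = (\<Prod>i<k. emeasure lborel {x. s i + x \<in> A i})"
      using S by (intro emeasure_PiM) auto
    also have "\<dots> = (\<Prod>i<k. emeasure lborel (A i))"
    proof (intro prod.cong refl)
      fix i assume i: "i \<in> {..<k}"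
      have "emeasure lborel (A i) = emeasure (distr lborel borel ((+) (s i))) (A i)"
        by (simp add: lborel_distr_plus)
      also have "\<dots> = emeasure lborel {x. s i + x \<in> A i}"
        using A[OF i] by (subst emeasure_distr) (auto simp: vimage_def)
      finally show "emeasure lborel {x. s i + x \<in> A i} = emeasure lborel (A i)" ..
    qed
    finally show "emeasure (distr (coord_space k) (coord_space k) (\<lambda>t. \<lambda>i\<in>{..<k}. s i + t i)) (Pi\<^sub>E {..<k} A)
        = (\<Prod>i\<in>{..<k}. emeasure lborel (A i))" .
  qed auto
qed

lemma coord_measure_translate:
  assumes x: "x = (\<Sum>i<k. s i *\<^sub>R e i)"
  shows "distr (coord_measure e k) borel (\<lambda>y. x + y) = coord_measure e k"
proof -
  have m: "(\<lambda>t. \<lambda>i\<in>{..<k}. s i + t i) \<in> measurable (coord_space k) (coord_space k)"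
    by measurable
  have "coord_measure e k
      = distr (distr (coord_space k) (coord_space k) (\<lambda>t. \<lambda>i\<in>{..<k}. s i + t i)) borel (\<lambda>t. \<Sum>i<k. t i *\<^sub>R e i)"
    by (simp add: coord_space_translate coord_measure_def)
  also have "\<dots> = distr (coord_space k) borel (\<lambda>t. \<Sum>i<k. (\<lambda>i\<in>{..<k}. s i + t i) i *\<^sub>R e i)"
    using m by (subst distr_distr) (auto simp: o_def)
  also have "\<dots> = distr (coord_space k) borel (\<lambda>t. x + (\<Sum>i<k. t i *\<^sub>R e i))"
    by (intro distr_cong) (auto simp: x scaleR_add_left sum.distrib)
  also have "\<dots> = distr (coord_measure e k) borel (\<lambda>y. x + y)"
    unfolding coord_measure_def by (subst distr_distr) (auto simp: o_def)
  finally show ?thesis ..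
qed

lemma sigma_finite_ballsI:
  fixes M :: "'a::real_normed_vector measure"
  assumes "sets M = sets borel" "\<And>R::nat. emeasure M (cball 0 R) < \<infinity>"
  shows "sigma_finite_measure M"
proof
  have sp: "space M = UNIV" using sets_eq_imp_space_eq[OF assms(1)] by simp
  have "\<exists>n::nat. x \<in> cball 0 n" for x :: 'a
    by (metis mem_cball_0 real_arch_simple)
  then show "\<exists>A. countable A \<and> A \<subseteq> sets M \<and> \<Union> A = space M \<and> (\<forall>a\<in>A. emeasure M a \<noteq> \<infinity>)"
    using assms by (intro exI[of _ "range (\<lambda>n::nat. cball 0 (real n))"]) (auto simp: sp less_top)
qed

lemma sigma_finite_coord_measure:
  assumes "orthonormal_seq e k" shows "sigma_finite_measure (coord_measure e k)"
proof (rule sigma_finite_ballsI)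
  show "emeasure (coord_measure e k) (cball 0 (real R)) < \<infinity>" for R :: nat
    using coord_measure_cball_le[OF assms, of "real R" 0] by (simp add: le_less_trans)
qed simp

lemma orthonormal_seq_expansion:
  fixes e :: "nat \<Rightarrow> 'a::euclidean_space"
  assumes e: "orthonormal_seq e k" and x: "x \<in> span (e ` {..<k})"
  shows "(\<Sum>i<k. (x \<bullet> e i) *\<^sub>R e i) = x"
proof -
  have "x \<in> range (\<lambda>t. \<Sum>i<k. t i *\<^sub>R e i)"
    using x
  proof (induction rule: span_induct_alt)
    case base
    show ?case by (intro image_eqI[where x="\<lambda>_. 0"]) auto
  next
    case (step c z y)
    then obtain j t where j: "j < k" "z = e j" and t: "y = (\<Sum>i<k. t i *\<^sub>R e i)" by auto
    have "c *\<^sub>R z = (\<Sum>i<k. (if i = j then c else 0) *\<^sub>R e i)"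
      using j by (simp add: if_distrib[where f="\<lambda>x. x *\<^sub>R _"] cong: if_cong)
    then have eq: "c *\<^sub>R z + y = (\<Sum>i<k. ((if i = j then c else 0) + t i) *\<^sub>R e i)"
      by (simp add: t scaleR_add_left sum.distrib)
    show ?case by (rule range_eqI[where x="\<lambda>i. (if i = j then c else 0) + t i"]) (simp only: eq)
  qed
  then obtain t where t: "x = (\<Sum>i<k. t i *\<^sub>R e i)" by auto
  show ?thesis
    unfolding t by (intro sum.cong refl) (auto simp: inner_synthesis[OF e])
qed

lemma orthonormal_seq_inj: "orthonormal_seq e k \<Longrightarrow> inj_on e {..<k}"
  by (auto simp: inj_on_def orthonormal_seq_def) (metis zero_neq_one)

lemma orthonormal_seq_span_UNIV:
  fixes e :: "nat \<Rightarrow> 'a::euclidean_space"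
  assumes e: "orthonormal_seq e DIM('a)"
  shows "span (e ` {..<DIM('a)}) = UNIV"
proof -
  have "independent (e ` {..<DIM('a)})"
    using e by (intro pairwise_orthogonal_independent)
      (auto simp: pairwise_def orthogonal_def orthonormal_seq_def dest: norm_orthonormal_seq[OF e])
  moreover have "card (e ` {..<DIM('a)}) = DIM('a)"
    by (simp add: card_image orthonormal_seq_inj[OF e])
  ultimately show ?thesis
    by (metis card_eq_dim dim_UNIV subset_UNIV finite_imageI finite_lessThan order_refl top.extremum_uniqueI)
qed

text \<open>Uniqueness of translation invariant measures: compute
  \<open>\<integral>\<integral> 1\<^sub>A(x) 1\<^sub>Q(x - y) dM(y) dx\<close> in both orders, with \<open>Q\<close> the unit ball.\<close>

lemma coord_measure_lborel_exchange:
  fixes e :: "nat \<Rightarrow> 'a::euclidean_space"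
  assumes e: "orthonormal_seq e DIM('a)" and A[measurable]: "A \<in> sets borel"
  shows "emeasure lborel A * emeasure (coord_measure e DIM('a)) (cball 0 1)
       = emeasure lborel (cball 0 1 :: 'a set) * emeasure (coord_measure e DIM('a)) A"
proof -
  let ?M = "coord_measure e DIM('a)"
  let ?Q = "cball 0 1 :: 'a set"
  have [measurable]: "?Q \<in> sets borel" by simp
  interpret M: sigma_finite_measure ?M by (rule sigma_finite_coord_measure[OF e])
  interpret P: pair_sigma_finite lborel ?M ..
  have tr: "distr ?M borel (\<lambda>y. x + y) = ?M" for x
    using orthonormal_seq_expansion[OF e] orthonormal_seq_span_UNIV[OF e]
    by (intro coord_measure_translate[where s="\<lambda>i. x \<bullet> e i"]) auto
  \<comment> \<open>The unit ball is symmetric, so \<open>x - y\<close> may be replaced by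
    \<open>- x + y\<close>, to which translation invariance applies.\<close>
  have 1: "emeasure ?M {y. x - y \<in> ?Q} = emeasure ?M ?Q" for x
  proof -
    have "emeasure ?M ?Q = emeasure (distr ?M borel (\<lambda>y. - x + y)) ?Q" by (simp only: tr)
    also have "\<dots> = emeasure ?M {y. x - y \<in> ?Q}"
      by (subst emeasure_distr) (auto simp: vimage_def norm_minus_commute)
    finally show ?thesis ..
  qed
  have 2: "emeasure ?M {y. x + y \<in> A} = emeasure ?M A" for x
  proof -
    have "emeasure ?M A = emeasure (distr ?M borel (\<lambda>y. x + y)) A" by (simp only: tr)
    also have "\<dots> = emeasure ?M {y. x + y \<in> A}"
      by (subst emeasure_distr) (auto simp: vimage_def)
    finally show ?thesis ..
  qed
  have 3: "(\<integral>\<^sup>+x. indicator A x * indicator ?Q (x - y) \<partial>lborel)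
      = (\<integral>\<^sup>+x. indicator A (x + y) * indicator ?Q x \<partial>lborel)" for y :: 'a
  proof -
    have "(\<integral>\<^sup>+x. indicator A x * indicator ?Q (x - y) \<partial>lborel)
        = (\<integral>\<^sup>+x. indicator A x * indicator ?Q (x - y) \<partial>distr lborel borel ((+) y))"
      by (simp only: lborel_distr_plus)
    also have "\<dots> = (\<integral>\<^sup>+x. indicator A (y + x) * indicator ?Q (y + x - y) \<partial>lborel)"
      by (intro nn_integral_distr) measurable
    finally show ?thesis by (simp add: add.commute)
  qed
  have "emeasure lborel A * emeasure ?M ?Q
      = (\<integral>\<^sup>+x. \<integral>\<^sup>+y. indicator A x * indicator ?Q (x - y) \<partial>?M \<partial>lborel)"
  proof -
    have "(\<integral>\<^sup>+y. indicator A x * indicator ?Q (x - y) \<partial>?M) = indicator A x * emeasure ?M ?Q" for x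
    proof -
      have "(\<integral>\<^sup>+y. indicator ?Q (x - y) \<partial>?M) = (\<integral>\<^sup>+y. indicator {y. x - y \<in> ?Q} y \<partial>?M)"
        by (intro nn_integral_cong) (auto simp: indicator_def)
      also have "\<dots> = emeasure ?M {y. x - y \<in> ?Q}"
        by (intro nn_integral_indicator) (simp, measurable)
      also note 1
      finally show ?thesis by (subst nn_integral_cmult) auto
    qed
    then show ?thesis by (simp add: nn_integral_multc)
  qed
  also have "\<dots> = (\<integral>\<^sup>+y. \<integral>\<^sup>+x. indicator A x * indicator ?Q (x - y) \<partial>lborel \<partial>?M)"
    by (intro P.Fubini'[symmetric]) measurable
  also have "\<dots> = (\<integral>\<^sup>+y. \<integral>\<^sup>+x. indicator A (x + y) * indicator ?Q x \<partial>lborel \<partial>?M)"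
    by (simp only: 3)
  also have "\<dots> = (\<integral>\<^sup>+x. \<integral>\<^sup>+y. indicator A (x + y) * indicator ?Q x \<partial>?M \<partial>lborel)"
    by (intro P.Fubini') measurable
  also have "\<dots> = (\<integral>\<^sup>+x. emeasure ?M A * indicator ?Q x \<partial>lborel)"
  proof (intro nn_integral_cong)
    fix x
    have "(\<integral>\<^sup>+y. indicator A (x + y) \<partial>?M) = (\<integral>\<^sup>+y. indicator {y. x + y \<in> A} y \<partial>?M)"
      by (intro nn_integral_cong) (auto simp: indicator_def)
    also have "\<dots> = emeasure ?M {y. x + y \<in> A}"
      by (intro nn_integral_indicator) (simp, measurable)
    finally show "(\<integral>\<^sup>+y. indicator A (x + y) * indicator ?Q x \<partial>?M) = emeasure ?M A * indicator ?Q x"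
      by (subst nn_integral_multc) (auto simp: 2)
  qed
  also have "\<dots> = emeasure lborel ?Q * emeasure ?M A"
    by (subst nn_integral_cmult) (auto simp: mult.commute)
  finally show ?thesis .
qed

text \<open>The constant precedes the quantifier over \<open>e\<close>. The exchange formula
  determines it as a ratio of two measures of the unit ball, and the one belonging to
  \<open>e\<close> is the number \<open>q\<close>, whose definition mentions coordinates
  only.\<close>

lemma coord_measure_proportional_lborel:
  "\<exists>c>0. \<forall>e :: nat \<Rightarrow> 'a::euclidean_space. orthonormal_seq e DIM('a) \<longrightarrow>
     (\<forall>A\<in>sets borel. emeasure (coord_measure e DIM('a)) A = ennreal c * emeasure lborel A)"
proof (cases "\<exists>e :: nat \<Rightarrow> 'a. orthonormal_seq e DIM('a)")
  case False
  then show ?thesis by (intro exI[of _ 1]) auto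
next
  case True
  then obtain e0 :: "nat \<Rightarrow> 'a" where e0: "orthonormal_seq e0 DIM('a)" by auto
  define q where "q = emeasure (coord_space DIM('a)) {t\<in>space (coord_space DIM('a)). sqrt (\<Sum>i<DIM('a). (t i)\<^sup>2) \<le> 1}"
  define l where "l = emeasure lborel (cball 0 1 :: 'a set)"
  have q: "emeasure (coord_measure e DIM('a)) (cball 0 1) = q" if "orthonormal_seq e DIM('a)" for e :: "nat \<Rightarrow> 'a"
    unfolding q_def by (subst emeasure_coord_measure) (auto simp: norm_synthesis[OF that])
  have q_fin: "q < \<infinity>"
    using coord_measure_cball_le[OF e0, of 1 0] q[OF e0] by (simp add: le_less_trans)
  have "0 < ennreal ((2 * 1 / DIM('a)) ^ DIM('a))" by simp
  also have "\<dots> \<le> emeasure (coord_measure e0 DIM('a)) (cball 0 1)"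
    by (rule coord_measure_cball_ge[OF e0, where s="\<lambda>_. 0"]) auto
  finally have q_pos: "q > 0" using q[OF e0] by simp
  have l_fin: "l < \<infinity>" unfolding l_def using emeasure_lborel_cball_finite by blast
  have l_pos: "l > 0"
  proof -
    have "measure lborel (cball 0 1 :: 'a set) > 0" by (rule content_cball_pos) simp
    then have "l \<noteq> 0" by (auto simp: l_def measure_def)
    then show ?thesis by (simp add: zero_less_iff_neq_zero)
  qed
  define c where "c = enn2real (q / l)"
  have ql: "q / l < \<infinity>" "q / l > 0" using q_fin l_pos l_fin q_pos
    by (auto simp: ennreal_divide_eq_top_iff less_top[symmetric] ennreal_zero_less_divide)
  then have c: "c > 0" "ennreal c = q / l"
    by (auto simp: c_def enn2real_positive_iff)
  show ?thesis
  proof (intro exI[of _ c] conjI allI impI ballI)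
    fix e :: "nat \<Rightarrow> 'a" and A :: "'a set"
    assume e: "orthonormal_seq e DIM('a)" and A: "A \<in> sets borel"
    have "emeasure lborel A * q = l * emeasure (coord_measure e DIM('a)) A"
      using coord_measure_lborel_exchange[OF e A] q[OF e] by (simp add: l_def)
    then have "q * emeasure lborel A / l = emeasure (coord_measure e DIM('a)) A"
      using ennreal_mult_divide_eq[of l "emeasure (coord_measure e DIM('a)) A"] l_pos l_fin
      by (simp add: mult.commute)
    then show "emeasure (coord_measure e DIM('a)) A = ennreal c * emeasure lborel A"
      by (simp add: c(2) ennreal_divide_times mult.commute ennreal_times_divide)
  qed (rule c(1))
qed

section \<open>Orthonormal bases of subspaces and orthogonal projections\<close>

lemma orthonormal_seq_exists:
  assumes "subspace (V :: 'a::euclidean_space set)"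
  shows "\<exists>e. (\<forall>i<dim V. e i \<in> V) \<and> orthonormal_seq e (dim V) \<and> span (e ` {..<dim V}) = V"
proof -
  obtain B where B: "B \<subseteq> V" "pairwise orthogonal B" "\<And>x. x \<in> B \<Longrightarrow> norm x = 1"
      "independent B" "card B = dim V" "span B = V"
    using orthonormal_basis_subspace[OF assms] by metis
  have "finite B" using B(4) independent_imp_finite by blast
  then obtain e where e: "bij_betw e {..<dim V} B"
    using ex_bij_betw_nat_finite[of B] B(5) by (auto simp: atLeast0LessThan)
  have inB: "e i \<in> B" if "i < dim V" for i using e that by (auto simp: bij_betw_def)
  have "orthonormal_seq e (dim V)"
    unfolding orthonormal_seq_def
  proof (intro allI impI)
    fix i j assume ij: "i < dim V" "j < dim V"
    have "e i = e j \<longleftrightarrow> i = j" using e ij by (auto simp: bij_betw_def inj_on_def)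
    then show "e i \<bullet> e j = (if i = j then 1 else 0)"
      using B(2) B(3)[OF inB[OF ij(1)]] inB ij
      by (auto simp: pairwise_def orthogonal_def norm_eq_1)
  qed
  moreover have "e ` {..<dim V} = B" using e by (simp add: bij_betw_def)
  ultimately show ?thesis using inB B by (intro exI[of _ e]) auto
qed

lemma onb_props:
  assumes "subspace (V :: 'a::euclidean_space set)"
  shows "\<And>i. i < dim V \<Longrightarrow> onb V i \<in> V" "orthonormal_seq (onb V) (dim V)"
    "span (onb V ` {..<dim V}) = V"
  using someI_ex[OF orthonormal_seq_exists[OF assms]]
  unfolding onb_def[symmetric] orthonormal_seq_def by blast+

lemma lebV_eq_coord_measure: "lebV V = coord_measure (onb V) (dim V)"
  by (simp add: lebV_def coord_measure_def)

lemma proj_eqI: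
  assumes "subspace V" "v \<in> V" "\<And>w. w \<in> V \<Longrightarrow> (x - v) \<bullet> w = 0"
  shows "proj V x = v"
  unfolding proj_def
proof (rule the_equality)
  fix u assume u: "u \<in> V \<and> (\<forall>w\<in>V. (x - u) \<bullet> w = 0)"
  have "v - u \<in> V" using u assms subspace_diff by blast
  then have "(x - u) \<bullet> (v - u) = 0" "(x - v) \<bullet> (v - u) = 0" using u assms by auto
  then have "(v - u) \<bullet> (v - u) = 0" by (simp add: inner_diff_left)
  then show "u = v" by simp
qed (use assms in auto)

lemma proj_expansion:
  assumes V: "subspace (V :: 'a::euclidean_space set)"
  shows "proj V x = (\<Sum>i<dim V. (x \<bullet> onb V i) *\<^sub>R onb V i)"
proof (rule proj_eqI[OF V])
  let ?v = "\<Sum>i<dim V. (x \<bullet> onb V i) *\<^sub>R onb V i"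
  show "?v \<in> V" using onb_props(1)[OF V] by (intro subspace_sum subspace_mul V) auto
  fix w assume "w \<in> V"
  then have "w \<in> span (onb V ` {..<dim V})" using onb_props(3)[OF V] by simp
  then show "(x - ?v) \<bullet> w = 0"
  proof (induction rule: span_induct_alt)
    case (step c z y)
    then obtain j where "j < dim V" "z = onb V j" by auto
    then have "(x - ?v) \<bullet> z = 0"
      by (simp add: inner_diff_left inner_synthesis[OF onb_props(2)[OF V]])
    then show ?case using step by (simp add: inner_add_right)
  qed simp
qed

lemma proj_in: "subspace V \<Longrightarrow> proj V x \<in> V"
  unfolding proj_expansion using onb_props(1) by (intro subspace_sum subspace_mul) auto

lemma inner_proj_residual:
  assumes V: "subspace (V :: 'a::euclidean_space set)" and w: "w \<in> V"
  shows "(x - proj V x) \<bullet> w = 0"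
proof -
  have "(x - proj V x) \<bullet> onb V i = 0" if "i < dim V" for i
    using that by (simp add: inner_diff_left proj_expansion[OF V] inner_synthesis[OF onb_props(2)[OF V]])
  then have "(x - proj V x) \<bullet> (\<Sum>i<dim V. (w \<bullet> onb V i) *\<^sub>R onb V i) = 0"
    by (simp add: inner_sum_right)
  moreover have "(\<Sum>i<dim V. (w \<bullet> onb V i) *\<^sub>R onb V i) = w"
    using orthonormal_seq_expansion[OF onb_props(2)[OF V]] onb_props(3)[OF V] w by simp
  ultimately show ?thesis by simp
qed

lemma linear_proj: "subspace V \<Longrightarrow> linear (proj V)"
  by (rule linearI) (simp_all add: proj_expansion inner_add_left scaleR_add_left sum.distrib scaleR_sum_right)

lemma norm_proj_le:
  assumes V: "subspace (V :: 'a::euclidean_space set)" shows "norm (proj V x) \<le> norm x"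
proof -
  have "(x - proj V x) \<bullet> proj V x = 0" by (rule inner_proj_residual[OF V proj_in[OF V]])
  then have "proj V x \<bullet> proj V x = x \<bullet> proj V x" by (simp add: inner_diff_left)
  also have "\<dots> \<le> norm x * norm (proj V x)" by (rule norm_cauchy_schwarz)
  finally have "norm (proj V x) * norm (proj V x) \<le> norm x * norm (proj V x)"
    by (simp add: dot_square_norm power2_eq_square)
  then show ?thesis by (cases "proj V x = 0") auto
qed

lemma compact_proj_image:
  assumes V: "subspace (V :: 'a::euclidean_space set)" and "compact K"
  shows "compact (proj V ` K)"
  using assms linear_continuous_on[of "proj V"] linear_proj[OF V]
  by (intro compact_continuous_image) (auto simp: linear_conv_bounded_linear)

text \<open>An orthonormal basis of the orthogonal complement is appended to \<open>onb V\<close>.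
  In these coordinates \<open>proj V\<close> simply drops every coordinate from index
  \<open>dim V\<close> on, which is what both the comparison of null sets and the slab volumes
  exploit.\<close>

lemma orthonormal_extension_onb:
  assumes V: "subspace (V :: 'a::euclidean_space set)"
  shows "\<exists>e. orthonormal_seq e DIM('a) \<and> (\<forall>i<dim V. e i = onb V i)"
proof -
  define W where "W = {y. \<forall>x\<in>V. orthogonal x y}"
  have W: "subspace W" unfolding W_def by (rule subspace_orthogonal_to_vectors)
  have dW: "dim W + dim V = DIM('a)"
    using dim_subspace_orthogonal_to_vectors[OF V subspace_UNIV] by (simp add: W_def)
  define e where "e i = (if i < dim V then onb V i else onb W (i - dim V))" for i
  have o: "onb V i \<bullet> onb W j = 0" "onb W j \<bullet> onb V i = 0" if "i < dim V" "j < dim W" for i j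
    using onb_props(1)[OF V that(1)] onb_props(1)[OF W that(2)]
    by (auto simp: W_def orthogonal_def inner_commute)
  have "orthonormal_seq e DIM('a)"
    unfolding orthonormal_seq_def e_def
    using onb_props(2)[OF V] onb_props(2)[OF W] dW
    by (auto simp: orthonormal_seq_def o)
  then show ?thesis by (intro exI[of _ e]) (auto simp: e_def)
qed

lemma proj_synthesis:
  assumes V: "subspace (V :: 'a::euclidean_space set)"
    and e: "orthonormal_seq e DIM('a)" "\<And>i. i < dim V \<Longrightarrow> e i = onb V i"
  shows "proj V (\<Sum>i<DIM('a). t i *\<^sub>R e i) = (\<Sum>i<dim V. t i *\<^sub>R onb V i)"
proof -
  have d: "dim V \<le> DIM('a)" by (rule dim_subset_UNIV)
  show ?thesis
    unfolding proj_expansion[OF V] using d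
    by (intro sum.cong) (auto simp: e(2)[symmetric] inner_synthesis[OF e(1)])
qed

lemma measurable_proj [measurable]: "subspace V \<Longrightarrow> proj V \<in> borel_measurable borel"
  by (subst measurable_cong[OF proj_expansion]) auto

text \<open>In coordinates adapted to V the set on the right is the coordinate set of S times the
  whole complementary space. Its measure is thus \<open>lebV V\<close> of S times a nonzero,
  possibly infinite, factor, and with 0 times infinity equal to 0 it vanishes exactly when the
  measure of S does. The gain is that the right side involves one measure for all V.\<close>

lemma lebV_null_iff:
  assumes V: "subspace (V :: 'a::euclidean_space set)" and S: "S \<in> sets borel"
  shows "emeasure (lebV V) S = 0 \<longleftrightarrow> emeasure lborel {z. proj V z \<in> S} = 0"
proof -
  obtain e where e: "orthonormal_seq e DIM('a)" "\<And>i. i < dim V \<Longrightarrow> e i = onb V i"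
    using orthonormal_extension_onb[OF V] by auto
  obtain c where c: "c > 0" "\<And>A. A \<in> sets borel \<Longrightarrow>
      emeasure (coord_measure e DIM('a)) A = ennreal c * emeasure lborel A"
    using coord_measure_proportional_lborel[where 'a='a] e(1) by metis
  let ?n = "DIM('a)" and ?m = "dim V"
  have d: "?m \<le> ?n" by (rule dim_subset_UNIV)
  have pS: "{z. proj V z \<in> S} \<in> sets borel"
    using measurable_sets[OF measurable_proj[OF V] S] by (simp add: vimage_def)
  interpret product_sigma_finite "\<lambda>_::nat. lborel :: real measure"
    by (unfold_locales)
  let ?I = "{..<?m}" and ?J = "{?m..<?n}"
  let ?A = "{t\<in>space (coord_space ?m). (\<Sum>i<?m. t i *\<^sub>R onb V i) \<in> S}"
  let ?N = "PiM ?J (\<lambda>_. lborel :: real measure)"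
  interpret J: sigma_finite_measure ?N by (intro sigma_finite) auto
  have IJ: "?I \<union> ?J = {..<?n}" "?I \<inter> ?J = {}" using d by auto
  have A: "?A \<in> sets (coord_space ?m)" using S by measurable
  have m1: "(\<lambda>t. \<Sum>i<?m. t i *\<^sub>R onb V i) \<in> borel_measurable (coord_space ?n)"
    using d by (intro borel_measurable_sum borel_measurable_scaleR measurable_component_singleton) auto
  let ?B = "{t\<in>space (coord_space ?n). (\<Sum>i<?m. t i *\<^sub>R onb V i) \<in> S}"
  have B: "?B \<in> sets (coord_space ?n)"
    using measurable_sets[OF m1 S] by (simp add: vimage_def Int_def conj_commute)
  have mm: "merge ?I ?J \<in> measurable (coord_space ?m \<Otimes>\<^sub>M ?N) (coord_space ?n)"
    using measurable_merge[of ?I ?J "\<lambda>_. lborel :: real measure"] IJ by simp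
  have "emeasure (coord_measure e ?n) {z. proj V z \<in> S} = emeasure (coord_space ?n) ?B"
    using pS by (subst emeasure_coord_measure) (auto simp: proj_synthesis[OF V e])
  also have "\<dots> = emeasure (distr (coord_space ?m \<Otimes>\<^sub>M ?N) (coord_space ?n) (merge ?I ?J)) ?B"
    using distr_merge[of ?I ?J] IJ by simp
  also have "\<dots> = emeasure (coord_space ?m \<Otimes>\<^sub>M ?N) (?A \<times> space ?N)"
  proof (subst emeasure_distr[OF mm B], rule arg_cong[where f="emeasure _"])
    have eq: "(\<Sum>i<?m. merge ?I ?J (s, u) i *\<^sub>R onb V i) = (\<Sum>i<?m. s i *\<^sub>R onb V i)" for s u
      by (intro sum.cong) (auto simp: merge_def)
    have sp: "merge ?I ?J su \<in> space (coord_space ?n)" if "su \<in> space (coord_space ?m \<Otimes>\<^sub>M ?N)" for su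
      using measurable_space[OF mm that] .
    show "merge ?I ?J -` ?B \<inter> space (coord_space ?m \<Otimes>\<^sub>M ?N) = ?A \<times> space ?N"
      using sp by (auto simp: eq space_pair_measure)
  qed
  also have "\<dots> = emeasure (coord_space ?m) ?A * emeasure ?N (space ?N)"
    using A by (intro J.emeasure_pair_measure_Times) auto
  also have "emeasure (coord_space ?m) ?A = emeasure (lebV V) S"
    using S by (simp add: lebV_eq_coord_measure emeasure_coord_measure)
  finally have 1: "emeasure (coord_measure e ?n) {z. proj V z \<in> S}
      = emeasure (lebV V) S * emeasure ?N (space ?N)" .
  \<comment> \<open>A unit cube keeps the complementary factor away from zero; the computation
    includes the empty index set, where the factor is 1.\<close>
  have "emeasure ?N (\<Pi>\<^sub>E i\<in>?J. {0..1}) \<le> emeasure ?N (space ?N)"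
    by (intro emeasure_space)
  moreover have "emeasure ?N (\<Pi>\<^sub>E i\<in>?J. {0..1}) = 1"
    by (subst emeasure_PiM) auto
  ultimately have "emeasure ?N (space ?N) \<noteq> 0" by (metis not_one_le_zero)
  then show ?thesis using 1 c(2)[OF pS] c(1) by (auto simp: mult_eq_0_iff)
qed

lemma proj_scaleR: "subspace V \<Longrightarrow> proj V (c *\<^sub>R z) = c *\<^sub>R proj V z"
  using linear_proj linear_scale by blast

lemma proj_diff: "subspace V \<Longrightarrow> proj V (x - y) = proj V x - proj V y"
  using linear_proj linear_diff by blast

section \<open>Orthogonal maps and volumes of slabs\<close>

text \<open>The reflection in the hyperplane orthogonal to \<open>a - b\<close> exchanges two
  vectors of equal length. For \<open>a = b\<close> the subtracted term is zero and the map is the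
  identity.\<close>

lemma orthogonal_transformation_exists_mapping:
  fixes a b :: "'a::euclidean_space"
  assumes "norm a = norm b"
  shows "\<exists>T. orthogonal_transformation T \<and> T a = b"
proof -
  define u where "u = a - b"
  define T where "T x = x - (2 * (x \<bullet> u) / (u \<bullet> u)) *\<^sub>R u" for x
  have "linear T"
    by (rule linearI) (auto simp: T_def algebra_simps add_divide_distrib inner_add_left)
  moreover have "T v \<bullet> T w = v \<bullet> w" for v w
  proof (cases "u = 0")
    case False
    then have "u \<bullet> u \<noteq> 0" by simp
    then show ?thesis
      by (simp add: T_def inner_diff_left inner_diff_right inner_commute field_simps)
  qed (simp add: T_def)
  moreover have "T a = b"
  proof (cases "u = 0")
    case False
    have "a \<bullet> a = b \<bullet> b" using assms by (simp add: norm_eq)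
    then have "u \<bullet> u = 2 * (a \<bullet> u)"
      by (simp add: u_def inner_diff_left inner_diff_right inner_commute)
    moreover have "u \<bullet> u \<noteq> 0" using False by simp
    ultimately have "2 * (a \<bullet> u) / (u \<bullet> u) = 1" by simp
    then have "T a = a - u" unfolding T_def by (simp only: scaleR_one)
    then show ?thesis by (simp add: u_def)
  qed (simp add: T_def u_def)
  ultimately show ?thesis by (auto simp: orthogonal_transformation_def)
qed

lemma proj_orthogonal_transformation:
  assumes T: "orthogonal_transformation T" and V: "subspace V"
  shows "proj (T ` V) (T z) = T (proj V z)"
proof (rule proj_eqI)
  have lin: "linear T" using T by (rule orthogonal_transformation_linear)
  show "subspace (T ` V)" using lin V by (rule linear_subspace_image)
  show "T (proj V z) \<in> T ` V" using proj_in[OF V] by auto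
  fix w assume "w \<in> T ` V"
  then obtain v where "v \<in> V" "w = T v" by auto
  then show "(T z - T (proj V z)) \<bullet> w = 0"
    using inner_proj_residual[OF V \<open>v \<in> V\<close>] T by (simp add: linear_diff[OF lin, symmetric] orthogonal_transformation_def)
qed

lemma prod_if_less: "m \<le> n \<Longrightarrow> (\<Prod>i<n. if i < m then x else y) = x ^ m * (y::real) ^ (n - m)"
proof -
  assume "m \<le> n"
  then have "{..<n} \<inter> {i. i < m} = {..<m}" "{..<n} \<inter> - {i. i < m} = {m..<n}" by auto
  then show ?thesis by (simp add: prod.If_cases)
qed

lemma measurable_norm_proj_set [measurable]:
  "subspace V \<Longrightarrow> {w. norm (proj V w) \<le> d} \<in> sets borel"
proof -
  assume [measurable]: "subspace V"
  have [measurable]: "proj V \<in> borel_measurable borel" by (rule measurable_proj) fact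
  show ?thesis by measurable
qed

text \<open>In an adapted basis the slab is comparable to a box with \<open>m\<close> sides of order
  \<open>d\<close> and all other sides of order one. The lower bound stays away from the origin
  because it will be compared with \<open>hit\<close> at vectors of norm at least 1/2.\<close>

lemma lborel_slab_bounds:
  assumes m: "m < DIM('a::euclidean_space)"
  shows "\<exists>C>0. \<forall>V d. subspace (V :: 'a set) \<longrightarrow> dim V = m \<longrightarrow> d > 0 \<longrightarrow>
     emeasure lborel (cball 0 1 \<inter> {w. norm (proj V w) \<le> d}) \<le> ennreal (C * d ^ m)"
   "\<exists>c>0. \<forall>V d. subspace (V :: 'a set) \<longrightarrow> dim V = m \<longrightarrow> d > 0 \<longrightarrow> d \<le> 1 \<longrightarrow>
     ennreal (c * d ^ m) \<le> emeasure lborel ((cball 0 1 - ball 0 (1/2)) \<inter> {w. norm (proj V w) \<le> d})"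
proof -
  let ?n = "DIM('a)"
  obtain k where k: "k > 0" "\<And>(e :: nat \<Rightarrow> 'a) A. orthonormal_seq e ?n \<Longrightarrow> A \<in> sets borel \<Longrightarrow>
      emeasure (coord_measure e ?n) A = ennreal k * emeasure lborel A"
    using coord_measure_proportional_lborel[where 'a='a] by blast
  have k_inv: "emeasure lborel A = ennreal (1 / k) * emeasure (coord_measure e ?n) A"
    if "orthonormal_seq e ?n" "A \<in> sets borel" for e :: "nat \<Rightarrow> 'a" and A
    using k(1) by (simp add: k(2)[OF that] mult.assoc[symmetric] ennreal_mult[symmetric])
  show "\<exists>C>0. \<forall>V d. subspace (V :: 'a set) \<longrightarrow> dim V = m \<longrightarrow> d > 0 \<longrightarrow>
     emeasure lborel (cball 0 1 \<inter> {w. norm (proj V w) \<le> d}) \<le> ennreal (C * d ^ m)"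
  proof (intro exI[of _ "1 / k * (2 ^ m * 2 ^ (?n - m))"] conjI allI impI)
    show "0 < 1 / k * (2 ^ m * 2 ^ (?n - m))" using k by simp
    fix V :: "'a set" and d :: real
    assume V: "subspace V" and dimV: "dim V = m" and d: "d > 0"
    let ?A = "cball 0 1 \<inter> {w. norm (proj V w) \<le> d}"
    obtain e where e: "orthonormal_seq e ?n" "\<And>i. i < dim V \<Longrightarrow> e i = onb V i"
      using orthonormal_extension_onb[OF V] by auto
    have A: "?A \<in> sets borel" using measurable_norm_proj_set[OF V] by simp
    have "emeasure (coord_measure e ?n) ?A \<le> ennreal (\<Prod>i<?n. (if i < m then d else 1) - (if i < m then -d else -1))"
    proof (rule coord_measure_le_box[OF A])
      fix t assume t: "(\<Sum>i<?n. t i *\<^sub>R e i) \<in> ?A"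
      show "\<forall>i<?n. t i \<in> {if i < m then - d else - 1..if i < m then d else 1}"
      proof (intro allI impI)
        fix j assume j: "j < ?n"
        have "\<bar>(\<Sum>i<?n. t i *\<^sub>R e i) \<bullet> e j\<bar> \<le> norm (\<Sum>i<?n. t i *\<^sub>R e i) * norm (e j)"
          by (rule Cauchy_Schwarz_ineq2)
        then have 1: "\<bar>t j\<bar> \<le> 1" using t norm_orthonormal_seq[OF e(1) j]
          by (simp add: inner_synthesis[OF e(1) j])
        have 2: "\<bar>t j\<bar> \<le> d" if "j < m"
        proof -
          have jV: "j < dim V" using that dimV by simp
          have "\<bar>(\<Sum>i<dim V. t i *\<^sub>R onb V i) \<bullet> onb V j\<bar> \<le> norm (\<Sum>i<dim V. t i *\<^sub>R onb V i) * norm (onb V j)"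
            by (rule Cauchy_Schwarz_ineq2)
          then show ?thesis using t norm_orthonormal_seq[OF onb_props(2)[OF V] jV]
            by (simp add: inner_synthesis[OF onb_props(2)[OF V] jV] proj_synthesis[OF V e])
        qed
        show "t j \<in> {if j < m then - d else - 1..if j < m then d else 1}"
          using 1 2 by (auto simp: abs_le_iff)
      qed
    qed (use d in auto)
    also have "(\<Prod>i<?n. (if i < m then d else 1) - (if i < m then -d else -1)) = (\<Prod>i<?n. if i < m then 2 * d else 2)"
      by (intro prod.cong) auto
    also have "\<dots> = (2 * d) ^ m * 2 ^ (?n - m)" using m by (intro prod_if_less) simp
    finally have "emeasure (coord_measure e ?n) ?A \<le> ennreal ((2 * d) ^ m * 2 ^ (?n - m))" .
    then have "ennreal (1 / k) * emeasure (coord_measure e ?n) ?A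
        \<le> ennreal (1 / k) * ennreal ((2 * d) ^ m * 2 ^ (?n - m))"
      by (rule mult_left_mono) simp
    then show "emeasure lborel ?A \<le> ennreal (1 / k * (2 ^ m * 2 ^ (?n - m)) * d ^ m)"
      using k(1) d by (simp add: k_inv[OF e(1) A] ennreal_mult[symmetric] power_mult_distrib mult_ac)
  qed
  show "\<exists>c>0. \<forall>V d. subspace (V :: 'a set) \<longrightarrow> dim V = m \<longrightarrow> d > 0 \<longrightarrow> d \<le> 1 \<longrightarrow>
     ennreal (c * d ^ m) \<le> emeasure lborel ((cball 0 1 - ball 0 (1/2)) \<inter> {w. norm (proj V w) \<le> d})"
  proof (intro exI[of _ "1 / k * ((1 / (4 * ?n)) ^ m * (1 / (4 * ?n)) ^ (?n - m))"] conjI allI impI)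
    show "0 < 1 / k * ((1 / (4 * ?n)) ^ m * (1 / (4 * ?n)) ^ (?n - m))" using k by simp
    fix V :: "'a set" and d :: real
    assume V: "subspace V" and dimV: "dim V = m" and d: "d > 0" "d \<le> 1"
    let ?A = "(cball 0 1 - ball 0 (1/2)) \<inter> {w. norm (proj V w) \<le> d}"
    obtain e where e: "orthonormal_seq e ?n" "\<And>i. i < dim V \<Longrightarrow> e i = onb V i"
      using orthonormal_extension_onb[OF V] by auto
    have A: "?A \<in> sets borel" using measurable_norm_proj_set[OF V] by simp
    \<comment> \<open>Coordinates count from 0, so \<open>m\<close> is the index of the first
      direction orthogonal to V, present because \<open>m < DIM('a)\<close>. Shifting the box by 1/2
      in this direction keeps it out of the smaller ball and leaves the projections to V
      unchanged.\<close>
    define a where "a i = (if i = m then 1/2 else 0 :: real)" for i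
    \<comment> \<open>With sides at most \<open>1 / (4 * ?n)\<close> the coordinates sum to at most
      1/2 + 1/4, so the box lies in the unit ball.\<close>
    define b where "b i = a i + (if i < m then d / (4 * ?n) else 1 / (4 * ?n))" for i
    have "ennreal (\<Prod>i<?n. b i - a i) \<le> emeasure (coord_measure e ?n) ?A"
    proof (rule coord_measure_ge_box[OF A])
      show "a i \<le> b i" if "i < ?n" for i using d by (simp add: b_def)
      fix t assume t: "\<forall>i<?n. t i \<in> {a i..b i}"
      let ?z = "\<Sum>i<?n. t i *\<^sub>R e i"
      have "d / (4 * real ?n) \<le> 1 / (4 * real ?n)" using d by (simp add: field_simps)
      then have t1: "\<bar>t i\<bar> \<le> a i + 1 / (4 * ?n)" if "i < ?n" for i
        using t[rule_format, OF that] d by (auto simp: a_def b_def abs_le_iff split: if_splits)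
      have "norm ?z \<le> (\<Sum>i<?n. \<bar>t i\<bar>)" by (rule norm_synthesis_le_sum[OF e(1)])
      also have "\<dots> \<le> (\<Sum>i<?n. a i + 1 / (4 * ?n))" using t1 by (intro sum_mono) auto
      also have "\<dots> = 1/2 + 1/4" using m by (simp add: sum.distrib a_def)
      finally have 1: "norm ?z \<le> 1" by simp
      have "\<bar>?z \<bullet> e m\<bar> \<le> norm ?z * norm (e m)" by (rule Cauchy_Schwarz_ineq2)
      then have "\<bar>t m\<bar> \<le> norm ?z"
        using norm_orthonormal_seq[OF e(1) m] by (simp add: inner_synthesis[OF e(1) m])
      moreover have "t m \<ge> 1/2" using t[rule_format, OF m] by (simp add: a_def)
      ultimately have 2: "norm ?z \<ge> 1/2" by simp
      have "norm (proj V ?z) \<le> (\<Sum>i<m. \<bar>t i\<bar>)"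
        using norm_synthesis_le_sum[OF onb_props(2)[OF V], of t] proj_synthesis[OF V e, of t]
        by (simp only: dimV)
      also have "\<dots> \<le> (\<Sum>i<m. d / ?n)"
      proof (intro sum_mono)
        fix i assume i: "i \<in> {..<m}"
        then have "i < ?n" using m by simp
        then have "\<bar>t i\<bar> \<le> d / (4 * ?n)" using t i d by (auto simp: a_def b_def)
        also have "\<dots> \<le> d / ?n" using d by (simp add: field_simps)
        finally show "\<bar>t i\<bar> \<le> d / ?n" .
      qed
      also have "\<dots> = m * d / ?n" by simp
      also have "\<dots> \<le> d" using m d by (simp add: field_simps)
      finally show "?z \<in> ?A" using 1 2 by simp
    qed
    also have "(\<Prod>i<?n. b i - a i) = (\<Prod>i<?n. if i < m then d / (4 * ?n) else 1 / (4 * ?n))"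
      by (intro prod.cong) (auto simp: b_def)
    also have "\<dots> = (d / (4 * ?n)) ^ m * (1 / (4 * ?n)) ^ (?n - m)" using m by (intro prod_if_less) simp
    finally have "ennreal ((d / (4 * ?n)) ^ m * (1 / (4 * ?n)) ^ (?n - m)) \<le> emeasure (coord_measure e ?n) ?A" .
    then have "ennreal (1 / k) * ennreal ((d / (4 * ?n)) ^ m * (1 / (4 * ?n)) ^ (?n - m))
        \<le> ennreal (1 / k) * emeasure (coord_measure e ?n) ?A"
      by (rule mult_left_mono) simp
    then show "ennreal (1 / k * ((1 / (4 * ?n)) ^ m * (1 / (4 * ?n)) ^ (?n - m)) * d ^ m) \<le> emeasure lborel ?A"
      using k(1) d by (simp add: k_inv[OF e(1) A] ennreal_mult[symmetric] power_divide mult_ac)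
  qed
qed

section \<open>Ahlfors regular measures\<close>

lemma cball_borel [measurable]: "cball (x::'a::metric_space) r \<in> sets borel"
  by simp

definition near :: "real \<Rightarrow> 'a::metric_space \<Rightarrow> 'a \<Rightarrow> ennreal" where
  "near d x y = (if dist x y \<le> d then 1 else 0)"

lemma near_commute: "near d x y = near d y x"
  by (simp add: near_def dist_commute)

lemma measurable_near [measurable (raw)]:
  fixes f g :: "'b \<Rightarrow> 'a::{second_countable_topology, metric_space}"
  assumes [measurable]: "f \<in> borel_measurable M" "g \<in> borel_measurable M"
  shows "(\<lambda>x. near d (f x) (g x)) \<in> borel_measurable M"
  unfolding near_def by measurable

lemma nn_integral_near:
  assumes "sets M = sets borel"
  shows "(\<integral>\<^sup>+y. near d x y \<partial>M) = emeasure M (cball x d)"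
proof -
  have "(\<integral>\<^sup>+y. near d x y \<partial>M) = (\<integral>\<^sup>+y. indicator (cball x d) y \<partial>M)"
    by (intro nn_integral_cong) (auto simp: near_def)
  also have "\<dots> = emeasure M (cball x d)" using assms by (intro nn_integral_indicator) auto
  finally show ?thesis .
qed

definition coincidence :: "real \<Rightarrow> 'a::metric_space measure \<Rightarrow> 'a measure \<Rightarrow> ennreal" where
  "coincidence d \<alpha> \<beta> = (\<integral>\<^sup>+x. \<integral>\<^sup>+y. near d x y \<partial>\<beta> \<partial>\<alpha>)"

text \<open>For the radius d = 1/(k+1) the factor is d^(-m), the reciprocal of the order of
  magnitude of an m-dimensional ball. For measures with square integrable densities p and q the
  quantity is therefore bounded, up to constants and in the limit, by the integral of p q.\<close>

definition scaled_coincidence :: "nat \<Rightarrow> nat \<Rightarrow> 'a::metric_space measure \<Rightarrow> 'a measure \<Rightarrow> ennreal" where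
  "scaled_coincidence m k \<alpha> \<beta> = ennreal (real (Suc k) ^ m) * coincidence (1 / Suc k) \<alpha> \<beta>"

lemma ennreal_tendsto_zeroI:
  fixes f :: "nat \<Rightarrow> ennreal"
  assumes "\<And>e. e > 0 \<Longrightarrow> eventually (\<lambda>k. f k \<le> ennreal e) sequentially"
  shows "f \<longlonglongrightarrow> 0"
proof (rule order_tendstoI)
  fix a :: ennreal assume "0 < a"
  then obtain e where e: "0 < e" "ennreal e < a"
  proof (cases a)
    case (real r)
    then show ?thesis using that[of "r / 2"] \<open>0 < a\<close> by (simp add: ennreal_less_iff)
  next
    case top
    then show ?thesis using that[of 1] by simp
  qed
  from assms[OF e(1)] show "eventually (\<lambda>k. f k < a) sequentially"
    by eventually_elim (use e in auto)
qed simp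

lemma ennreal_tendsto_zeroD:
  fixes f :: "nat \<Rightarrow> ennreal"
  assumes "f \<longlonglongrightarrow> 0" "e > 0"
  shows "eventually (\<lambda>k. f k \<le> ennreal e) sequentially"
  using order_tendstoD(2)[OF assms(1), of "ennreal e"] assms(2)
  by (auto elim: eventually_mono)

lemma liminf_ge_of_null_error:
  fixes f o' :: "nat \<Rightarrow> ennreal"
  assumes "\<And>k. a \<le> f k + o' k" "o' \<longlonglongrightarrow> 0"
  shows "a \<le> liminf f"
proof (rule ennreal_le_epsilon)
  fix e :: real assume e: "e > 0"
  have "eventually (\<lambda>k. a - ennreal e \<le> f k) sequentially"
    using ennreal_tendsto_zeroD[OF assms(2) e]
  proof eventually_elim
    case (elim k)
    have "a \<le> f k + ennreal e" using assms(1)[of k] elim by (meson add_left_mono order_trans)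
    then show ?case by (simp add: ennreal_minus_le_iff add.commute)
  qed
  then have "a - ennreal e \<le> liminf f" by (rule Liminf_bounded)
  then show "a \<le> liminf f + ennreal e" by (simp add: ennreal_minus_le_iff add.commute)
qed

lemma limsup_le_of_null_error:
  fixes f o' :: "nat \<Rightarrow> ennreal"
  assumes "\<And>k. f k \<le> a + o' k" "o' \<longlonglongrightarrow> 0"
  shows "limsup f \<le> a"
proof (rule ennreal_le_epsilon)
  fix e :: real assume e: "e > 0"
  have "eventually (\<lambda>k. f k \<le> a + ennreal e) sequentially"
    using ennreal_tendsto_zeroD[OF assms(2) e]
    by eventually_elim (meson assms(1) add_left_mono order_trans)
  then show "limsup f \<le> a + ennreal e" by (rule Limsup_bounded)
qed

text \<open>Abstracts from \<open>lebV V\<close> exactly what the analysis on a plane uses. The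
  measure lives on the ambient space and is concentrated on V, so the lower bound is restricted to
  centres in V while the upper bound holds for all centres. The constants are parameters because
  they later have to be independent of the plane.\<close>

locale ahlfors_regular =
  fixes L :: "'a::euclidean_space measure" and V :: "'a set" and m :: nat and c C :: real
  assumes sets_L [simp, measurable_cong]: "sets L = sets borel"
    and V_borel [measurable]: "V \<in> sets borel" and null: "emeasure L (- V) = 0"
    and c: "c > 0" and C: "C > 0"
    and upper: "\<And>x d. d > 0 \<Longrightarrow> emeasure L (cball x d) \<le> ennreal (C * d ^ m)"
    and lower: "\<And>x d. x \<in> V \<Longrightarrow> d > 0 \<Longrightarrow> ennreal (c * d ^ m) \<le> emeasure L (cball x d)"
begin

lemma space_L [simp]: "space L = UNIV"
  using sets_eq_imp_space_eq[OF sets_L] by simp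

lemma finite_on_bounded:
  assumes "bounded A" shows "emeasure L A < \<infinity>"
proof -
  obtain r where r: "r > 0" "A \<subseteq> cball 0 r"
    using assms by (auto simp: bounded_pos subset_iff)
  have "emeasure L A \<le> emeasure L (cball 0 r)" using r by (intro emeasure_mono) auto
  also have "\<dots> \<le> ennreal (C * r ^ m)" by (rule upper[OF r(1)])
  finally show ?thesis by (simp add: le_less_trans)
qed

sublocale sigma_finite_measure L
  using finite_on_bounded[OF bounded_cball] by (intro sigma_finite_ballsI) auto

lemma AE_V: "AE x in L. x \<in> V"
  using null by (intro AE_I[where N="-V"]) auto

lemma near_integral_le:
  assumes [measurable]: "f \<in> borel_measurable L" and d: "d > 0"
  shows "(\<integral>\<^sup>+x. \<integral>\<^sup>+y. near d x y * f x \<partial>L \<partial>L) \<le> ennreal (C * d ^ m) * (\<integral>\<^sup>+x. f x \<partial>L)"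
    and "(\<integral>\<^sup>+x. \<integral>\<^sup>+y. near d x y * f y \<partial>L \<partial>L) \<le> ennreal (C * d ^ m) * (\<integral>\<^sup>+x. f x \<partial>L)"
proof -
  interpret P: pair_sigma_finite L L ..
  have "(\<integral>\<^sup>+x. \<integral>\<^sup>+y. near d x y * f x \<partial>L \<partial>L) = (\<integral>\<^sup>+x. emeasure L (cball x d) * f x \<partial>L)"
    by (intro nn_integral_cong) (simp add: nn_integral_multc nn_integral_near)
  also have "\<dots> \<le> (\<integral>\<^sup>+x. ennreal (C * d ^ m) * f x \<partial>L)"
    using upper[OF d] by (intro nn_integral_mono mult_right_mono) auto
  also have "\<dots> = ennreal (C * d ^ m) * (\<integral>\<^sup>+x. f x \<partial>L)" by (simp add: nn_integral_cmult)
  finally show 1: "(\<integral>\<^sup>+x. \<integral>\<^sup>+y. near d x y * f x \<partial>L \<partial>L) \<le> ennreal (C * d ^ m) * (\<integral>\<^sup>+x. f x \<partial>L)" .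
  have "(\<integral>\<^sup>+x. \<integral>\<^sup>+y. near d x y * f y \<partial>L \<partial>L) = (\<integral>\<^sup>+y. \<integral>\<^sup>+x. near d x y * f y \<partial>L \<partial>L)"
    by (rule P.Fubini'[symmetric]) measurable
  also have "\<dots> = (\<integral>\<^sup>+x. \<integral>\<^sup>+y. near d x y * f x \<partial>L \<partial>L)" by (simp only: near_commute)
  finally show "(\<integral>\<^sup>+x. \<integral>\<^sup>+y. near d x y * f y \<partial>L \<partial>L) \<le> ennreal (C * d ^ m) * (\<integral>\<^sup>+x. f x \<partial>L)"
    using 1 by simp
qed

lemma near_integral_ge:
  assumes [measurable]: "f \<in> borel_measurable L" and d: "d > 0"
  shows "ennreal (c * d ^ m) * (\<integral>\<^sup>+x. f x \<partial>L) \<le> (\<integral>\<^sup>+x. \<integral>\<^sup>+y. near d x y * f x \<partial>L \<partial>L)"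
proof -
  have "ennreal (c * d ^ m) * (\<integral>\<^sup>+x. f x \<partial>L) = (\<integral>\<^sup>+x. ennreal (c * d ^ m) * f x \<partial>L)"
    by (simp add: nn_integral_cmult)
  also have "\<dots> \<le> (\<integral>\<^sup>+x. emeasure L (cball x d) * f x \<partial>L)"
    using AE_V by (intro nn_integral_mono_AE) (auto elim!: eventually_mono intro!: mult_right_mono lower d)
  also have "\<dots> = (\<integral>\<^sup>+x. \<integral>\<^sup>+y. near d x y * f x \<partial>L \<partial>L)"
    by (intro nn_integral_cong) (simp add: nn_integral_multc nn_integral_near)
  finally show ?thesis .
qed

lemma coincidence_density:
  assumes [measurable]: "p \<in> borel_measurable L" "q \<in> borel_measurable L"
  shows "coincidence d (density L p) (density L q) = (\<integral>\<^sup>+x. \<integral>\<^sup>+y. near d x y * (p x * q y) \<partial>L \<partial>L)"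
proof -
  have "coincidence d (density L p) (density L q)
      = (\<integral>\<^sup>+x. p x * (\<integral>\<^sup>+y. q y * near d x y \<partial>L) \<partial>L)"
    unfolding coincidence_def by (simp add: nn_integral_density)
  also have "\<dots> = (\<integral>\<^sup>+x. \<integral>\<^sup>+y. near d x y * (p x * q y) \<partial>L \<partial>L)"
    by (intro nn_integral_cong) (simp add: nn_integral_cmult[symmetric] mult_ac)
  finally show ?thesis .
qed

text \<open>The closed neighbourhoods of a compact set decrease to the set, hence to nothing once
  the set is removed. They are bounded, which supplies the finite measure that continuity from above
  requires.\<close>

lemma neighbourhood_measure_tendsto:
  assumes K: "compact K" "K \<noteq> {}"
  shows "(\<lambda>k. emeasure L ({x. infdist x K \<le> 1 / Suc k} - K)) \<longlonglongrightarrow> 0"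
proof -
  let ?N = "\<lambda>k. {x. infdist x K \<le> 1 / Suc k} - K"
  have cK: "compact {x. infdist x K \<le> 1 / Suc k}" for k
    using K by (intro compact_infdist_le) auto
  have sets: "?N k \<in> sets L" for k
    using cK[of k] K(1) by (auto dest: borel_compact)
  have "(\<lambda>k. emeasure L (?N k)) \<longlonglongrightarrow> emeasure L (\<Inter>k. ?N k)"
  proof (rule Lim_emeasure_decseq)
    show "range ?N \<subseteq> sets L" using sets by auto
    show "decseq ?N"
    proof (rule decseq_SucI)
      fix k
      have "1 / real (Suc (Suc k)) \<le> 1 / real (Suc k)" by (simp add: field_simps)
      then show "?N (Suc k) \<subseteq> ?N k" by (auto intro: order_trans simp del: of_nat_Suc)
    qed
    show "emeasure L (?N k) \<noteq> \<infinity>" for k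
      using finite_on_bounded[OF bounded_subset[OF compact_imp_bounded[OF cK[of k]] Diff_subset], of K]
      by (simp add: less_top)
  qed
  also have "(\<Inter>k. ?N k) = {}"
  proof -
    have "x \<in> K" if x: "\<And>k. infdist x K \<le> 1 / Suc k" for x
    proof -
      have "infdist x K \<le> 0"
        by (rule LIMSEQ_le_const[OF LIMSEQ_inverse_real_of_nat]) (use x in \<open>auto simp: inverse_eq_divide\<close>)
      then have "infdist x K = 0" using infdist_nonneg[of x K] by simp
      then show ?thesis using K in_closed_iff_infdist_zero compact_imp_closed by blast
    qed
    then show ?thesis by auto
  qed
  finally show ?thesis by simp
qed

section \<open>Oscillation of square integrable functions at small scales\<close>

text \<open>The averaged squared oscillation of an \<open>L\<^sup>2\<close> function at scale \<open>1/(k+1)\<close>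
  tends to zero; it controls the error made when \<open>p x * q y\<close> is replaced by
  \<open>p y * q y\<close> in the coincidence integral.\<close>

definition oscillation :: "nat \<Rightarrow> ('a \<Rightarrow> real) \<Rightarrow> ennreal" where
  "oscillation k p = ennreal (real (Suc k) ^ m) *
     (\<integral>\<^sup>+x. \<integral>\<^sup>+y. near (1 / Suc k) x y * ennreal ((p x - p y)\<^sup>2) \<partial>L \<partial>L)"

lemma scale_cancel: "ennreal (real (Suc k) ^ m) * (ennreal (a * (1 / Suc k) ^ m) * x) = ennreal a * x" if "a \<ge> 0"
proof -
  have "real (Suc k) ^ m * (a * (1 / Suc k) ^ m) = a"
    by (simp add: power_divide del: of_nat_Suc)
  then have "ennreal (real (Suc k) ^ m) * ennreal (a * (1 / Suc k) ^ m) = ennreal a"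
    using that by (subst ennreal_mult[symmetric]) (auto simp del: of_nat_Suc)
  then show ?thesis by (simp only: mult.assoc[symmetric])
qed

text \<open>Uniformity in \<open>k\<close> is the point: it allows convergence to zero to be
  verified on a dense class only. The 4 is the 2 from (a - b)^2 <= 2 a^2 + 2 b^2, counted once for
  each of the two variables.\<close>

lemma oscillation_le:
  assumes [measurable]: "p \<in> borel_measurable borel"
  shows "oscillation k p \<le> ennreal (4 * C) * (\<integral>\<^sup>+x. ennreal ((p x)\<^sup>2) \<partial>L)"
proof -
  let ?d = "1 / real (Suc k)"
  have *: "(a - b)\<^sup>2 \<le> 2 * a\<^sup>2 + 2 * b\<^sup>2" for a b :: real
    using sum_squares_ge_zero[of "a+b" 0] by (simp add: power2_eq_square algebra_simps)
  have "(\<integral>\<^sup>+x. \<integral>\<^sup>+y. near ?d x y * ennreal ((p x - p y)\<^sup>2) \<partial>L \<partial>L)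
      \<le> (\<integral>\<^sup>+x. \<integral>\<^sup>+y. near ?d x y * ennreal (2 * (p x)\<^sup>2) + near ?d x y * ennreal (2 * (p y)\<^sup>2) \<partial>L \<partial>L)"
    by (intro nn_integral_mono, subst distrib_left[symmetric], intro mult_left_mono,
        subst ennreal_plus[symmetric]) (auto simp del: ennreal_plus intro!: ennreal_leI *)
  also have "\<dots> = (\<integral>\<^sup>+x. \<integral>\<^sup>+y. near ?d x y * ennreal (2 * (p x)\<^sup>2) \<partial>L \<partial>L)
      + (\<integral>\<^sup>+x. \<integral>\<^sup>+y. near ?d x y * ennreal (2 * (p y)\<^sup>2) \<partial>L \<partial>L)"
    by (subst nn_integral_add[symmetric]) (auto intro!: nn_integral_cong nn_integral_add)
  also have "\<dots> \<le> ennreal (C * ?d ^ m) * (\<integral>\<^sup>+x. ennreal (2 * (p x)\<^sup>2) \<partial>L)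
      + ennreal (C * ?d ^ m) * (\<integral>\<^sup>+x. ennreal (2 * (p x)\<^sup>2) \<partial>L)"
    by (intro add_mono near_integral_le) auto
  finally have "oscillation k p \<le> ennreal (real (Suc k) ^ m) * (ennreal (C * ?d ^ m) * (\<integral>\<^sup>+x. ennreal (2 * (p x)\<^sup>2) \<partial>L)
      + ennreal (C * ?d ^ m) * (\<integral>\<^sup>+x. ennreal (2 * (p x)\<^sup>2) \<partial>L))"
    unfolding oscillation_def by (intro mult_left_mono) auto
  also have "\<dots> = ennreal C * (\<integral>\<^sup>+x. ennreal (2 * (p x)\<^sup>2) \<partial>L) + ennreal C * (\<integral>\<^sup>+x. ennreal (2 * (p x)\<^sup>2) \<partial>L)"
    using C by (simp add: distrib_left scale_cancel del: of_nat_Suc)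
  also have "(\<integral>\<^sup>+x. ennreal (2 * (p x)\<^sup>2) \<partial>L) = ennreal 2 * (\<integral>\<^sup>+x. ennreal ((p x)\<^sup>2) \<partial>L)"
    by (subst nn_integral_cmult[symmetric]) (auto simp: ennreal_mult)
  also have "ennreal C * (ennreal 2 * (\<integral>\<^sup>+x. ennreal ((p x)\<^sup>2) \<partial>L)) + ennreal C * (ennreal 2 * (\<integral>\<^sup>+x. ennreal ((p x)\<^sup>2) \<partial>L))
      = ennreal (4 * C) * (\<integral>\<^sup>+x. ennreal ((p x)\<^sup>2) \<partial>L)"
  proof -
    have "ennreal (4 * C) = ennreal C * ennreal 2 + ennreal C * ennreal 2"
      using C by (simp only: ennreal_mult[symmetric] ennreal_plus[symmetric]) simp
    then show ?thesis by (simp only: distrib_right mult.assoc)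
  qed
  finally show ?thesis .
qed

lemma oscillation_add_le:
  assumes [measurable]: "p \<in> borel_measurable borel" "q \<in> borel_measurable borel"
  shows "oscillation k (\<lambda>x. p x + q x) \<le> 2 * oscillation k p + 2 * oscillation k q"
proof -
  let ?d = "1 / real (Suc k)"
  have *: "(a + b)\<^sup>2 \<le> 2 * a\<^sup>2 + 2 * b\<^sup>2" for a b :: real
    using sum_squares_ge_zero[of "a-b" 0] by (simp add: power2_eq_square algebra_simps)
  have **: "ennreal ((p x + q x - (p y + q y))\<^sup>2) \<le> 2 * ennreal ((p x - p y)\<^sup>2) + 2 * ennreal ((q x - q y)\<^sup>2)" for x y
  proof -
    have "(p x + q x - (p y + q y))\<^sup>2 \<le> 2 * (p x - p y)\<^sup>2 + 2 * (q x - q y)\<^sup>2"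
      using *[of "p x - p y" "q x - q y"] by (simp add: algebra_simps)
    then have "ennreal ((p x + q x - (p y + q y))\<^sup>2) \<le> ennreal (2 * (p x - p y)\<^sup>2 + 2 * (q x - q y)\<^sup>2)"
      by (rule ennreal_leI)
    then show ?thesis by (simp add: ennreal_mult)
  qed
  have "(\<integral>\<^sup>+x. \<integral>\<^sup>+y. near ?d x y * ennreal ((p x + q x - (p y + q y))\<^sup>2) \<partial>L \<partial>L)
      \<le> (\<integral>\<^sup>+x. \<integral>\<^sup>+y. 2 * (near ?d x y * ennreal ((p x - p y)\<^sup>2)) + 2 * (near ?d x y * ennreal ((q x - q y)\<^sup>2)) \<partial>L \<partial>L)"
  proof (intro nn_integral_mono)
    fix x y
    have "near ?d x y * ennreal ((p x + q x - (p y + q y))\<^sup>2)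
        \<le> near ?d x y * (2 * ennreal ((p x - p y)\<^sup>2) + 2 * ennreal ((q x - q y)\<^sup>2))"
      by (intro mult_left_mono **) auto
    then show "near ?d x y * ennreal ((p x + q x - (p y + q y))\<^sup>2) \<le>
       2 * (near ?d x y * ennreal ((p x - p y)\<^sup>2)) + 2 * (near ?d x y * ennreal ((q x - q y)\<^sup>2))"
      by (simp add: distrib_left mult.left_commute)
  qed
  also have "\<dots> = 2 * (\<integral>\<^sup>+x. \<integral>\<^sup>+y. near ?d x y * ennreal ((p x - p y)\<^sup>2) \<partial>L \<partial>L)
      + 2 * (\<integral>\<^sup>+x. \<integral>\<^sup>+y. near ?d x y * ennreal ((q x - q y)\<^sup>2) \<partial>L \<partial>L)"
    by (simp add: nn_integral_add nn_integral_cmult)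
  finally have "oscillation k (\<lambda>x. p x + q x) \<le> ennreal (real (Suc k) ^ m) *
     (2 * (\<integral>\<^sup>+x. \<integral>\<^sup>+y. near ?d x y * ennreal ((p x - p y)\<^sup>2) \<partial>L \<partial>L)
      + 2 * (\<integral>\<^sup>+x. \<integral>\<^sup>+y. near ?d x y * ennreal ((q x - q y)\<^sup>2) \<partial>L \<partial>L))"
    unfolding oscillation_def by (intro mult_left_mono) auto
  then show ?thesis unfolding oscillation_def by (simp only: distrib_left mult.left_commute)
qed

text \<open>Only pairs with exactly one point in K contribute. The other point of such a pair lies
  outside K at distance at most 1/(k+1), in a set whose measure tends to zero.\<close>

lemma oscillation_compact_indicator:
  assumes K: "compact K"
  shows "(\<lambda>k. oscillation k (indicator K)) \<longlonglongrightarrow> 0"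
proof (cases "K = {}")
  case True
  then show ?thesis by (simp add: oscillation_def)
next
  case False
  define N where "N k = {x. infdist x K \<le> 1 / Suc k} - K" for k
  have N [measurable]: "N k \<in> sets L" for k
    unfolding N_def using compact_infdist_le[OF False K, of "1 / Suc k"] K by (auto dest: borel_compact)
  have le: "oscillation k (indicator K) \<le> ennreal (2 * C) * emeasure L (N k)" for k
  proof -
    let ?d = "1 / real (Suc k)"
    have in_N: "y \<in> N k" if "x \<in> K" "y \<notin> K" "dist x y \<le> ?d" for x y
      using infdist_le[OF that(1), of y] that by (auto simp: N_def dist_commute)
    have "(\<integral>\<^sup>+x. \<integral>\<^sup>+y. near ?d x y * ennreal ((indicator K x - indicator K y)\<^sup>2) \<partial>L \<partial>L)
       \<le> (\<integral>\<^sup>+x. \<integral>\<^sup>+y. near ?d x y * indicator (N k) x + near ?d x y * indicator (N k) y \<partial>L \<partial>L)"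
    proof (intro nn_integral_mono)
      fix x y
      show "near ?d x y * ennreal ((indicator K x - indicator K y)\<^sup>2)
          \<le> near ?d x y * indicator (N k) x + near ?d x y * indicator (N k) y"
        using in_N[of x y] in_N[of y x]
        by (cases "x \<in> K"; cases "y \<in> K"; cases "dist x y \<le> ?d")
           (auto simp: near_def dist_commute simp del: of_nat_Suc)
    qed
    also have "\<dots> = (\<integral>\<^sup>+x. \<integral>\<^sup>+y. near ?d x y * indicator (N k) x \<partial>L \<partial>L)
         + (\<integral>\<^sup>+x. \<integral>\<^sup>+y. near ?d x y * indicator (N k) y \<partial>L \<partial>L)"
      by (simp add: nn_integral_add)
    also have "\<dots> \<le> ennreal (C * ?d ^ m) * (\<integral>\<^sup>+x. indicator (N k) x \<partial>L)
        + ennreal (C * ?d ^ m) * (\<integral>\<^sup>+x. indicator (N k) x \<partial>L)"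
      by (intro add_mono near_integral_le) auto
    finally have "oscillation k (indicator K) \<le> ennreal (real (Suc k) ^ m) *
      (ennreal (C * ?d ^ m) * emeasure L (N k) + ennreal (C * ?d ^ m) * emeasure L (N k))"
      unfolding oscillation_def nn_integral_indicator[OF N] by (rule mult_left_mono) simp
    also have "\<dots> = ennreal C * emeasure L (N k) + ennreal C * emeasure L (N k)"
      using C by (simp only: distrib_left scale_cancel less_imp_le)
    also have "\<dots> = ennreal (2 * C) * emeasure L (N k)"
    proof -
      have "ennreal (2 * C) = ennreal C + ennreal C"
        using C by (simp only: ennreal_plus[symmetric] less_imp_le mult_2)
      then show ?thesis by (simp only: distrib_right)
    qed
    finally show ?thesis .
  qed
  have "(\<lambda>k. ennreal (2 * C) * emeasure L (N k)) \<longlonglongrightarrow> ennreal (2 * C) * 0"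
    unfolding N_def by (intro ennreal_tendsto_cmult neighbourhood_measure_tendsto K False) simp
  then have "(\<lambda>k. ennreal (2 * C) * emeasure L (N k)) \<longlonglongrightarrow> 0" by simp
  then show ?thesis
    by (rule tendsto_sandwich[OF _ _ tendsto_const, rotated 2]) (use le in auto)
qed

text \<open>Functions with vanishing oscillation form a class closed under approximation in L^2, by
  the uniform bound applied to the difference.\<close>

lemma oscillation_tendsto_approx:
  assumes p [measurable]: "p \<in> borel_measurable borel"
    and approx: "\<And>e. e > 0 \<Longrightarrow> \<exists>q\<in>borel_measurable borel. (\<lambda>k. oscillation k q) \<longlonglongrightarrow> 0 \<and>
       (\<integral>\<^sup>+x. ennreal ((p x - q x)\<^sup>2) \<partial>L) \<le> ennreal e"
  shows "(\<lambda>k. oscillation k p) \<longlonglongrightarrow> 0"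
proof (rule ennreal_tendsto_zeroI)
  fix e :: real assume e: "e > 0"
  \<comment> \<open>The uniform bound turns \<open>e'\<close> into
    \<open>4 * C * e' = e / 4\<close>. Adding two functions doubles both contributions of
    \<open>e / 4\<close>, for a total of \<open>e\<close>.\<close>
  define e' where "e' = e / (16 * C)"
  have e': "e' > 0" using e C by (simp add: e'_def)
  then obtain q where q [measurable]: "q \<in> borel_measurable borel" and q0: "(\<lambda>k. oscillation k q) \<longlonglongrightarrow> 0"
    and pq: "(\<integral>\<^sup>+x. ennreal ((p x - q x)\<^sup>2) \<partial>L) \<le> ennreal e'"
    using approx by blast
  have "eventually (\<lambda>k. oscillation k q \<le> ennreal (e / 4)) sequentially"
    using ennreal_tendsto_zeroD[OF q0] e by simp
  then show "eventually (\<lambda>k. oscillation k p \<le> ennreal e) sequentially"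
  proof eventually_elim
    case (elim k)
    have "oscillation k (\<lambda>x. p x - q x) \<le> ennreal (4 * C) * ennreal e'"
      by (rule order_trans[OF oscillation_le mult_left_mono[OF pq]]) measurable
    also have "\<dots> = ennreal (e / 4)" using C e by (simp add: ennreal_mult[symmetric] e'_def)
    finally have 1: "oscillation k (\<lambda>x. p x - q x) \<le> ennreal (e / 4)" .
    have "oscillation k p = oscillation k (\<lambda>x. (p x - q x) + q x)" by simp
    also have "\<dots> \<le> 2 * oscillation k (\<lambda>x. p x - q x) + 2 * oscillation k q"
      by (rule oscillation_add_le) measurable
    also have "\<dots> \<le> 2 * ennreal (e / 4) + 2 * ennreal (e / 4)"
      by (intro add_mono mult_left_mono 1 elim) auto
    also have "\<dots> = ennreal 2 * ennreal (e / 4) + ennreal 2 * ennreal (e / 4)" by simp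
    also have "\<dots> = ennreal e"
      using e by (simp only: ennreal_mult[symmetric] ennreal_plus[symmetric]) simp
    finally show ?case .
  qed
qed

lemma oscillation_bounded_indicator:
  assumes E [measurable]: "E \<in> sets borel" and "bounded E"
  shows "(\<lambda>k. oscillation k (indicator E)) \<longlonglongrightarrow> 0"
proof (rule oscillation_tendsto_approx)
  obtain r where r: "r > 0" "E \<subseteq> cball 0 r"
    using \<open>bounded E\<close> by (auto simp: bounded_pos subset_iff)
  \<comment> \<open>Inner regularity by compact sets is applied to a finite measure, hence the
    restriction of \<open>L\<close> to a ball containing \<open>E\<close>.\<close>
  define M where "M = density L (indicator (cball 0 r))"
  have sM [simp]: "sets M = sets borel" by (simp add: M_def)
  have M_eq: "emeasure M A = emeasure L A" if "A \<in> sets borel" "A \<subseteq> E" for A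
  proof -
    have "emeasure M A = (\<integral>\<^sup>+x. indicator (cball 0 r) x * indicator A x \<partial>L)"
      unfolding M_def using that by (intro emeasure_density) auto
    also have "\<dots> = (\<integral>\<^sup>+x. indicator A x \<partial>L)"
      using that r by (intro nn_integral_cong) (auto simp: indicator_def)
    also have "\<dots> = emeasure L A" using that by simp
    finally show ?thesis .
  qed
  have fin: "emeasure M (space M) \<noteq> \<infinity>"
    unfolding M_def using finite_on_bounded[of "cball 0 r"] by (simp add: emeasure_density less_top)
  fix e :: real assume e: "e > 0"
  have EM: "emeasure M E \<noteq> \<infinity>"
    using fin emeasure_mono[of E "space M" M] by (auto simp: sets_eq_imp_space_eq[OF sM] top_unique)
  have "\<exists>K\<in>{K. K \<subseteq> E \<and> compact K}. emeasure M E < emeasure M K + ennreal e"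
    by (rule SUP_approx_ennreal[OF e _ inner_regular[OF sM fin E] EM]) auto
  then obtain K where K: "K \<subseteq> E" "compact K" "emeasure M E < emeasure M K + ennreal e" by auto
  have Kb [measurable]: "K \<in> sets borel" using K(2) by (rule borel_compact)
  have KL: "emeasure L K \<noteq> \<infinity>"
    using finite_on_bounded[OF compact_imp_bounded[OF K(2)]] by simp
  have "(\<integral>\<^sup>+x. ennreal ((indicator E x - indicator K x)\<^sup>2) \<partial>L) = (\<integral>\<^sup>+x. indicator (E - K) x \<partial>L)"
    using K(1) by (intro nn_integral_cong) (auto simp: indicator_def)
  also have "\<dots> = emeasure L (E - K)" by simp
  also have "\<dots> = emeasure L E - emeasure L K"
    using K(1) KL by (intro emeasure_Diff) auto
  also have "\<dots> \<le> ennreal e"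
  proof -
    have "emeasure L E \<le> ennreal e + emeasure L K"
      using K(3) M_eq[OF E] M_eq[OF Kb K(1)] by (simp add: add.commute)
    then show ?thesis using KL by (simp add: ennreal_minus_le_iff add.commute)
  qed
  finally have "(\<integral>\<^sup>+x. ennreal ((indicator E x - indicator K x)\<^sup>2) \<partial>L) \<le> ennreal e" .
  then show "\<exists>q\<in>borel_measurable borel. (\<lambda>k. oscillation k q) \<longlonglongrightarrow> 0 \<and>
       (\<integral>\<^sup>+x. ennreal ((indicator E x - q x)\<^sup>2) \<partial>L) \<le> ennreal e"
    using oscillation_compact_indicator[OF K(2)] by (intro bexI[of _ "indicator K"]) auto
qed measurable

lemma oscillation_scale:
  assumes [measurable]: "p \<in> borel_measurable borel"
  shows "oscillation k (\<lambda>x. a * p x) = ennreal (a\<^sup>2) * oscillation k p"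
proof -
  have "(a * p x - a * p y)\<^sup>2 = a\<^sup>2 * (p x - p y)\<^sup>2" for x y
    by (simp add: power_mult_distrib right_diff_distrib[symmetric])
  then show ?thesis
    unfolding oscillation_def
    by (simp add: ennreal_mult mult.left_commute[of _ "ennreal (a\<^sup>2)"] nn_integral_cmult del: of_nat_Suc)
qed

lemma square_integrable_approx:
  fixes U :: "nat \<Rightarrow> 'a \<Rightarrow> real"
  assumes [measurable]: "\<And>i. U i \<in> borel_measurable borel" "u \<in> borel_measurable borel"
    and le: "\<And>i x. 0 \<le> U i x" "\<And>i x. U i x \<le> u x"
    and lim: "\<And>x. (\<lambda>i. U i x) \<longlonglongrightarrow> u x"
    and fin: "(\<integral>\<^sup>+x. ennreal ((u x)\<^sup>2) \<partial>L) < \<infinity>"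
  shows "(\<lambda>i. \<integral>\<^sup>+x. ennreal ((u x - U i x)\<^sup>2) \<partial>L) \<longlonglongrightarrow> 0"
proof -
  have "(\<lambda>i. \<integral>\<^sup>+x. ennreal ((u x - U i x)\<^sup>2) \<partial>L) \<longlonglongrightarrow> (\<integral>\<^sup>+x. 0 \<partial>L)"
  proof (rule nn_integral_dominated_convergence[where w="\<lambda>x. ennreal ((u x)\<^sup>2)"])
    show "AE x in L. ennreal ((u x - U j x)\<^sup>2) \<le> ennreal ((u x)\<^sup>2)" for j
    proof (intro AE_I2 ennreal_leI power_mono)
      show "u x - U j x \<le> u x" "0 \<le> u x - U j x" for x using le[of j x] by auto
    qed
    have "(\<lambda>i. ennreal ((u x - U i x)\<^sup>2)) \<longlonglongrightarrow> ennreal ((u x - u x)\<^sup>2)" for x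
      by (intro tendsto_ennrealI tendsto_intros lim)
    then show "AE x in L. (\<lambda>i. ennreal ((u x - U i x)\<^sup>2)) \<longlonglongrightarrow> 0" by simp
  qed (use fin in auto)
  then show ?thesis by simp
qed

lemma oscillation_tendsto_limit:
  fixes U :: "nat \<Rightarrow> 'a \<Rightarrow> real"
  assumes [measurable]: "\<And>i. U i \<in> borel_measurable borel" "u \<in> borel_measurable borel"
    and le: "\<And>i x. 0 \<le> U i x" "\<And>i x. U i x \<le> u x"
    and lim: "\<And>x. (\<lambda>i. U i x) \<longlonglongrightarrow> u x"
    and fin: "(\<integral>\<^sup>+x. ennreal ((u x)\<^sup>2) \<partial>L) < \<infinity>"
    and osc: "\<And>i. (\<lambda>k. oscillation k (U i)) \<longlonglongrightarrow> 0"
  shows "(\<lambda>k. oscillation k u) \<longlonglongrightarrow> 0"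
proof (rule oscillation_tendsto_approx)
  fix e :: real assume "e > 0"
  from ennreal_tendsto_zeroD[OF square_integrable_approx[OF assms(1-6)] this]
  obtain i where "(\<integral>\<^sup>+x. ennreal ((u x - U i x)\<^sup>2) \<partial>L) \<le> ennreal e"
    by (auto simp: eventually_sequentially)
  then show "\<exists>q\<in>borel_measurable borel. (\<lambda>k. oscillation k q) \<longlonglongrightarrow> 0 \<and>
       (\<integral>\<^sup>+x. ennreal ((u x - q x)\<^sup>2) \<partial>L) \<le> ennreal e"
    using osc[of i] by (intro bexI[of _ "U i"]) auto
qed fact

text \<open>An induction over nonnegative measurable functions. The cutoff is part of the statement,
  so that the indicator of an arbitrary Borel set becomes that of a bounded one. Finiteness of the
  square integral passes to summands and to members of an increasing sequence, since these are
  nonnegative and lie below the whole function.\<close>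

lemma oscillation_tendsto_zero_bounded:
  fixes p :: "'a \<Rightarrow> real"
  assumes "p \<in> borel_measurable borel" "\<And>x. 0 \<le> p x"
    and fin: "(\<integral>\<^sup>+x. ennreal ((p x * indicator (cball 0 R) x)\<^sup>2) \<partial>L) < \<infinity>"
  shows "(\<lambda>k. oscillation k (\<lambda>x. p x * indicator (cball 0 R) x)) \<longlonglongrightarrow> 0"
  using assms
proof (induction rule: borel_measurable_induct_real)
  case (set A)
  have "bounded (A \<inter> cball 0 R)" by (meson bounded_Int bounded_cball)
  moreover have "(\<lambda>x. indicator A x * indicator (cball 0 R) x :: real) = indicator (A \<inter> cball 0 R)"
    by (auto simp: indicator_def)
  ultimately show ?case using set by (simp add: oscillation_bounded_indicator)
next
  case (mult u a)
  note [measurable] = mult(2)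
  show ?case
  \<comment> \<open>For \<open>a = 0\<close> the finite integral of the scaled function says nothing
    about \<open>u\<close>, so the induction hypothesis cannot be invoked.\<close>
  proof (cases "a = 0")
    case True
    then show ?thesis by (simp add: oscillation_def)
  next
    case False
    have "(\<integral>\<^sup>+x. ennreal ((a * u x * indicator (cball 0 R) x)\<^sup>2) \<partial>L)
        = ennreal (a\<^sup>2) * (\<integral>\<^sup>+x. ennreal ((u x * indicator (cball 0 R) x)\<^sup>2) \<partial>L)"
      by (subst nn_integral_cmult[symmetric]) (auto simp: ennreal_mult[symmetric] power_mult_distrib mult.assoc)
    then have "(\<integral>\<^sup>+x. ennreal ((u x * indicator (cball 0 R) x)\<^sup>2) \<partial>L) < \<infinity>"
      using mult(5) False by (auto simp: ennreal_mult_less_top)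
    then have *: "(\<lambda>k. oscillation k (\<lambda>x. u x * indicator (cball 0 R) x)) \<longlonglongrightarrow> 0" by (rule mult(4))
    have "oscillation k (\<lambda>x. a * u x * indicator (cball 0 R) x)
        = ennreal (a\<^sup>2) * oscillation k (\<lambda>x. u x * indicator (cball 0 R) x)" for k
      by (subst oscillation_scale[symmetric]) (auto simp: mult.assoc)
    then show ?thesis using ennreal_tendsto_cmult[OF _ *, of "ennreal (a\<^sup>2)"] by simp
  qed
next
  case (add u v)
  note [measurable] = add.hyps(1,3)
  have le: "(\<integral>\<^sup>+x. ennreal ((w x * indicator (cball 0 R) x)\<^sup>2) \<partial>L) < \<infinity>" if "\<And>x. 0 \<le> w x" "\<And>x. w x \<le> v x + u x" for w
  proof -
    have "(\<integral>\<^sup>+x. ennreal ((w x * indicator (cball 0 R) x)\<^sup>2) \<partial>L)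
        \<le> (\<integral>\<^sup>+x. ennreal (((v x + u x) * indicator (cball 0 R) x)\<^sup>2) \<partial>L)"
      using that by (intro nn_integral_mono ennreal_leI power_mono mult_right_mono) auto
    then show ?thesis using add.prems by (auto intro: le_less_trans)
  qed
  have u: "(\<lambda>k. oscillation k (\<lambda>x. u x * indicator (cball 0 R) x)) \<longlonglongrightarrow> 0"
    using add.hyps(2,4) by (intro add.IH(1) le) auto
  have v: "(\<lambda>k. oscillation k (\<lambda>x. v x * indicator (cball 0 R) x)) \<longlonglongrightarrow> 0"
    using add.hyps(2,4) by (intro add.IH(2) le) auto
  have "(\<lambda>k. 2 * oscillation k (\<lambda>x. v x * indicator (cball 0 R) x)
      + 2 * oscillation k (\<lambda>x. u x * indicator (cball 0 R) x)) \<longlonglongrightarrow> 2 * 0 + 2 * 0"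
    by (intro tendsto_add ennreal_tendsto_cmult u v) auto
  then have lim: "(\<lambda>k. 2 * oscillation k (\<lambda>x. v x * indicator (cball 0 R) x)
      + 2 * oscillation k (\<lambda>x. u x * indicator (cball 0 R) x)) \<longlonglongrightarrow> 0" by simp
  have "oscillation k (\<lambda>x. (v x + u x) * indicator (cball 0 R) x)
      \<le> 2 * oscillation k (\<lambda>x. v x * indicator (cball 0 R) x)
      + 2 * oscillation k (\<lambda>x. u x * indicator (cball 0 R) x)" for k
    unfolding distrib_right by (rule oscillation_add_le) measurable
  then show ?case
    by (intro tendsto_sandwich[OF _ _ tendsto_const lim]) auto
next
  case (seq U)
  note [measurable] = seq.hyps(1)
  have up: "U i x \<le> p x" for i x
    using seq.hyps(3) seq.hyps(4)[of x] by (intro incseq_le) (auto simp: incseq_def le_fun_def)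
  have [measurable]: "p \<in> borel_measurable borel"
    by (rule assms(1))
  show ?case
  proof (rule oscillation_tendsto_limit[where U="\<lambda>i x. U i x * indicator (cball 0 R) x"])
    show "U i x * indicator (cball 0 R) x \<le> p x * indicator (cball 0 R) x" for i x
      by (intro mult_right_mono up) auto
    show "(\<lambda>i. U i x * indicator (cball 0 R) x) \<longlonglongrightarrow> p x * indicator (cball 0 R) x" for x
      by (intro tendsto_mult_right seq.hyps(4)) auto
    show "(\<lambda>k. oscillation k (\<lambda>x. U i x * indicator (cball 0 R) x)) \<longlonglongrightarrow> 0" for i
    proof (rule seq.IH)
      have "(\<integral>\<^sup>+x. ennreal ((U i x * indicator (cball 0 R) x)\<^sup>2) \<partial>L)
          \<le> (\<integral>\<^sup>+x. ennreal ((p x * indicator (cball 0 R) x)\<^sup>2) \<partial>L)"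
        using up seq.hyps(2) by (intro nn_integral_mono ennreal_leI power_mono mult_right_mono) auto
      then show "(\<integral>\<^sup>+x. ennreal ((U i x * indicator (cball 0 R) x)\<^sup>2) \<partial>L) < \<infinity>"
        using seq.prems by (auto intro: le_less_trans)
    qed
  qed (use seq in auto)
qed

lemma oscillation_tendsto_zero:
  fixes p :: "'a \<Rightarrow> real"
  assumes [measurable]: "p \<in> borel_measurable borel" and p: "\<And>x. 0 \<le> p x"
    and fin: "(\<integral>\<^sup>+x. ennreal ((p x)\<^sup>2) \<partial>L) < \<infinity>"
  shows "(\<lambda>k. oscillation k p) \<longlonglongrightarrow> 0"
proof (rule oscillation_tendsto_limit[where U="\<lambda>i x. p x * indicator (cball 0 (real i)) x"])
  show "p x * indicator (cball 0 (real i)) x \<le> p x" for i x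
    using p[of x] by (auto simp: indicator_def)
  show "(\<lambda>i. p x * indicator (cball 0 (real i)) x) \<longlonglongrightarrow> p x" for x
  proof (rule tendsto_eventually)
    obtain N :: nat where "norm x \<le> N" using real_arch_simple by blast
    then show "\<forall>\<^sub>F i in sequentially. p x * indicator (cball 0 (real i)) x = p x"
      unfolding eventually_sequentially by (intro exI[of _ N]) (auto simp: indicator_def)
  qed
  show "(\<lambda>k. oscillation k (\<lambda>x. p x * indicator (cball 0 (real i)) x)) \<longlonglongrightarrow> 0" for i
  proof (rule oscillation_tendsto_zero_bounded)
    have "(\<integral>\<^sup>+x. ennreal ((p x * indicator (cball 0 (real i)) x)\<^sup>2) \<partial>L) \<le> (\<integral>\<^sup>+x. ennreal ((p x)\<^sup>2) \<partial>L)"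
      using p by (intro nn_integral_mono ennreal_leI power_mono) (auto simp: indicator_def)
    then show "(\<integral>\<^sup>+x. ennreal ((p x * indicator (cball 0 (real i)) x)\<^sup>2) \<partial>L) < \<infinity>"
      using fin by (rule le_less_trans)
  qed (use p in auto)
qed (use p fin in auto)

section \<open>From a finite liminf to absolute continuity\<close>

text \<open>Inner regularity reduces the claim to compact null sets. The mass of small balls, as a
  function of the centre, has its square integral controlled by the coincidence mass. Mass sitting
  on a compact null set would be spread over neighbourhoods of vanishing measure and so force this
  square integral to be too large.\<close>

lemma absolutely_continuous_of_liminf_coincidence:
  assumes sets_a [simp, measurable_cong]: "sets \<alpha> = sets borel" and fin: "finite_measure \<alpha>"
    and aV: "emeasure \<alpha> (- V) = 0"
    and W: "liminf (\<lambda>k. scaled_coincidence m k \<alpha> \<alpha>) < \<infinity>"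
  shows "absolutely_continuous L \<alpha>"
proof -
  interpret A: finite_measure \<alpha> by fact
  interpret P: pair_sigma_finite \<alpha> L ..
  have [simp]: "space \<alpha> = UNIV" using sets_eq_imp_space_eq[OF sets_a] by simp
  have AE_aV: "AE x in \<alpha>. x \<in> V"
    using aV by (intro AE_I[where N="-V"]) auto
  have compact_null: "emeasure \<alpha> K = 0" if K: "compact K" and LK: "emeasure L K = 0" for K
  proof (cases "K = {}")
    case False
    have [measurable]: "K \<in> sets borel" using K by (rule borel_compact)
    define N where "N k = {x. infdist x K \<le> 1 / real (Suc k)}" for k
    have N [measurable]: "N k \<in> sets borel" for k
      unfolding N_def using compact_infdist_le[OF False K, of "1 / real (Suc k)"] by (auto dest: borel_compact)
    have LN: "(\<lambda>k. emeasure L (N k)) \<longlonglongrightarrow> 0"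
    proof -
      have "emeasure L (N k) = emeasure L (N k - K)" for k
        using LK emeasure_Diff_null_set[of K L "N k"] by (simp add: null_sets_def)
      then show ?thesis using neighbourhood_measure_tendsto[OF K False] by (simp add: N_def)
    qed
    \<comment> \<open>Average over balls and split with Young's inequality at weight \<open>s\<close>; letting \<open>s\<close> tend to
      infinity after \<open>k\<close> shows that a null compact set carries no mass.\<close>
    have key: "ennreal (s * c / (C * 2 ^ m)) * emeasure \<alpha> K
        \<le> scaled_coincidence m k \<alpha> \<alpha> + ennreal (s\<^sup>2 / C) * emeasure L (N k)" if s: "s > 0" for s k
    proof -
      define d where "d = 1 / real (Suc k)"
      have d: "d > 0" by (simp add: d_def)
      \<comment> \<open>Half the radius, because two points within \<open>d / 2\<close> of the same
        \<open>v\<close> are within \<open>d\<close> of each other. This is how the square of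
        \<open>g\<close> is bounded by the coincidence mass at radius \<open>d\<close>.\<close>
      define g where "g v = (\<integral>\<^sup>+x. near (d/2) x v \<partial>\<alpha>)" for v
      have [measurable]: "g \<in> borel_measurable borel" unfolding g_def by measurable
      have g_fin: "g v < \<infinity>" for v
      proof -
        have "g v = emeasure \<alpha> (cball v (d/2))"
          unfolding g_def by (subst near_commute) (simp add: nn_integral_near)
        then show ?thesis using A.emeasure_finite[of "cball v (d/2)"] by (simp add: less_top[symmetric])
      qed
      have 1: "ennreal (c * (d/2) ^ m) * emeasure \<alpha> K \<le> (\<integral>\<^sup>+v. indicator (N k) v * g v \<partial>L)"
      proof -
        have "ennreal (c * (d/2) ^ m) * emeasure \<alpha> K = (\<integral>\<^sup>+x. ennreal (c * (d/2) ^ m) * indicator K x \<partial>\<alpha>)"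
          by (simp add: nn_integral_cmult)
        also have "\<dots> \<le> (\<integral>\<^sup>+x. emeasure L (cball x (d/2)) * indicator K x \<partial>\<alpha>)"
          using AE_aV d by (intro nn_integral_mono_AE) (auto elim!: eventually_mono intro!: mult_right_mono lower)
        also have "\<dots> = (\<integral>\<^sup>+x. \<integral>\<^sup>+v. near (d/2) x v * indicator K x \<partial>L \<partial>\<alpha>)"
          by (intro nn_integral_cong) (simp add: nn_integral_multc nn_integral_near)
        also have "\<dots> = (\<integral>\<^sup>+v. \<integral>\<^sup>+x. near (d/2) x v * indicator K x \<partial>\<alpha> \<partial>L)"
          by (rule P.Fubini'[symmetric]) measurable
        also have "\<dots> \<le> (\<integral>\<^sup>+v. \<integral>\<^sup>+x. indicator (N k) v * near (d/2) x v \<partial>\<alpha> \<partial>L)"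
        proof (intro nn_integral_mono)
          fix v x
          have "v \<in> N k" if "x \<in> K" "dist x v \<le> d/2"
            using infdist_le[OF that(1), of v] that(2) d
            unfolding N_def d_def[symmetric] by (auto simp: dist_commute)
          then show "near (d/2) x v * indicator K x \<le> indicator (N k) v * near (d/2) x v"
            by (auto simp: near_def indicator_def)
        qed
        also have "\<dots> = (\<integral>\<^sup>+v. indicator (N k) v * g v \<partial>L)"
          unfolding g_def by (intro nn_integral_cong nn_integral_cmult) measurable
        finally show ?thesis .
      qed
      have 2: "(\<integral>\<^sup>+v. g v * g v \<partial>L) \<le> ennreal (C * d ^ m) * coincidence d \<alpha> \<alpha>"
      proof -
        have "(\<integral>\<^sup>+v. g v * g v \<partial>L) = (\<integral>\<^sup>+v. \<integral>\<^sup>+x. near (d/2) x v * g v \<partial>\<alpha> \<partial>L)"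
          by (subst (1) g_def) (simp add: nn_integral_multc)
        also have "\<dots> \<le> (\<integral>\<^sup>+v. \<integral>\<^sup>+x. near (d/2) x v * (\<integral>\<^sup>+y. near d x y \<partial>\<alpha>) \<partial>\<alpha> \<partial>L)"
        proof (intro nn_integral_mono)
          fix v x
          show "near (d/2) x v * g v \<le> near (d/2) x v * (\<integral>\<^sup>+y. near d x y \<partial>\<alpha>)"
          proof (cases "dist x v \<le> d/2")
            case True
            have "dist x y \<le> d" if "dist y v \<le> d/2" for y
              using True that dist_triangle2[of x y v] by linarith
            then have "g v \<le> (\<integral>\<^sup>+y. near d x y \<partial>\<alpha>)"
              unfolding g_def by (intro nn_integral_mono) (auto simp: near_def)
            then show ?thesis by (intro mult_left_mono) auto
          qed (simp add: near_def)
        qed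
        also have "\<dots> = (\<integral>\<^sup>+x. \<integral>\<^sup>+v. near (d/2) x v * (\<integral>\<^sup>+y. near d x y \<partial>\<alpha>) \<partial>L \<partial>\<alpha>)"
          by (rule P.Fubini') measurable
        also have "\<dots> = (\<integral>\<^sup>+x. emeasure L (cball x (d/2)) * (\<integral>\<^sup>+y. near d x y \<partial>\<alpha>) \<partial>\<alpha>)"
          by (intro nn_integral_cong) (subst nn_integral_multc, auto simp: nn_integral_near)
        also have "\<dots> \<le> (\<integral>\<^sup>+x. ennreal (C * d ^ m) * (\<integral>\<^sup>+y. near d x y \<partial>\<alpha>) \<partial>\<alpha>)"
        proof (intro nn_integral_mono mult_right_mono)
          fix x
          have "emeasure L (cball x (d/2)) \<le> emeasure L (cball x d)"
            using d by (intro emeasure_mono) auto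
          then show "emeasure L (cball x (d/2)) \<le> ennreal (C * d ^ m)"
            using upper[OF d, of x] by simp
        qed auto
        also have "\<dots> = ennreal (C * d ^ m) * coincidence d \<alpha> \<alpha>"
          unfolding coincidence_def by (rule nn_integral_cmult) measurable
        finally show ?thesis .
      qed
      \<comment> \<open>The weight \<open>s * d ^ m\<close> makes all powers of \<open>d\<close>
        match. After multiplication by \<open>s / (C * d ^ m)\<close> the coincidence mass carries
        exactly the factor of \<open>scaled_coincidence\<close>, and the measure of
        \<open>N k\<close> a factor independent of \<open>k\<close>.\<close>
      have young: "indicator (N k) v * g v \<le> ennreal (s * d ^ m) * indicator (N k) v + ennreal (1 / (s * d ^ m)) * (g v * g v)" for v
      proof (cases "v \<in> N k")
        case True
        obtain r where r: "r \<ge> 0" "g v = ennreal r" using g_fin[of v] by (cases "g v") auto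
        define t where "t = s * d ^ m"
        have t: "t > 0" using s d by (simp add: t_def)
        have "r * t \<le> t * t + r * r"
          using zero_le_square[of "r - t/2"] mult_pos_pos[OF t t] by (simp add: algebra_simps)
        then have "r \<le> t + 1 / t * (r * r)" using t by (simp add: field_simps)
        then have "ennreal r \<le> ennreal (t + 1 / t * (r * r))" by (rule ennreal_leI)
        also have "\<dots> = ennreal t + ennreal (1 / t) * (ennreal r * ennreal r)"
          using t r by (simp add: ennreal_mult[symmetric])
        finally show ?thesis using True by (simp add: r t_def)
      qed simp
      have "(\<integral>\<^sup>+v. indicator (N k) v * g v \<partial>L)
          \<le> (\<integral>\<^sup>+v. ennreal (s * d ^ m) * indicator (N k) v + ennreal (1 / (s * d ^ m)) * (g v * g v) \<partial>L)"
        by (intro nn_integral_mono young)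
      also have "\<dots> = ennreal (s * d ^ m) * emeasure L (N k) + ennreal (1 / (s * d ^ m)) * (\<integral>\<^sup>+v. g v * g v \<partial>L)"
        by (simp add: nn_integral_add nn_integral_cmult)
      also have "\<dots> \<le> ennreal (s * d ^ m) * emeasure L (N k) + ennreal (1 / (s * d ^ m)) * (ennreal (C * d ^ m) * coincidence d \<alpha> \<alpha>)"
        by (intro add_left_mono mult_left_mono 2) simp
      also have "\<dots> = ennreal (s * d ^ m) * emeasure L (N k) + ennreal (C / s) * coincidence d \<alpha> \<alpha>"
        using s d C by (simp add: mult.assoc[symmetric] ennreal_mult[symmetric])
      finally have "ennreal (c * (d/2) ^ m) * emeasure \<alpha> K
          \<le> ennreal (s * d ^ m) * emeasure L (N k) + ennreal (C / s) * coincidence d \<alpha> \<alpha>"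
        using 1 by (rule order_trans[rotated])
      then have "ennreal (s / (C * d ^ m)) * (ennreal (c * (d/2) ^ m) * emeasure \<alpha> K)
          \<le> ennreal (s / (C * d ^ m)) * (ennreal (s * d ^ m) * emeasure L (N k) + ennreal (C / s) * coincidence d \<alpha> \<alpha>)"
        by (rule mult_left_mono) simp
      also have "ennreal (s / (C * d ^ m)) * (ennreal (c * (d/2) ^ m) * emeasure \<alpha> K)
          = ennreal (s * c / (C * 2 ^ m)) * emeasure \<alpha> K"
        using s d C c by (simp add: mult.assoc[symmetric] ennreal_mult[symmetric] power_divide)
      also have "ennreal (s / (C * d ^ m)) * (ennreal (s * d ^ m) * emeasure L (N k) + ennreal (C / s) * coincidence d \<alpha> \<alpha>)
          = ennreal (s\<^sup>2 / C) * emeasure L (N k) + ennreal (1 / d ^ m) * coincidence d \<alpha> \<alpha>"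
        using s d C by (simp add: distrib_left mult.assoc[symmetric] ennreal_mult[symmetric] power2_eq_square)
      also have "1 / d ^ m = real (Suc k) ^ m" by (simp add: d_def power_divide)
      finally show ?thesis unfolding scaled_coincidence_def d_def by (simp only: add.commute)
    qed
    have bound: "ennreal (s * c / (C * 2 ^ m)) * emeasure \<alpha> K \<le> liminf (\<lambda>k. scaled_coincidence m k \<alpha> \<alpha>)" if "s > 0" for s
    proof (rule liminf_ge_of_null_error)
      show "ennreal (s * c / (C * 2 ^ m)) * emeasure \<alpha> K
        \<le> scaled_coincidence m k \<alpha> \<alpha> + ennreal (s\<^sup>2 / C) * emeasure L (N k)" for k by (rule key[OF that])
      show "(\<lambda>k. ennreal (s\<^sup>2 / C) * emeasure L (N k)) \<longlonglongrightarrow> 0"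
        using ennreal_tendsto_cmult[OF _ LN, of "ennreal (s\<^sup>2 / C)"] by simp
    qed
    obtain w where w: "w \<ge> 0" "liminf (\<lambda>k. scaled_coincidence m k \<alpha> \<alpha>) = ennreal w"
      using W by (cases "liminf (\<lambda>k. scaled_coincidence m k \<alpha> \<alpha>)") auto
    obtain a where a: "a \<ge> 0" "emeasure \<alpha> K = ennreal a"
      using A.emeasure_finite[of K] by (cases "emeasure \<alpha> K") auto
    have "a = 0"
    proof (rule ccontr)
      assume "a \<noteq> 0"
      then have a0: "a > 0" using a by simp
      \<comment> \<open>Chosen so that the left side of \<open>bound\<close> evaluates to
        \<open>w + 1\<close>, which exceeds the liminf \<open>w\<close>.\<close>
      define s where "s = (w + 1) * (C * 2 ^ m) / (c * a)"
      have "s > 0" using w a0 c C by (simp add: s_def)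
      from bound[OF this] have "ennreal (s * c / (C * 2 ^ m) * a) \<le> ennreal w"
        unfolding w a using \<open>s > 0\<close> c C a by (simp add: ennreal_mult[symmetric])
      then have "s * c / (C * 2 ^ m) * a \<le> w" using w by simp
      moreover have "s * c / (C * 2 ^ m) * a = w + 1"
        using a0 c C by (simp add: s_def)
      ultimately show False by simp
    qed
    then show ?thesis using a by simp
  qed simp
  show ?thesis
    unfolding absolutely_continuous_def
  proof
    fix E assume "E \<in> null_sets L"
    then have E: "E \<in> sets borel" "emeasure L E = 0" by (auto simp: null_sets_def)
    have "emeasure \<alpha> E = (SUP K \<in> {K. K \<subseteq> E \<and> compact K}. emeasure \<alpha> K)"
      using A.emeasure_finite[of "space \<alpha>"] by (intro inner_regular E) auto
    also have "\<dots> \<le> 0"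
    proof (rule SUP_least)
      fix K assume K: "K \<in> {K. K \<subseteq> E \<and> compact K}"
      then have "emeasure L K \<le> emeasure L E" using E by (intro emeasure_mono) auto
      then show "emeasure \<alpha> K \<le> 0" using compact_null[of K] K E by simp
    qed
    finally show "E \<in> null_sets \<alpha>" using E by (auto simp: null_sets_def)
  qed
qed

section \<open>Coincidence masses and integrals of densities\<close>

text \<open>Combines p q <= p^2 + q^2 with the upper ball bound. Since the right side does not
  depend on \<open>k\<close>, it can act as a majorant for the reverse Fatou lemma.\<close>

lemma scaled_coincidence_density_le:
  fixes p q :: "'a \<Rightarrow> real"
  assumes [measurable]: "p \<in> borel_measurable borel" "q \<in> borel_measurable borel"
    and nonneg: "\<And>x. 0 \<le> p x" "\<And>x. 0 \<le> q x"
  shows "scaled_coincidence m k (density L p) (density L q)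
    \<le> ennreal C * ((\<integral>\<^sup>+x. ennreal ((p x)\<^sup>2) \<partial>L) + (\<integral>\<^sup>+x. ennreal ((q x)\<^sup>2) \<partial>L))"
proof -
  let ?d = "1 / real (Suc k)"
  have "coincidence ?d (density L p) (density L q)
      = (\<integral>\<^sup>+x. \<integral>\<^sup>+y. near ?d x y * (ennreal (p x) * ennreal (q y)) \<partial>L \<partial>L)"
    by (rule coincidence_density) measurable
  also have "\<dots> \<le> (\<integral>\<^sup>+x. \<integral>\<^sup>+y. near ?d x y * ennreal ((p x)\<^sup>2) + near ?d x y * ennreal ((q y)\<^sup>2) \<partial>L \<partial>L)"
  proof (intro nn_integral_mono)
    fix x y
    have "p x * q y \<le> (p x)\<^sup>2 + (q y)\<^sup>2"
    proof -
      have "0 \<le> p x * q y" using nonneg by simp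
      moreover have "0 \<le> (p x)\<^sup>2 + (q y)\<^sup>2 - 2 * (p x * q y)"
        using zero_le_power2[of "p x - q y"] by (simp only: power2_diff mult.assoc)
      ultimately show ?thesis by linarith
    qed
    then have "ennreal (p x * q y) \<le> ennreal ((p x)\<^sup>2 + (q y)\<^sup>2)" by (rule ennreal_leI)
    then have "ennreal (p x) * ennreal (q y) \<le> ennreal ((p x)\<^sup>2) + ennreal ((q y)\<^sup>2)"
      using nonneg by (simp add: ennreal_mult)
    from mult_left_mono[OF this, of "near ?d x y"]
    show "near ?d x y * (ennreal (p x) * ennreal (q y)) \<le> near ?d x y * ennreal ((p x)\<^sup>2) + near ?d x y * ennreal ((q y)\<^sup>2)"
      by (simp add: distrib_left)
  qed
  also have "\<dots> = (\<integral>\<^sup>+x. \<integral>\<^sup>+y. near ?d x y * ennreal ((p x)\<^sup>2) \<partial>L \<partial>L)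
      + (\<integral>\<^sup>+x. \<integral>\<^sup>+y. near ?d x y * ennreal ((q y)\<^sup>2) \<partial>L \<partial>L)"
    by (simp add: nn_integral_add)
  also have "\<dots> \<le> ennreal (C * ?d ^ m) * (\<integral>\<^sup>+x. ennreal ((p x)\<^sup>2) \<partial>L)
      + ennreal (C * ?d ^ m) * (\<integral>\<^sup>+x. ennreal ((q x)\<^sup>2) \<partial>L)"
    by (intro add_mono near_integral_le) auto
  finally have "scaled_coincidence m k (density L p) (density L q) \<le> ennreal (real (Suc k) ^ m) *
     (ennreal (C * ?d ^ m) * (\<integral>\<^sup>+x. ennreal ((p x)\<^sup>2) \<partial>L)
      + ennreal (C * ?d ^ m) * (\<integral>\<^sup>+x. ennreal ((q x)\<^sup>2) \<partial>L))"
    unfolding scaled_coincidence_def by (rule mult_left_mono) simp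
  then show ?thesis using C by (simp only: distrib_left scale_cancel less_imp_le)
qed

text \<open>Replacing \<open>p x\<close> by \<open>p y\<close> leaves \<open>p y * q y\<close>,
  handled by the upper ball bound, and the error \<open>(p x - p y) * q y\<close>. Young's
  inequality with weight \<open>t\<close> splits the error into the oscillation of \<open>p\<close>
  divided by \<open>t\<close>, which vanishes as \<open>k\<close> grows, and \<open>t\<close> times
  a multiple of the square integral of \<open>q\<close>, which a small \<open>t\<close> makes
  negligible.\<close>

lemma limsup_scaled_coincidence_density_le:
  fixes p q :: "'a \<Rightarrow> real"
  assumes [measurable]: "p \<in> borel_measurable borel" "q \<in> borel_measurable borel"
    and nonneg: "\<And>x. 0 \<le> p x" "\<And>x. 0 \<le> q x"
    and fin: "(\<integral>\<^sup>+x. ennreal ((p x)\<^sup>2) \<partial>L) < \<infinity>" "(\<integral>\<^sup>+x. ennreal ((q x)\<^sup>2) \<partial>L) < \<infinity>"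
  shows "limsup (\<lambda>k. scaled_coincidence m k (density L p) (density L q))
    \<le> ennreal C * (\<integral>\<^sup>+x. ennreal (p x) * ennreal (q x) \<partial>L)"
proof (rule ennreal_le_epsilon)
  fix e :: real assume e: "e > 0"
  obtain b where b: "b \<ge> 0" "(\<integral>\<^sup>+x. ennreal ((q x)\<^sup>2) \<partial>L) = ennreal b"
    using fin(2) by (cases "\<integral>\<^sup>+x. ennreal ((q x)\<^sup>2) \<partial>L") auto
  \<comment> \<open>After scaling, the square term of \<open>q\<close> contributes
    \<open>t * C * b\<close> for every \<open>k\<close>; the \<open>+ 1\<close> keeps the
    denominator positive when \<open>b = 0\<close>.\<close>
  define t where "t = e / (C * (b + 1))"
  have t: "t > 0" using e b C by (simp add: t_def)
  have tb: "t * C * b \<le> e"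
  proof -
    have "t * C = e / (b + 1)" using C by (simp add: t_def)
    then have "t * C * b = e * (b / (b + 1))" by simp
    also have "\<dots> \<le> e * 1" using e b by (intro mult_left_mono) auto
    finally show ?thesis by simp
  qed
  let ?I = "\<integral>\<^sup>+x. ennreal (p x) * ennreal (q x) \<partial>L"
  show "limsup (\<lambda>k. scaled_coincidence m k (density L p) (density L q)) \<le> ennreal C * ?I + ennreal e"
  proof (rule limsup_le_of_null_error)
    show "(\<lambda>k. ennreal (1 / t) * oscillation k p) \<longlonglongrightarrow> 0"
      using ennreal_tendsto_cmult[OF _ oscillation_tendsto_zero[OF _ nonneg(1) fin(1)], of "ennreal (1 / t)"] by simp
    fix k
    let ?d = "1 / real (Suc k)"
    have pt: "near ?d x y * (ennreal (p x) * ennreal (q y))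
        \<le> near ?d x y * (ennreal (p y) * ennreal (q y)) + ennreal (1 / t) * (near ?d x y * ennreal ((p x - p y)\<^sup>2))
          + ennreal t * (near ?d x y * ennreal ((q y)\<^sup>2))" for x y
    proof -
      have young: "a * b \<le> a\<^sup>2 / t + t * b\<^sup>2" for a b :: real
      proof -
        have "0 \<le> (a - t * b / 2)\<^sup>2 + 3/4 * (t * b)\<^sup>2" by simp
        then have "a * b * t \<le> a\<^sup>2 + t * b\<^sup>2 * t" by (simp add: power2_eq_square algebra_simps)
        then show ?thesis using t by (simp add: field_simps)
      qed
      have "p x * q y \<le> p y * q y + 1 / t * (p x - p y)\<^sup>2 + t * (q y)\<^sup>2"
        using young[of "p x - p y" "q y"] by (simp add: algebra_simps)
      then have "ennreal (p x * q y) \<le> ennreal (p y * q y + 1 / t * (p x - p y)\<^sup>2 + t * (q y)\<^sup>2)"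
        by (rule ennreal_leI)
      also have "\<dots> = ennreal (p y * q y) + ennreal (1 / t * (p x - p y)\<^sup>2) + ennreal (t * (q y)\<^sup>2)"
        using nonneg t by (simp add: ennreal_plus)
      finally have "ennreal (p x) * ennreal (q y) \<le> ennreal (p y) * ennreal (q y)
           + ennreal (1 / t) * ennreal ((p x - p y)\<^sup>2) + ennreal t * ennreal ((q y)\<^sup>2)"
        using nonneg t by (simp only: ennreal_mult zero_le_power2 less_imp_le zero_le_divide_1_iff)
      from mult_left_mono[OF this, of "near ?d x y"] show ?thesis
        by (simp only: distrib_left mult.left_commute zero_le)
    qed
    have "coincidence ?d (density L p) (density L q)
        = (\<integral>\<^sup>+x. \<integral>\<^sup>+y. near ?d x y * (ennreal (p x) * ennreal (q y)) \<partial>L \<partial>L)"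
      by (rule coincidence_density) measurable
    also have "\<dots> \<le> (\<integral>\<^sup>+x. \<integral>\<^sup>+y. near ?d x y * (ennreal (p y) * ennreal (q y))
         + ennreal (1 / t) * (near ?d x y * ennreal ((p x - p y)\<^sup>2))
          + ennreal t * (near ?d x y * ennreal ((q y)\<^sup>2)) \<partial>L \<partial>L)"
      by (intro nn_integral_mono pt)
    also have "\<dots> = (\<integral>\<^sup>+x. \<integral>\<^sup>+y. near ?d x y * (ennreal (p y) * ennreal (q y)) \<partial>L \<partial>L)
       + ennreal (1 / t) * (\<integral>\<^sup>+x. \<integral>\<^sup>+y. near ?d x y * ennreal ((p x - p y)\<^sup>2) \<partial>L \<partial>L)
       + ennreal t * (\<integral>\<^sup>+x. \<integral>\<^sup>+y. near ?d x y * ennreal ((q y)\<^sup>2) \<partial>L \<partial>L)"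
      by (simp add: nn_integral_add nn_integral_cmult)
    also have "\<dots> \<le> ennreal (C * ?d ^ m) * ?I
       + ennreal (1 / t) * (\<integral>\<^sup>+x. \<integral>\<^sup>+y. near ?d x y * ennreal ((p x - p y)\<^sup>2) \<partial>L \<partial>L)
       + ennreal t * (ennreal (C * ?d ^ m) * ennreal b)"
      unfolding b(2)[symmetric] by (intro add_mono mult_left_mono near_integral_le order_refl) auto
    finally have "scaled_coincidence m k (density L p) (density L q) \<le> ennreal (real (Suc k) ^ m) *
      (ennreal (C * ?d ^ m) * ?I
       + ennreal (1 / t) * (\<integral>\<^sup>+x. \<integral>\<^sup>+y. near ?d x y * ennreal ((p x - p y)\<^sup>2) \<partial>L \<partial>L)
       + ennreal t * (ennreal (C * ?d ^ m) * ennreal b))"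
      unfolding scaled_coincidence_def by (rule mult_left_mono) simp
    also have "\<dots> = ennreal C * ?I + ennreal (1 / t) * oscillation k p + ennreal t * (ennreal C * ennreal b)"
      unfolding oscillation_def
      using C by (simp only: distrib_left mult.left_commute[of "ennreal (real (Suc k) ^ m)" "ennreal (1 / t)"]
        mult.left_commute[of "ennreal (real (Suc k) ^ m)" "ennreal t"] scale_cancel less_imp_le)
    also have "ennreal t * (ennreal C * ennreal b) = ennreal (t * C * b)"
      using t C b by (simp add: ennreal_mult mult.assoc)
    also have "ennreal C * ?I + ennreal (1 / t) * oscillation k p + ennreal (t * C * b)
        \<le> ennreal C * ?I + ennreal (1 / t) * oscillation k p + ennreal e"
      by (intro add_left_mono ennreal_leI tb)
    finally show "scaled_coincidence m k (density L p) (density L q)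
        \<le> ennreal C * ?I + ennreal e + ennreal (1 / t) * oscillation k p"
      by (simp only: add_ac)
  qed
qed

text \<open>Serves to prove that \<open>p\<close> is square integrable, so vanishing of the
  oscillation of \<open>p\<close> cannot be presupposed. It is available for bounded truncations
  with bounded support; monotone convergence then passes from these to \<open>p\<close>.\<close>

lemma square_integral_le_liminf:
  fixes p :: "'a \<Rightarrow> real"
  assumes [measurable]: "p \<in> borel_measurable borel" and nonneg: "\<And>x. 0 \<le> p x"
  shows "ennreal c * (\<integral>\<^sup>+x. ennreal ((p x)\<^sup>2 / 2) \<partial>L)
    \<le> liminf (\<lambda>k. scaled_coincidence m k (density L p) (density L p))"
proof -
  define r where "r i x = min (p x) (real i) * indicator (cball 0 (real i)) x" for i :: nat and x
  have [measurable]: "r i \<in> borel_measurable borel" for i unfolding r_def by measurable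
  have r0: "0 \<le> r i x" and rp: "r i x \<le> p x" and ri: "r i x \<le> real i * indicator (cball 0 (real i)) x" for i x
    using nonneg[of x] by (auto simp: r_def indicator_def)
  have r_mono: "r i x \<le> r j x" if "i \<le> j" for i j x
    using nonneg[of x] that by (auto simp: r_def indicator_def)
  have r_lim: "(\<lambda>i. r i x) \<longlonglongrightarrow> p x" for x
  proof (rule tendsto_eventually)
    obtain N :: nat where "max (norm x) (p x) \<le> N" using real_arch_simple by blast
    then show "\<forall>\<^sub>F i in sequentially. r i x = p x"
      unfolding eventually_sequentially by (intro exI[of _ N]) (auto simp: r_def indicator_def)
  qed
  have r_fin: "(\<integral>\<^sup>+x. ennreal ((r i x)\<^sup>2) \<partial>L) < \<infinity>" for i
  proof -
    have "(\<integral>\<^sup>+x. ennreal ((r i x)\<^sup>2) \<partial>L) \<le> (\<integral>\<^sup>+x. ennreal ((real i)\<^sup>2) * indicator (cball 0 (real i)) x \<partial>L)"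
    proof (intro nn_integral_mono)
      fix x
      have "(r i x)\<^sup>2 \<le> (real i * indicator (cball 0 (real i)) x)\<^sup>2"
        using ri[of i x] r0[of i x] by (rule power_mono)
      then have "ennreal ((r i x)\<^sup>2) \<le> ennreal ((real i * indicator (cball 0 (real i)) x)\<^sup>2)" by (rule ennreal_leI)
      then show "ennreal ((r i x)\<^sup>2) \<le> ennreal ((real i)\<^sup>2) * indicator (cball 0 (real i)) x"
        by (auto simp: indicator_def split: if_splits)
    qed
    also have "\<dots> = ennreal ((real i)\<^sup>2) * emeasure L (cball 0 (real i))"
      by (simp add: nn_integral_cmult)
    also have "\<dots> < \<infinity>"
      using finite_on_bounded[OF bounded_cball, of 0 "real i"] by (simp add: ennreal_mult_less_top)
    finally show ?thesis .
  qed
  have step: "ennreal c * (\<integral>\<^sup>+x. ennreal ((r i x)\<^sup>2 / 2) \<partial>L)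
      \<le> liminf (\<lambda>k. scaled_coincidence m k (density L p) (density L p))" for i
  proof (rule liminf_ge_of_null_error)
    show "(\<lambda>k. oscillation k (r i)) \<longlonglongrightarrow> 0"
      by (intro oscillation_tendsto_zero r0 r_fin) measurable
    fix k
    let ?d = "1 / real (Suc k)"
    have pt: "near ?d x y * ennreal ((r i x)\<^sup>2 / 2)
       \<le> near ?d x y * (ennreal (p x) * ennreal (p y)) + near ?d x y * ennreal ((r i x - r i y)\<^sup>2)" for x y
    proof -
      have "(r i x)\<^sup>2 / 2 \<le> r i x * r i y + (r i x - r i y)\<^sup>2"
      proof -
        \<comment> \<open>The surplus is a sum of squares. Writing r for \<open>r i x\<close> and r'
          for \<open>r i y\<close>, with r^2 in place of its half the surplus would be r' (r' - r),
          which can be negative; hence the halved square in the statement.\<close>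
        have "r i x * r i y + (r i x - r i y)\<^sup>2 - (r i x)\<^sup>2 / 2 = (r i x - r i y)\<^sup>2 / 2 + (r i y)\<^sup>2 / 2"
          by (simp add: power2_eq_square field_simps)
        then show ?thesis by (smt (verit) zero_le_power2 divide_nonneg_pos)
      qed
      also have "r i x * r i y \<le> p x * p y" by (intro mult_mono rp nonneg r0)
      finally have "ennreal ((r i x)\<^sup>2 / 2) \<le> ennreal (p x * p y + (r i x - r i y)\<^sup>2)" by (intro ennreal_leI) simp
      also have "\<dots> = ennreal (p x) * ennreal (p y) + ennreal ((r i x - r i y)\<^sup>2)"
        using nonneg by (simp add: ennreal_mult)
      finally show ?thesis by (simp only: distrib_left[symmetric]) (rule mult_left_mono, auto)
    qed
    have "ennreal (c * ?d ^ m) * (\<integral>\<^sup>+x. ennreal ((r i x)\<^sup>2 / 2) \<partial>L)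
        \<le> (\<integral>\<^sup>+x. \<integral>\<^sup>+y. near ?d x y * ennreal ((r i x)\<^sup>2 / 2) \<partial>L \<partial>L)"
      by (rule near_integral_ge) auto
    also have "\<dots> \<le> (\<integral>\<^sup>+x. \<integral>\<^sup>+y. near ?d x y * (ennreal (p x) * ennreal (p y)) + near ?d x y * ennreal ((r i x - r i y)\<^sup>2) \<partial>L \<partial>L)"
      by (intro nn_integral_mono pt)
    also have "\<dots> = (\<integral>\<^sup>+x. \<integral>\<^sup>+y. near ?d x y * (ennreal (p x) * ennreal (p y)) \<partial>L \<partial>L)
       + (\<integral>\<^sup>+x. \<integral>\<^sup>+y. near ?d x y * ennreal ((r i x - r i y)\<^sup>2) \<partial>L \<partial>L)"
      by (simp add: nn_integral_add)
    also have "(\<integral>\<^sup>+x. \<integral>\<^sup>+y. near ?d x y * (ennreal (p x) * ennreal (p y)) \<partial>L \<partial>L)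
        = coincidence ?d (density L p) (density L p)"
      by (rule coincidence_density[symmetric]) measurable
    finally have "ennreal (real (Suc k) ^ m) * (ennreal (c * ?d ^ m) * (\<integral>\<^sup>+x. ennreal ((r i x)\<^sup>2 / 2) \<partial>L))
       \<le> ennreal (real (Suc k) ^ m) * (coincidence ?d (density L p) (density L p)
         + (\<integral>\<^sup>+x. \<integral>\<^sup>+y. near ?d x y * ennreal ((r i x - r i y)\<^sup>2) \<partial>L \<partial>L))"
      by (rule mult_left_mono) simp
    then show "ennreal c * (\<integral>\<^sup>+x. ennreal ((r i x)\<^sup>2 / 2) \<partial>L)
      \<le> scaled_coincidence m k (density L p) (density L p) + oscillation k (r i)"
      unfolding scaled_coincidence_def oscillation_def
      using c by (simp only: distrib_left scale_cancel less_imp_le)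
  qed
  have "(\<lambda>i. \<integral>\<^sup>+x. ennreal ((r i x)\<^sup>2 / 2) \<partial>L) \<longlonglongrightarrow> (\<integral>\<^sup>+x. ennreal ((p x)\<^sup>2 / 2) \<partial>L)"
  proof (rule nn_integral_LIMSEQ)
    show "incseq (\<lambda>i x. ennreal ((r i x)\<^sup>2 / 2))"
      unfolding incseq_def le_fun_def
      by (intro allI impI ennreal_leI divide_right_mono power_mono r_mono r0) auto
    show "(\<lambda>i. ennreal ((r i x)\<^sup>2 / 2)) \<longlonglongrightarrow> ennreal ((p x)\<^sup>2 / 2)" for x
      by (intro tendsto_ennrealI tendsto_intros r_lim) auto
  qed measurable
  then have "(\<lambda>i. ennreal c * (\<integral>\<^sup>+x. ennreal ((r i x)\<^sup>2 / 2) \<partial>L)) \<longlonglongrightarrow> ennreal c * (\<integral>\<^sup>+x. ennreal ((p x)\<^sup>2 / 2) \<partial>L)"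
    by (intro ennreal_tendsto_cmult) auto
  then show ?thesis by (rule LIMSEQ_le_const2) (use step in auto)
qed

text \<open>Real values suffice because the measure is finite: its Radon-Nikodym derivative is
  finite almost everywhere, and \<open>enn2real\<close> alters it on a null set only. The factor
  \<open>2 / c\<close> undoes the ball constant and the halved square of the preceding
  estimate.\<close>

lemma square_integrable_density:
  assumes sets_a: "sets \<alpha> = sets borel" and fin: "finite_measure \<alpha>"
    and aV: "emeasure \<alpha> (- V) = 0"
    and W: "liminf (\<lambda>k. scaled_coincidence m k \<alpha> \<alpha>) < \<infinity>"
  obtains p :: "'a \<Rightarrow> real" where "p \<in> borel_measurable borel" "\<And>x. 0 \<le> p x"
    "\<alpha> = density L p" "AE x in L. RN_deriv L \<alpha> x = ennreal (p x)"
    "(\<integral>\<^sup>+x. ennreal ((p x)\<^sup>2) \<partial>L) \<le> ennreal (2 / c) * liminf (\<lambda>k. scaled_coincidence m k \<alpha> \<alpha>)"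
proof
  interpret A: finite_measure \<alpha> by fact
  let ?f = "RN_deriv L \<alpha>"
  have [measurable]: "?f \<in> borel_measurable L" by measurable
  have f: "density L ?f = \<alpha>"
    using absolutely_continuous_of_liminf_coincidence[OF assms] sets_a by (intro density_RN_deriv) auto
  define p where "p x = enn2real (?f x)" for x
  show p: "p \<in> borel_measurable borel"
  proof -
    have "p \<in> borel_measurable L" unfolding p_def by measurable
    then show ?thesis by simp
  qed
  show p0: "0 \<le> p x" for x by (simp add: p_def)
  have "(\<integral>\<^sup>+x. ?f x \<partial>L) = emeasure \<alpha> (space \<alpha>)"
    by (subst (2) f[symmetric]) (simp add: emeasure_density sets_eq_imp_space_eq[OF sets_a])
  then have "(\<integral>\<^sup>+x. ?f x \<partial>L) \<noteq> \<infinity>" using A.emeasure_finite by simp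
  then have "AE x in L. ?f x \<noteq> \<infinity>" by (intro nn_integral_PInf_AE) auto
  then show ae: "AE x in L. ?f x = ennreal (p x)"
    by eventually_elim (simp add: p_def less_top)
  have "density L ?f = density L p"
    using ae p by (intro density_cong) auto
  then show dens: "\<alpha> = density L p" using f by simp
  let ?W = "liminf (\<lambda>k. scaled_coincidence m k \<alpha> \<alpha>)"
  have "ennreal c * (\<integral>\<^sup>+x. ennreal ((p x)\<^sup>2 / 2) \<partial>L) \<le> ?W"
    using square_integral_le_liminf[OF p p0] dens by simp
  then have "ennreal (2 / c) * (ennreal c * (\<integral>\<^sup>+x. ennreal ((p x)\<^sup>2 / 2) \<partial>L)) \<le> ennreal (2 / c) * ?W"
    by (rule mult_left_mono) simp
  moreover have "ennreal (2 / c) * (ennreal c * (\<integral>\<^sup>+x. ennreal ((p x)\<^sup>2 / 2) \<partial>L))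
      = (\<integral>\<^sup>+x. ennreal ((p x)\<^sup>2) \<partial>L)"
  proof -
    have "ennreal (2 / c) * (ennreal c * (\<integral>\<^sup>+x. ennreal ((p x)\<^sup>2 / 2) \<partial>L))
       = ennreal 2 * (\<integral>\<^sup>+x. ennreal ((p x)\<^sup>2 / 2) \<partial>L)"
    proof -
      have "ennreal (2 / c) * ennreal c = ennreal 2" using c by (subst ennreal_mult[symmetric]) auto
      then show ?thesis by (simp only: mult.assoc[symmetric])
    qed
    also have "\<dots> = (\<integral>\<^sup>+x. ennreal 2 * ennreal ((p x)\<^sup>2 / 2) \<partial>L)"
      using p by (intro nn_integral_cmult[symmetric]) simp
    also have "\<dots> = (\<integral>\<^sup>+x. ennreal ((p x)\<^sup>2) \<partial>L)"
      by (intro nn_integral_cong, subst ennreal_mult[symmetric]) auto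
    finally show ?thesis .
  qed
  ultimately show "(\<integral>\<^sup>+x. ennreal ((p x)\<^sup>2) \<partial>L) \<le> ennreal (2 / c) * ?W" by simp
qed

text \<open>The first bound supplies the majorant and the second evaluates the limit when reverse
  Fatou is applied over planes. Only \<open>c\<close> and \<open>C\<close> enter the constants, so
  these do not change from plane to plane.\<close>

theorem coincidence_bounds:
  assumes a: "sets \<alpha> = sets borel" "finite_measure \<alpha>" "emeasure \<alpha> (- V) = 0"
      "liminf (\<lambda>k. scaled_coincidence m k \<alpha> \<alpha>) < \<infinity>"
    and b: "sets \<beta> = sets borel" "finite_measure \<beta>" "emeasure \<beta> (- V) = 0"
      "liminf (\<lambda>k. scaled_coincidence m k \<beta> \<beta>) < \<infinity>"
  shows "scaled_coincidence m k \<alpha> \<beta> \<le> ennreal (C * (2 / c)) *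
      (liminf (\<lambda>k. scaled_coincidence m k \<alpha> \<alpha>) + liminf (\<lambda>k. scaled_coincidence m k \<beta> \<beta>))"
    and "limsup (\<lambda>k. scaled_coincidence m k \<alpha> \<beta>)
      \<le> ennreal C * (\<integral>\<^sup>+x. RN_deriv L \<alpha> x * RN_deriv L \<beta> x \<partial>L)"
proof -
  obtain p where p: "p \<in> borel_measurable borel" "\<And>x. 0 \<le> p x"
    "\<alpha> = density L p" "AE x in L. RN_deriv L \<alpha> x = ennreal (p x)"
    "(\<integral>\<^sup>+x. ennreal ((p x)\<^sup>2) \<partial>L) \<le> ennreal (2 / c) * liminf (\<lambda>k. scaled_coincidence m k \<alpha> \<alpha>)"
    using square_integrable_density[OF a] by blast
  obtain q where q: "q \<in> borel_measurable borel" "\<And>x. 0 \<le> q x"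
    "\<beta> = density L q" "AE x in L. RN_deriv L \<beta> x = ennreal (q x)"
    "(\<integral>\<^sup>+x. ennreal ((q x)\<^sup>2) \<partial>L) \<le> ennreal (2 / c) * liminf (\<lambda>k. scaled_coincidence m k \<beta> \<beta>)"
    using square_integrable_density[OF b] by blast
  have pfin: "(\<integral>\<^sup>+x. ennreal ((p x)\<^sup>2) \<partial>L) < \<infinity>"
    using p(5) a(4) by (auto intro!: le_less_trans[OF p(5)] simp: ennreal_mult_less_top)
  have qfin: "(\<integral>\<^sup>+x. ennreal ((q x)\<^sup>2) \<partial>L) < \<infinity>"
    using q(5) b(4) by (auto intro!: le_less_trans[OF q(5)] simp: ennreal_mult_less_top)
  have "scaled_coincidence m k \<alpha> \<beta> \<le> ennreal C * ((\<integral>\<^sup>+x. ennreal ((p x)\<^sup>2) \<partial>L) + (\<integral>\<^sup>+x. ennreal ((q x)\<^sup>2) \<partial>L))"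
    using scaled_coincidence_density_le[OF p(1) q(1) p(2) q(2)] by (simp add: p(3) q(3))
  also have "\<dots> \<le> ennreal C * (ennreal (2 / c) * liminf (\<lambda>k. scaled_coincidence m k \<alpha> \<alpha>)
       + ennreal (2 / c) * liminf (\<lambda>k. scaled_coincidence m k \<beta> \<beta>))"
    by (intro mult_left_mono add_mono p(5) q(5)) simp
  also have "\<dots> = ennreal (C * (2 / c)) *
      (liminf (\<lambda>k. scaled_coincidence m k \<alpha> \<alpha>) + liminf (\<lambda>k. scaled_coincidence m k \<beta> \<beta>))"
  proof -
    have "ennreal (C * (2 / c)) = ennreal C * ennreal (2 / c)" using C c by (intro ennreal_mult) auto
    then show ?thesis by (simp only: distrib_left mult.assoc)
  qed
  finally show "scaled_coincidence m k \<alpha> \<beta> \<le> \<dots>" .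
  have "AE x in L. RN_deriv L \<alpha> x * RN_deriv L \<beta> x = ennreal (p x) * ennreal (q x)"
    using p(4) q(4) by eventually_elim simp
  then have "(\<integral>\<^sup>+x. RN_deriv L \<alpha> x * RN_deriv L \<beta> x \<partial>L) = (\<integral>\<^sup>+x. ennreal (p x) * ennreal (q x) \<partial>L)"
    by (rule nn_integral_cong_AE)
  then show "limsup (\<lambda>k. scaled_coincidence m k \<alpha> \<beta>)
      \<le> ennreal C * (\<integral>\<^sup>+x. RN_deriv L \<alpha> x * RN_deriv L \<beta> x \<partial>L)"
    using limsup_scaled_coincidence_density_le[OF p(1) q(1) p(2) q(2) pfin qfin]
    by (simp add: p(3)[symmetric] q(3)[symmetric])
qed

end

section \<open>Averages over the Grassmannian\<close>

text \<open>The constants stem from cubes inscribed in and circumscribed about balls and depend on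
  \<open>m\<close> alone.\<close>

lemma ahlfors_regular_lebV:
  assumes V: "subspace (V :: 'a::euclidean_space set)" and d: "dim V = m" and m: "m \<ge> 1"
  shows "ahlfors_regular (lebV V) V m ((2 / m) ^ m) (2 ^ m)"
proof
  note e = onb_props(2)[OF V]
  show "sets (lebV V) = sets borel" by (simp add: lebV_eq_coord_measure)
  show Vb: "V \<in> sets borel" using closed_subspace[OF V] by (rule borel_closed)
  have "{t \<in> space (coord_space (dim V)). (\<Sum>i<dim V. t i *\<^sub>R onb V i) \<in> - V} = {}"
    using onb_props(1)[OF V] by (auto intro!: subspace_sum subspace_mul V)
  then show "emeasure (lebV V) (- V) = 0"
    using Vb by (simp only: lebV_eq_coord_measure emeasure_coord_measure sets.compl_sets borel_comp emeasure_empty)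
  show "0 < (2 / real m) ^ m" using m by simp
  show "(0::real) < 2 ^ m" by simp
  show "emeasure (lebV V) (cball x r) \<le> ennreal (2 ^ m * r ^ m)" if "r > 0" for x r
    using coord_measure_cball_le[OF e, of r x] that by (simp add: lebV_eq_coord_measure d power_mult_distrib)
  show "ennreal ((2 / real m) ^ m * r ^ m) \<le> emeasure (lebV V) (cball x r)" if x: "x \<in> V" and r: "r > 0" for x r
  proof -
    have "x = (\<Sum>i<dim V. (x \<bullet> onb V i) *\<^sub>R onb V i)"
      using orthonormal_seq_expansion[OF e] onb_props(3)[OF V] x by simp
    from coord_measure_cball_ge[OF e _ this, of r]
    show ?thesis using r m by (simp add: lebV_eq_coord_measure d power_mult_distrib[symmetric])
  qed
qed

section \<open>Supports and vanishing of densities\<close>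

text \<open>The complement of the support is the union of all balls of measure zero, and by the
  Lindelof property countably many of them already cover it.\<close>

lemma emeasure_compl_spt:
  fixes \<mu> :: "'a::euclidean_space measure"
  assumes [simp]: "sets \<mu> = sets borel"
  shows "- spt \<mu> \<in> null_sets \<mu>"
proof -
  define F where "F = {ball x e | x e. e > 0 \<and> emeasure \<mu> (ball x e) = 0}"
  obtain F' where F': "F' \<subseteq> F" "countable F'" "\<Union>F' = \<Union>F"
    using Lindelof[of F] by (auto simp: F_def)
  have null: "\<Union>F' \<in> null_sets \<mu>"
    using F' by (intro null_sets_UN'[where N="\<lambda>x. x" and I=F', simplified]) (auto simp: F_def null_sets_def)
  have "- spt \<mu> = \<Union>F"
  proof (intro set_eqI iffI)
    fix x assume "x \<in> - spt \<mu>"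
    then obtain e where "e > 0" "emeasure \<mu> (ball x e) = 0" by (auto simp: spt_def)
    then show "x \<in> \<Union>F" by (auto simp: F_def intro!: exI[of _ "ball x e"])
  next
    fix x assume "x \<in> \<Union>F"
    then obtain y e where e: "x \<in> ball y e" "emeasure \<mu> (ball y e) = 0" by (auto simp: F_def)
    then obtain r where r: "r > 0" "ball x r \<subseteq> ball y e"
      using openE[OF open_ball e(1)] by blast
    have "emeasure \<mu> (ball x r) \<le> emeasure \<mu> (ball y e)" using r by (intro emeasure_mono) auto
    then show "x \<in> - spt \<mu>" using r(1) e(2) by (force simp: spt_def)
  qed
  then show ?thesis using null F'(3) by simp
qed

text \<open>Covers measures without a density too, for which \<open>RN_deriv\<close> is the zero
  function by definition. The overlap argument therefore applies to every single plane, not just to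
  almost all of them.\<close>

lemma RN_deriv_zero_outside:
  assumes K: "K \<in> sets L" and s: "space L = UNIV" and a: "emeasure \<alpha> (- K) = 0"
  shows "AE x in L. x \<notin> K \<longrightarrow> RN_deriv L \<alpha> x = 0"
proof (cases "\<exists>f. f \<in> borel_measurable L \<and> density L f = \<alpha>")
  case True
  then have "density L (RN_deriv L \<alpha>) = \<alpha>" using RN_derivI by blast
  moreover have "- K \<in> sets L" using sets.compl_sets[OF K] s by (simp add: Compl_eq_Diff_UNIV)
  ultimately have "(\<integral>\<^sup>+x. RN_deriv L \<alpha> x * indicator (- K) x \<partial>L) = 0"
    using a emeasure_density[of "RN_deriv L \<alpha>" L "- K"] by simp
  then have "AE x in L. RN_deriv L \<alpha> x * indicator (- K) x = 0"
    using \<open>- K \<in> sets L\<close> by (subst (asm) nn_integral_0_iff_AE) auto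
  then show ?thesis by eventually_elim (auto simp: indicator_def)
next
  case False
  then have "RN_deriv L \<alpha> = (\<lambda>_. 0)" unfolding RN_deriv_def by (simp only: if_False)
  then show ?thesis by simp
qed

lemma overlap_pos_of_density_product:
  assumes L: "sets L = sets borel" and K: "K \<in> sets borel" "K' \<in> sets borel"
    and a: "emeasure \<alpha> (- K) = 0" "emeasure \<beta> (- K') = 0"
    and pos: "(\<integral>\<^sup>+x. RN_deriv L \<alpha> x * RN_deriv L \<beta> x \<partial>L) > 0"
  shows "emeasure L (K \<inter> K') > 0"
proof (rule ccontr)
  assume "\<not> ?thesis"
  then have "K \<inter> K' \<in> null_sets L" using K by (simp add: null_sets_def L)
  then have "AE x in L. x \<notin> K \<inter> K'" by (rule AE_not_in)
  moreover have "AE x in L. x \<notin> K \<longrightarrow> RN_deriv L \<alpha> x = 0" "AE x in L. x \<notin> K' \<longrightarrow> RN_deriv L \<beta> x = 0"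
    using K a sets_eq_imp_space_eq[OF L] by (auto intro!: RN_deriv_zero_outside simp: L)
  ultimately have "AE x in L. RN_deriv L \<alpha> x * RN_deriv L \<beta> x = 0"
    by eventually_elim auto
  then have "(\<integral>\<^sup>+x. RN_deriv L \<alpha> x * RN_deriv L \<beta> x \<partial>L) = 0"
    by (subst nn_integral_0_iff_AE) auto
  then show False using pos by simp
qed

section \<open>Planes on which a given vector has a short projection\<close>

locale invariant_grassmannian =
  fixes m :: nat and \<gamma> :: "'a::euclidean_space set measure"
  assumes invariant: "invariant_grass_measure m \<gamma>" and m_less: "m < DIM('a)"
begin

sublocale prob_space \<gamma>
  using invariant by (simp add: invariant_grass_measure_def)

lemma sets_gamma: "sets \<gamma> = sets (Grass_sets m)"
  using invariant by (simp add: invariant_grass_measure_def)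

lemma space_gamma [simp]: "space \<gamma> = Grass m"
  using sets_eq_imp_space_eq[OF sets_gamma] by (simp add: Grass_sets_def)

lemma emeasure_Grass [simp]: "emeasure \<gamma> (Grass m) = 1"
  using emeasure_space_1 by simp

lemma GrassD: "V \<in> Grass m \<Longrightarrow> subspace V" "V \<in> Grass m \<Longrightarrow> dim V = m"
  by (auto simp: Grass_def)

text \<open>The sigma-algebra on planes is pulled back along \<open>Blinfun (proj V)\<close>, and
  evaluation of a bounded linear map at a fixed vector is continuous. \<open>Blinfun\<close> can be
  undone because \<open>proj V\<close> is linear for V in the Grassmannian.\<close>

lemma measurable_proj_vector: "(\<lambda>V. proj V b) \<in> borel_measurable \<gamma>"
proof -
  have "(\<lambda>V. Blinfun (proj V)) \<in> measurable (Grass_sets m) borel"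
    unfolding Grass_sets_def by (rule measurable_vimage_algebra1) auto
  then have B: "(\<lambda>V. Blinfun (proj V)) \<in> borel_measurable \<gamma>"
    using measurable_cong_sets[OF sets_gamma refl] by blast
  have "(\<lambda>f. blinfun_apply f b) \<in> borel_measurable borel"
    by (intro borel_measurable_continuous_onI continuous_intros)
  from measurable_compose[OF B this]
  have "(\<lambda>V. blinfun_apply (Blinfun (proj V)) b) \<in> borel_measurable \<gamma>" .
  moreover have "blinfun_apply (Blinfun (proj V)) b = proj V b" if "V \<in> space \<gamma>" for V
    using linear_proj[OF GrassD(1)[OF that[unfolded space_gamma]]]
    by (simp add: bounded_linear_Blinfun_apply linear_conv_bounded_linear)
  ultimately show ?thesis by (subst measurable_cong[symmetric]) auto
qed

lemma measurable_proj_pair: "(\<lambda>(V, z). proj V z) \<in> borel_measurable (\<gamma> \<Otimes>\<^sub>M borel)"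
proof -
  have "(\<lambda>p. \<Sum>b\<in>Basis. (snd p \<bullet> b) *\<^sub>R proj (fst p) b) \<in> borel_measurable (\<gamma> \<Otimes>\<^sub>M borel)"
    using measurable_compose[OF measurable_fst measurable_proj_vector]
    by (intro borel_measurable_sum borel_measurable_scaleR borel_measurable_inner) auto
  moreover have eq: "proj V z = (\<Sum>b\<in>Basis. (z \<bullet> b) *\<^sub>R proj V b)" if "V \<in> Grass m" for V z
  proof -
    have "proj V z = proj V (\<Sum>b\<in>Basis. (z \<bullet> b) *\<^sub>R b)" by (simp add: euclidean_representation)
    then show ?thesis
      using linear_proj[OF GrassD(1)[OF that]] by (simp add: linear_sum linear_scale)
  qed
  ultimately show ?thesis
    by (subst measurable_cong[where g="\<lambda>p. \<Sum>b\<in>Basis. (snd p \<bullet> b) *\<^sub>R proj (fst p) b"])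
       (auto simp: space_pair_measure intro!: eq)
qed

lemma measurable_proj_grass [measurable (raw)]:
  assumes [measurable]: "F \<in> measurable M \<gamma>" "f \<in> borel_measurable M"
  shows "(\<lambda>x. proj (F x) (f x)) \<in> borel_measurable M"
  using measurable_compose[OF measurable_Pair[OF assms] measurable_proj_pair] by simp

lemma Grass_orthogonal_image:
  assumes T: "orthogonal_transformation T" and V: "V \<in> Grass m"
  shows "T ` V \<in> Grass m"
proof -
  have lin: "linear T" and inj: "inj T"
    using T orthogonal_transformation_linear orthogonal_transformation_inj by auto
  have "dim (T ` V) = dim V"
    using dim_image_eq[OF lin] inj by (meson inj_on_subset subset_UNIV)
  then show ?thesis using V linear_subspace_image[OF lin] by (simp add: Grass_def)
qed

definition hit :: "'a \<Rightarrow> real \<Rightarrow> ennreal" where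
  "hit z d = emeasure \<gamma> {V\<in>Grass m. norm (proj V z) \<le> d}"

lemma hit_sets [measurable]: "{V\<in>Grass m. norm (proj V z) \<le> d} \<in> sets \<gamma>"
  unfolding space_gamma[symmetric] by measurable

text \<open>Projecting T z to T V gives T of the projection of z to V. So the planes counted for z
  are those whose image under T is counted for T z, and invariance equates the two measures.\<close>

lemma hit_orthogonal_transformation:
  assumes T: "orthogonal_transformation T"
  shows "hit (T z) d = hit z d"
proof -
  let ?A = "{V\<in>Grass m. norm (proj V (T z)) \<le> d}"
  have "{V\<in>Grass m. T ` V \<in> ?A} = {V\<in>Grass m. norm (proj V z) \<le> d}"
    using Grass_orthogonal_image[OF T] proj_orthogonal_transformation[OF T GrassD(1)]
    by (auto simp: orthogonal_transformation_norm[OF T])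
  moreover have "emeasure \<gamma> {V\<in>Grass m. T ` V \<in> ?A} = emeasure \<gamma> ?A"
    using invariant T hit_sets unfolding invariant_grass_measure_def by blast
  ultimately show ?thesis by (simp add: hit_def)
qed

text \<open>Shrinking z to the length of w admits more planes, and an orthogonal map then carries
  the shrunk vector to w without changing the measure.\<close>

lemma hit_antimono:
  assumes "norm w \<le> norm z" shows "hit z d \<le> hit w d"
proof (cases "z = 0")
  case True
  then have "w = 0" using assms by simp
  then show ?thesis using True by simp
next
  case False
  define s where "s = norm w / norm z"
  have s: "0 \<le> s" "s \<le> 1" using assms False by (auto simp: s_def divide_le_eq_1)
  have "norm (s *\<^sub>R z) = norm w" using False by (simp add: s_def)
  then obtain T where T: "orthogonal_transformation T" "T (s *\<^sub>R z) = w"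
    using orthogonal_transformation_exists_mapping by blast
  have "hit z d \<le> hit (s *\<^sub>R z) d"
    unfolding hit_def
  proof (intro emeasure_mono hit_sets subsetI)
    fix V assume V: "V \<in> {V\<in>Grass m. norm (proj V z) \<le> d}"
    then have "norm (proj V (s *\<^sub>R z)) = s * norm (proj V z)"
      using s by (simp add: proj_scaleR[OF GrassD(1)])
    also have "\<dots> \<le> norm (proj V z)" using s by (simp add: mult_left_le_one_le)
    finally show "V \<in> {V\<in>Grass m. norm (proj V (s *\<^sub>R z)) \<le> d}" using V by auto
  qed
  then show ?thesis using hit_orthogonal_transformation[OF T(1), of "s *\<^sub>R z" d] T(2) by simp
qed

lemma hit_scale:
  assumes "a > 0" shows "hit (a *\<^sub>R z) (a * d) = hit z d"
proof -
  have "norm (proj V (a *\<^sub>R z)) \<le> a * d \<longleftrightarrow> norm (proj V z) \<le> d" if "V \<in> Grass m" for V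
    using assms by (simp add: proj_scaleR[OF GrassD(1)[OF that]])
  then show ?thesis unfolding hit_def by (intro arg_cong[where f="emeasure \<gamma>"]) auto
qed

lemma measurable_hit [measurable]: "(\<lambda>z. hit z d) \<in> borel_measurable borel"
proof -
  have "(\<lambda>z. \<integral>\<^sup>+V. indicator {..d} (norm (proj V z)) \<partial>\<gamma>) \<in> borel_measurable borel"
    by measurable
  also have "(\<lambda>z. \<integral>\<^sup>+V. indicator {..d} (norm (proj V z)) \<partial>\<gamma>) = (\<lambda>z. hit z d)"
  proof
    fix z
    have "(\<integral>\<^sup>+V. indicator {..d} (norm (proj V z)) \<partial>\<gamma>) = (\<integral>\<^sup>+V. indicator {V\<in>Grass m. norm (proj V z) \<le> d} V \<partial>\<gamma>)"
      by (intro nn_integral_cong) (auto simp: indicator_def)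
    then show "(\<integral>\<^sup>+V. indicator {..d} (norm (proj V z)) \<partial>\<gamma>) = hit z d"
      by (simp add: hit_def)
  qed
  finally show ?thesis .
qed

text \<open>By invariance \<open>hit\<close> is a decreasing function of the norm, so it can be estimated by its
  average over a ball or an annulus; Fubini turns that average into volumes of slabs.\<close>

lemma hit_integral:
  assumes A [measurable]: "A \<in> sets borel"
  shows "(\<integral>\<^sup>+w. hit w d * indicator A w \<partial>lborel)
       = (\<integral>\<^sup>+V. emeasure lborel (A \<inter> {w. norm (proj V w) \<le> d}) \<partial>\<gamma>)"
proof -
  interpret P: pair_sigma_finite \<gamma> "lborel :: 'a measure" ..
  have "(\<integral>\<^sup>+w. hit w d * indicator A w \<partial>lborel)
      = (\<integral>\<^sup>+w. \<integral>\<^sup>+V. indicator {..d} (norm (proj V w)) * indicator A w \<partial>\<gamma> \<partial>lborel)"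
  proof (intro nn_integral_cong)
    fix w :: 'a
    have "hit w d = (\<integral>\<^sup>+V. indicator {..d} (norm (proj V w)) \<partial>\<gamma>)"
      unfolding hit_def nn_integral_indicator[OF hit_sets, symmetric]
      by (intro nn_integral_cong) (auto simp: indicator_def)
    then show "hit w d * indicator A w = (\<integral>\<^sup>+V. indicator {..d} (norm (proj V w)) * indicator A w \<partial>\<gamma>)"
      by (simp add: nn_integral_multc)
  qed
  also have "\<dots> = (\<integral>\<^sup>+V. \<integral>\<^sup>+w. indicator {..d} (norm (proj V w)) * indicator A w \<partial>lborel \<partial>\<gamma>)"
    by (rule P.Fubini') measurable
  also have "\<dots> = (\<integral>\<^sup>+V. emeasure lborel (A \<inter> {w. norm (proj V w) \<le> d}) \<partial>\<gamma>)"
  proof (intro nn_integral_cong)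
    fix V assume "V \<in> space \<gamma>"
    then have V: "subspace V" using GrassD by simp
    have "(\<integral>\<^sup>+w. indicator {..d} (norm (proj V w)) * indicator A w \<partial>lborel)
        = (\<integral>\<^sup>+w. indicator (A \<inter> {w. norm (proj V w) \<le> d}) w \<partial>lborel)"
      by (intro nn_integral_cong) (auto simp: indicator_def)
    also have "\<dots> = emeasure lborel (A \<inter> {w. norm (proj V w) \<le> d})"
      using measurable_norm_proj_set[OF V] by (intro nn_integral_indicator) auto
    finally show "(\<integral>\<^sup>+w. indicator {..d} (norm (proj V w)) * indicator A w \<partial>lborel)
        = emeasure lborel (A \<inter> {w. norm (proj V w) \<le> d})" .
  qed
  finally show ?thesis .
qed

text \<open>Vectors of the unit ball are no longer than a unit vector z, so \<open>hit z d\<close>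
  is at most the average of \<open>hit\<close> over the ball, which is an average of slab volumes.
  Homogeneity reduces other vectors to unit ones.\<close>

lemma hit_upper:
  "\<exists>C>0. \<forall>z d. z \<noteq> 0 \<longrightarrow> d > 0 \<longrightarrow> hit z d \<le> ennreal (C * (d / norm z) ^ m)"
proof -
  obtain C where C: "C > 0" and bound: "\<And>(V::'a set) d. subspace V \<Longrightarrow> dim V = m \<Longrightarrow> d > 0 \<Longrightarrow>
     emeasure lborel (cball 0 1 \<inter> {w. norm (proj V w) \<le> d}) \<le> ennreal (C * d ^ m)"
    using lborel_slab_bounds(1)[OF m_less] by blast
  define l where "l = measure lborel (cball 0 1 :: 'a set)"
  have l: "l > 0" unfolding l_def by (rule content_cball_pos) simp
  have L: "emeasure lborel (cball 0 1 :: 'a set) = ennreal l"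
    unfolding l_def using emeasure_lborel_cball_finite[of "0::'a" 1] by (intro emeasure_eq_ennreal_measure) auto
  have unit: "hit z d \<le> ennreal (C / l * d ^ m)" if z: "norm z = 1" and d: "d > 0" for z d
  proof -
    have "hit z d * ennreal l = (\<integral>\<^sup>+w. hit z d * indicator (cball 0 1 :: 'a set) w \<partial>lborel)"
      by (simp add: nn_integral_cmult L)
    also have "\<dots> \<le> (\<integral>\<^sup>+w. hit w d * indicator (cball 0 1) w \<partial>lborel)"
      using z by (intro nn_integral_mono) (auto simp: indicator_def intro!: hit_antimono)
    also have "\<dots> = (\<integral>\<^sup>+V. emeasure lborel (cball 0 1 \<inter> {w. norm (proj V w) \<le> d}) \<partial>\<gamma>)"
      by (rule hit_integral) simp
    also have "\<dots> \<le> (\<integral>\<^sup>+V. ennreal (C * d ^ m) \<partial>\<gamma>)"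
      by (intro nn_integral_mono bound d) (auto simp: GrassD)
    also have "\<dots> = ennreal (C * d ^ m)" by simp
    finally have "ennreal (1 / l) * (hit z d * ennreal l) \<le> ennreal (1 / l) * ennreal (C * d ^ m)"
      by (rule mult_left_mono) simp
    moreover have "ennreal (1 / l) * (hit z d * ennreal l) = hit z d"
      using l by (simp add: mult.left_commute[of _ "hit z d"] ennreal_mult[symmetric])
    ultimately show ?thesis using l C d by (simp add: ennreal_mult[symmetric])
  qed
  show ?thesis
  proof (intro exI[of _ "C / l"] conjI allI impI)
    fix z :: 'a and d :: real assume z: "z \<noteq> 0" and d: "d > 0"
    have "hit z d = hit ((1 / norm z) *\<^sub>R z) ((1 / norm z) * d)"
      using z by (intro hit_scale[symmetric]) simp
    also have "\<dots> \<le> ennreal (C / l * (1 / norm z * d) ^ m)"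
      using z d by (intro unit) auto
    finally show "hit z d \<le> ennreal (C / l * (d / norm z) ^ m)" by simp
  qed (use C l in simp)
qed

text \<open>The comparison now needs vectors longer than z, hence the annulus: there
  \<open>hit\<close> is at most its value at any z of norm at most 1/2. Near the origin the
  inequality would point the wrong way.\<close>

lemma hit_lower:
  assumes R: "R > 0"
  shows "\<exists>c>0. \<exists>d0>0. \<forall>z d. norm z \<le> R \<longrightarrow> 0 < d \<longrightarrow> d \<le> d0 \<longrightarrow> ennreal (c * d ^ m) \<le> hit z d"
proof -
  obtain c where c: "c > 0" and bound: "\<And>(V::'a set) d. subspace V \<Longrightarrow> dim V = m \<Longrightarrow> d > 0 \<Longrightarrow> d \<le> 1 \<Longrightarrow>
     ennreal (c * d ^ m) \<le> emeasure lborel ((cball 0 1 - ball 0 (1/2)) \<inter> {w. norm (proj V w) \<le> d})"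
    using lborel_slab_bounds(2)[OF m_less] by blast
  define l where "l = measure lborel (cball 0 1 :: 'a set)"
  have l: "l > 0" unfolding l_def by (rule content_cball_pos) simp
  have L: "emeasure lborel (cball 0 1 :: 'a set) = ennreal l"
    unfolding l_def using emeasure_lborel_cball_finite[of "0::'a" 1] by (intro emeasure_eq_ennreal_measure) auto
  have half: "ennreal (c / l * d ^ m) \<le> hit z d" if z: "norm z \<le> 1/2" and d: "d > 0" "d \<le> 1" for z d
  proof -
    let ?A = "cball 0 1 - ball 0 (1/2) :: 'a set"
    have "ennreal (c * d ^ m) = (\<integral>\<^sup>+V. ennreal (c * d ^ m) \<partial>\<gamma>)" by simp
    also have "\<dots> \<le> (\<integral>\<^sup>+V. emeasure lborel (?A \<inter> {w. norm (proj V w) \<le> d}) \<partial>\<gamma>)"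
      by (intro nn_integral_mono bound d) (auto simp: GrassD)
    also have "\<dots> = (\<integral>\<^sup>+w. hit w d * indicator ?A w \<partial>lborel)"
      by (rule hit_integral[symmetric]) simp
    also have "\<dots> \<le> (\<integral>\<^sup>+w. hit z d * indicator (cball 0 1 :: 'a set) w \<partial>lborel)"
      using z by (intro nn_integral_mono) (auto simp: indicator_def intro!: hit_antimono)
    also have "\<dots> = hit z d * ennreal l" by (simp add: nn_integral_cmult L)
    finally have "ennreal (1 / l) * ennreal (c * d ^ m) \<le> ennreal (1 / l) * (hit z d * ennreal l)"
      by (rule mult_left_mono) simp
    moreover have "ennreal (1 / l) * (hit z d * ennreal l) = hit z d"
      using l by (simp add: mult.left_commute[of _ "hit z d"] ennreal_mult[symmetric])
    ultimately show ?thesis using l c d by (simp add: ennreal_mult[symmetric])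
  qed
  \<comment> \<open>Division by \<open>2 * R\<close> brings norms up to \<open>R\<close> down to 1/2
    and turns the restriction to radii at most 1 into \<open>d \<le> 2 * R\<close>, which becomes
    the threshold \<open>d0\<close>.\<close>
  have "\<forall>z d. norm z \<le> R \<longrightarrow> 0 < d \<longrightarrow> d \<le> 2 * R \<longrightarrow> ennreal (c / l * (1 / (2 * R)) ^ m * d ^ m) \<le> hit z d"
  proof (intro allI impI)
    fix z :: 'a and d :: real assume z: "norm z \<le> R" and d: "0 < d" "d \<le> 2 * R"
    have "ennreal (c / l * (1 / (2 * R) * d) ^ m) \<le> hit ((1 / (2 * R)) *\<^sub>R z) (1 / (2 * R) * d)"
      using z d R by (intro half) (auto simp: field_simps)
    also have "\<dots> = hit z d" using R by (intro hit_scale) simp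
    finally show "ennreal (c / l * (1 / (2 * R)) ^ m * d ^ m) \<le> hit z d"
      by (simp only: power_mult_distrib mult.assoc)
  qed
  moreover have "c / l * (1 / (2 * R)) ^ m > 0" "2 * R > 0" using c l R by auto
  ultimately show ?thesis by blast
qed

section \<open>Measurability of the overlap condition\<close>

text \<open>The image of a compact set is closed, so membership means distance zero from it. As
  projections do not increase distances, the distance can be tested on a countable dense subset of
  K, which leaves countably many measurable conditions.\<close>

lemma measurable_proj_image:
  assumes K: "compact (K :: 'a set)"
  shows "{p \<in> space (\<gamma> \<Otimes>\<^sub>M borel). proj (fst p) (snd p) \<in> proj (fst p) ` K} \<in> sets (\<gamma> \<Otimes>\<^sub>M borel)"
proof -
  obtain D where D: "countable D" "D \<subseteq> K" "K \<subseteq> closure D" using separable[of K] by blast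
  have "{p \<in> space (\<gamma> \<Otimes>\<^sub>M borel). proj (fst p) (snd p) \<in> proj (fst p) ` K}
      = {p \<in> space (\<gamma> \<Otimes>\<^sub>M borel). \<forall>n. \<exists>x\<in>D. dist (proj (fst p) x) (proj (fst p) (snd p)) < 1 / real (Suc n)}"
  proof (intro Collect_cong conj_cong refl iffI)
    fix p :: "'a set \<times> 'a" assume p: "p \<in> space (\<gamma> \<Otimes>\<^sub>M borel)"
    obtain V z where pv: "p = (V, z)" by (cases p)
    then have V: "subspace V" using p GrassD by (auto simp: space_pair_measure)
    {
      assume "proj (fst p) (snd p) \<in> proj (fst p) ` K"
      then obtain x where x: "x \<in> K" "proj V z = proj V x" by (auto simp: pv)
      show "\<forall>n. \<exists>x\<in>D. dist (proj (fst p) x) (proj (fst p) (snd p)) < 1 / real (Suc n)"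
      proof
        fix n
        have "x \<in> closure D" using x D by auto
        then obtain y where y: "y \<in> D" "dist y x < 1 / real (Suc n)"
          unfolding closure_approachable by (metis of_nat_0_less_iff zero_less_Suc zero_less_divide_1_iff)
        have "dist (proj V y) (proj V z) = norm (proj V (y - x))" by (simp add: x dist_norm proj_diff[OF V])
        also have "\<dots> \<le> dist y x" using norm_proj_le[OF V, of "y - x"] by (simp add: dist_norm)
        finally show "\<exists>x\<in>D. dist (proj (fst p) x) (proj (fst p) (snd p)) < 1 / real (Suc n)"
          using y by (intro bexI[of _ y]) (auto simp: pv simp del: of_nat_Suc)
      qed
    next
      assume *: "\<forall>n. \<exists>x\<in>D. dist (proj (fst p) x) (proj (fst p) (snd p)) < 1 / real (Suc n)"
      have cl: "closure (proj V ` K) = proj V ` K"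
        using compact_proj_image[OF V K] by (simp add: compact_imp_closed)
      have "proj V z \<in> closure (proj V ` K)"
        unfolding closure_approachable
      proof (intro allI impI)
        fix e :: real assume "e > 0"
        then obtain n where n: "1 / real (Suc n) < e" using nat_approx_posE by blast
        from * obtain x where "x \<in> D" "dist (proj V x) (proj V z) < 1 / real (Suc n)" by (auto simp: pv)
        then show "\<exists>y\<in>proj V ` K. dist y (proj V z) < e"
          using n D by (intro bexI[of _ "proj V x"]) auto
      qed
      then show "proj (fst p) (snd p) \<in> proj (fst p) ` K" by (simp add: cl pv)
    }
  qed
  moreover have "{p \<in> space (\<gamma> \<Otimes>\<^sub>M borel). \<forall>n. \<exists>x\<in>D. dist (proj (fst p) x) (proj (fst p) (snd p)) < 1 / real (Suc n)}
    \<in> sets (\<gamma> \<Otimes>\<^sub>M borel)"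
  proof -
    have [measurable]: "Measurable.pred (\<gamma> \<Otimes>\<^sub>M borel) (\<lambda>p. dist (proj (fst p) x) (proj (fst p) (snd p)) < 1 / real (Suc n))" for x n
      by measurable
    show ?thesis using D(1) by measurable
  qed
  ultimately show ?thesis by simp
qed

lemma overlap_sets:
  assumes K: "compact (K :: 'a set)" "compact K'"
  shows "{V \<in> Grass m. emeasure (lebV V) (proj V ` K \<inter> proj V ` K') > 0} \<in> sets \<gamma>"
proof -
  let ?Q = "{p \<in> space (\<gamma> \<Otimes>\<^sub>M borel). proj (fst p) (snd p) \<in> proj (fst p) ` K}
     \<inter> {p \<in> space (\<gamma> \<Otimes>\<^sub>M borel). proj (fst p) (snd p) \<in> proj (fst p) ` K'}"
  have "?Q \<in> sets (\<gamma> \<Otimes>\<^sub>M lborel)"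
    using measurable_proj_image K by (simp cong: sets_pair_measure_cong)
  then have [measurable]: "(\<lambda>V. emeasure lborel (Pair V -` ?Q)) \<in> borel_measurable \<gamma>"
    by (rule lborel.measurable_emeasure_Pair)
  have "{V \<in> Grass m. emeasure (lebV V) (proj V ` K \<inter> proj V ` K') > 0}
     = {V \<in> space \<gamma>. emeasure lborel (Pair V -` ?Q) > 0}"
  proof (intro Collect_cong conj_cong)
    fix V assume "V \<in> space \<gamma>"
    then have VG: "V \<in> Grass m" by simp
    note V = GrassD(1)[OF VG]
    have S: "proj V ` K \<inter> proj V ` K' \<in> sets borel"
      using compact_proj_image[OF V] K by (auto dest: borel_compact)
    have "Pair V -` ?Q = {z. proj V z \<in> proj V ` K \<inter> proj V ` K'}"
      using VG by (auto simp: space_pair_measure)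
    then show "(emeasure (lebV V) (proj V ` K \<inter> proj V ` K') > 0) = (emeasure lborel (Pair V -` ?Q) > 0)"
      using lebV_null_iff[OF V S] by (simp add: zero_less_iff_neq_zero)
  qed simp
  moreover have "{V \<in> space \<gamma>. emeasure lborel (Pair V -` ?Q) > 0} \<in> sets \<gamma>" by measurable
  ultimately show ?thesis by simp
qed

section \<open>Coincidence masses of projected measures and the energy\<close>

text \<open>This is the scaled coincidence mass of the two image measures, pulled back to the
  ambient space. In this form V enters only through the jointly measurable map (V, z) to
  \<open>proj V z\<close>, so Tonelli's theorem applies.\<close>

definition proj_coincidence :: "nat \<Rightarrow> 'a measure \<Rightarrow> 'a measure \<Rightarrow> 'a set \<Rightarrow> ennreal" where
  "proj_coincidence k \<mu> \<nu> V = ennreal (real (Suc k) ^ m) *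
     (\<integral>\<^sup>+x. \<integral>\<^sup>+y. indicator {..1 / real (Suc k)} (norm (proj V (x - y))) \<partial>\<nu> \<partial>\<mu>)"

lemma proj_coincidence_eq:
  assumes V: "V \<in> Grass m" and s [simp, measurable_cong]: "sets \<mu> = sets borel" "sets \<nu> = sets borel"
    and fin: "finite_measure \<nu>"
  shows "scaled_coincidence m k (distr \<mu> borel (proj V)) (distr \<nu> borel (proj V)) = proj_coincidence k \<mu> \<nu> V"
proof -
  have [measurable]: "proj V \<in> borel_measurable borel" using measurable_proj[OF GrassD(1)[OF V]] .
  interpret finite_measure \<nu> by fact
  let ?d = "1 / real (Suc k)"
  have "coincidence ?d (distr \<mu> borel (proj V)) (distr \<nu> borel (proj V))
      = (\<integral>\<^sup>+x. \<integral>\<^sup>+y. near ?d (proj V x) (proj V y) \<partial>\<nu> \<partial>\<mu>)"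
    unfolding coincidence_def by (simp add: nn_integral_distr)
  also have "\<dots> = (\<integral>\<^sup>+x. \<integral>\<^sup>+y. indicator {..?d} (norm (proj V (x - y))) \<partial>\<nu> \<partial>\<mu>)"
    by (intro nn_integral_cong) (simp add: near_def indicator_def dist_norm proj_diff[OF GrassD(1)[OF V]])
  finally show ?thesis by (simp only: scaled_coincidence_def proj_coincidence_def)
qed

lemma measurable_proj_coincidence [measurable]:
  assumes s [simp, measurable_cong]: "sets \<mu> = sets borel" "sets \<nu> = sets borel"
    and fin: "finite_measure \<mu>" "finite_measure \<nu>"
  shows "proj_coincidence k \<mu> \<nu> \<in> borel_measurable \<gamma>"
proof -
  interpret M: finite_measure \<mu> by fact
  interpret N: finite_measure \<nu> by fact
  show ?thesis unfolding proj_coincidence_def by measurable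
qed

lemma proj_coincidence_integral:
  assumes s [simp, measurable_cong]: "sets \<mu> = sets borel" "sets \<nu> = sets borel"
    and fin: "finite_measure \<mu>" "finite_measure \<nu>"
  shows "(\<integral>\<^sup>+V. proj_coincidence k \<mu> \<nu> V \<partial>\<gamma>)
    = ennreal (real (Suc k) ^ m) * (\<integral>\<^sup>+x. \<integral>\<^sup>+y. hit (x - y) (1 / real (Suc k)) \<partial>\<nu> \<partial>\<mu>)"
proof -
  interpret M: finite_measure \<mu> by fact
  interpret N: finite_measure \<nu> by fact
  interpret PM: pair_sigma_finite \<mu> \<gamma> ..
  interpret PN: pair_sigma_finite \<nu> \<gamma> ..
  let ?d = "1 / real (Suc k)"
  have hit: "(\<integral>\<^sup>+V. indicator {..?d} (norm (proj V z)) \<partial>\<gamma>) = hit z ?d" for z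
    unfolding hit_def nn_integral_indicator[OF hit_sets, symmetric]
    by (intro nn_integral_cong) (auto simp: indicator_def)
  have "(\<integral>\<^sup>+V. proj_coincidence k \<mu> \<nu> V \<partial>\<gamma>) = ennreal (real (Suc k) ^ m) *
     (\<integral>\<^sup>+V. \<integral>\<^sup>+x. \<integral>\<^sup>+y. indicator {..?d} (norm (proj V (x - y))) \<partial>\<nu> \<partial>\<mu> \<partial>\<gamma>)"
    unfolding proj_coincidence_def by (rule nn_integral_cmult) measurable
  also have "(\<integral>\<^sup>+V. \<integral>\<^sup>+x. \<integral>\<^sup>+y. indicator {..?d} (norm (proj V (x - y))) \<partial>\<nu> \<partial>\<mu> \<partial>\<gamma>)
     = (\<integral>\<^sup>+x. \<integral>\<^sup>+V. \<integral>\<^sup>+y. indicator {..?d} (norm (proj V (x - y))) \<partial>\<nu> \<partial>\<gamma> \<partial>\<mu>)"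
    by (rule PM.Fubini') measurable
  also have "\<dots> = (\<integral>\<^sup>+x. \<integral>\<^sup>+y. \<integral>\<^sup>+V. indicator {..?d} (norm (proj V (x - y))) \<partial>\<gamma> \<partial>\<nu> \<partial>\<mu>)"
    by (intro nn_integral_cong PN.Fubini') measurable
  also have "\<dots> = (\<integral>\<^sup>+x. \<integral>\<^sup>+y. hit (x - y) ?d \<partial>\<nu> \<partial>\<mu>)" by (simp only: hit)
  finally show ?thesis .
qed

text \<open>The factor (k+1)^m cancels the power of the radius in the upper bound for
  \<open>hit\<close> and leaves a multiple of |x - y|^(-m), the kernel of the energy, for every
  \<open>k\<close>. On the diagonal that kernel is infinite and the comparison is trivial.\<close>

lemma proj_coincidence_integral_le_energy:
  "\<exists>C>0. \<forall>\<mu> k. sets \<mu> = sets borel \<longrightarrow> finite_measure \<mu> \<longrightarrow>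
     (\<integral>\<^sup>+V. proj_coincidence k \<mu> \<mu> V \<partial>\<gamma>) \<le> ennreal C * energy (real m) \<mu>"
proof -
  obtain C where C: "C > 0" and bound: "\<And>z d. z \<noteq> 0 \<Longrightarrow> d > 0 \<Longrightarrow> hit z d \<le> ennreal (C * (d / norm z) ^ m)"
    using hit_upper by blast
  have "(\<integral>\<^sup>+V. proj_coincidence k \<mu> \<mu> V \<partial>\<gamma>) \<le> ennreal C * energy (real m) \<mu>"
    if s [simp, measurable_cong]: "sets \<mu> = sets borel" and fin: "finite_measure \<mu>" for \<mu> k
  proof -
    interpret M: finite_measure \<mu> by fact
    let ?E = "\<lambda>x y :: 'a. if x = y then \<infinity> else ennreal (dist x y powr - real m)"
    let ?r = "ennreal (real (Suc k) ^ m)"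
    have pt: "?r * hit (x - y) (1 / real (Suc k)) \<le> ennreal C * ?E x y" for x y
    proof (cases "x = y")
      case True
      then show ?thesis using C by (simp add: ennreal_mult_top)
    next
      case False
      then have n: "dist x y > 0" by simp
      have "?r * hit (x - y) (1 / real (Suc k)) \<le> ?r * ennreal (C * (1 / real (Suc k) / norm (x - y)) ^ m)"
        using False by (intro mult_left_mono bound) auto
      also have "\<dots> = ennreal (real (Suc k) ^ m * (C * (1 / real (Suc k) / norm (x - y)) ^ m))"
        using C by (intro ennreal_mult[symmetric]) auto
      also have "real (Suc k) ^ m * (C * (1 / real (Suc k) / norm (x - y)) ^ m) = C * dist x y powr - real m"
      proof -
        have "real (Suc k) ^ m * (1 / real (Suc k) / norm (x - y)) ^ m = (real (Suc k) * (1 / real (Suc k) / norm (x - y))) ^ m"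
          by (rule power_mult_distrib[symmetric])
        also have "real (Suc k) * (1 / real (Suc k) / norm (x - y)) = 1 / dist x y" by (simp add: dist_norm)
        also have "(1 / dist x y) ^ m = dist x y powr - real m"
          using n by (simp add: powr_minus powr_realpow power_one_over inverse_eq_divide)
        finally show ?thesis by (simp only: mult.left_commute)
      qed
      also have "ennreal \<dots> = ennreal C * ?E x y" using C False by (simp add: ennreal_mult)
      finally show ?thesis .
    qed
    have mE: "(\<lambda>(x, y). ?E x y) \<in> borel_measurable (borel \<Otimes>\<^sub>M borel)" by measurable
    have [measurable]: "(\<lambda>p. ?E (fst p) (snd p)) \<in> borel_measurable (\<mu> \<Otimes>\<^sub>M \<mu>)"
      using mE by (simp add: split_beta' cong: measurable_cong_sets sets_pair_measure_cong)
    have m1 [measurable]: "(\<lambda>y. ?E x y) \<in> borel_measurable \<mu>" for x by measurable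
    have m2 [measurable]: "(\<lambda>x. \<integral>\<^sup>+y. ?E x y \<partial>\<mu>) \<in> borel_measurable \<mu>" by measurable
    have "(\<integral>\<^sup>+V. proj_coincidence k \<mu> \<mu> V \<partial>\<gamma>)
        = (\<integral>\<^sup>+x. \<integral>\<^sup>+y. ?r * hit (x - y) (1 / real (Suc k)) \<partial>\<mu> \<partial>\<mu>)"
      by (simp add: proj_coincidence_integral fin nn_integral_cmult del: of_nat_Suc)
    also have "\<dots> \<le> (\<integral>\<^sup>+x. \<integral>\<^sup>+y. ennreal C * ?E x y \<partial>\<mu> \<partial>\<mu>)"
      by (intro nn_integral_mono pt)
    also have "\<dots> = ennreal C * energy (real m) \<mu>"
      unfolding energy_def by (simp only: nn_integral_cmult[OF m1] nn_integral_cmult[OF m2])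
    finally show ?thesis .
  qed
  then show ?thesis using C by blast
qed

text \<open>Some ball of radius \<open>R\<close> about the origin has positive mass for both
  measures. Differences of its points have norm at most \<open>2 * R\<close>, and there the lower
  bound for \<open>hit\<close> keeps the averages above a fixed multiple of the product of the two
  masses once \<open>k\<close> is large.\<close>

lemma proj_coincidence_integral_lower:
  assumes s [simp, measurable_cong]: "sets \<mu> = sets borel" "sets \<nu> = sets borel"
    and fin: "finite_measure \<mu>" "finite_measure \<nu>"
    and nonzero: "emeasure \<mu> (space \<mu>) \<noteq> 0" "emeasure \<nu> (space \<nu>) \<noteq> 0"
  shows "limsup (\<lambda>k. \<integral>\<^sup>+V. proj_coincidence k \<mu> \<nu> V \<partial>\<gamma>) > 0"
proof -
  interpret M: finite_measure \<mu> by fact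
  interpret N: finite_measure \<nu> by fact
  have ball_pos: "\<exists>R0::nat. \<forall>R\<ge>R0. emeasure \<rho> (cball 0 (real R)) > 0"
    if r: "sets \<rho> = sets borel" "emeasure \<rho> (space \<rho>) \<noteq> 0" for \<rho> :: "'a measure"
  proof -
    have un: "(\<Union>i::nat. cball 0 (real i)) = (UNIV :: 'a set)"
      by (auto simp: real_arch_simple)
    have "\<exists>i::nat. emeasure \<rho> (cball 0 (real i)) \<noteq> 0"
    proof (rule ccontr)
      assume "\<not> ?thesis"
      then have "emeasure \<rho> (\<Union>i::nat. cball 0 (real i)) = 0"
        using r(1) by (intro emeasure_UN_eq_0) auto
      then show False using r sets_eq_imp_space_eq[OF r(1)] un by simp
    qed
    then obtain i :: nat where i: "emeasure \<rho> (cball 0 (real i)) \<noteq> 0" by blast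
    have "emeasure \<rho> (cball 0 (real R)) > 0" if "R \<ge> i" for R
    proof -
      have "emeasure \<rho> (cball 0 (real i)) \<le> emeasure \<rho> (cball 0 (real R))"
        using that r(1) by (intro emeasure_mono) auto
      moreover have "emeasure \<rho> (cball 0 (real i)) > 0" using i by (simp add: zero_less_iff_neq_zero)
      ultimately show ?thesis by (rule less_le_trans[rotated])
    qed
    then show ?thesis by blast
  qed
  obtain R1 R2 :: nat where "\<forall>R\<ge>R1. emeasure \<mu> (cball 0 (real R)) > 0" "\<forall>R\<ge>R2. emeasure \<nu> (cball 0 (real R)) > 0"
    using ball_pos[of \<mu>] ball_pos[of \<nu>] nonzero by auto
  then obtain R :: nat where R: "R \<ge> 1" "emeasure \<mu> (cball 0 (real R)) > 0" "emeasure \<nu> (cball 0 (real R)) > 0"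
    by (metis max.cobounded1 max.cobounded2 max.coboundedI2)
  obtain c d0 where c: "c > 0" "d0 > 0"
    and bound: "\<And>z d. norm z \<le> 2 * real R \<Longrightarrow> 0 < d \<Longrightarrow> d \<le> d0 \<Longrightarrow> ennreal (c * d ^ m) \<le> hit z d"
    using hit_lower[of "2 * real R"] R(1) by auto
  let ?B = "cball 0 (real R) :: 'a set"
  have "eventually (\<lambda>k. 1 / real (Suc k) < d0) sequentially"
    using order_tendstoD(2)[OF LIMSEQ_inverse_real_of_nat c(2)] by (simp add: inverse_eq_divide)
  then have ev: "eventually (\<lambda>k. ennreal c * (emeasure \<mu> ?B * emeasure \<nu> ?B)
      \<le> (\<integral>\<^sup>+V. proj_coincidence k \<mu> \<nu> V \<partial>\<gamma>)) sequentially"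
  proof eventually_elim
    case (elim k)
    let ?r = "real (Suc k) ^ m"
    have pt: "ennreal c * (indicator ?B x * indicator ?B y) \<le> ennreal ?r * hit (x - y) (1 / real (Suc k))" for x y
    proof (cases "x \<in> ?B \<and> y \<in> ?B")
      case True
      then have "norm (x - y) \<le> 2 * real R" using norm_triangle_ineq4[of x y] by simp
      then have "ennreal (c * (1 / real (Suc k)) ^ m) \<le> hit (x - y) (1 / real (Suc k))"
        using elim by (intro bound) auto
      then have "ennreal ?r * ennreal (c * (1 / real (Suc k)) ^ m) \<le> ennreal ?r * hit (x - y) (1 / real (Suc k))"
        by (rule mult_left_mono) simp
      moreover have "ennreal ?r * ennreal (c * (1 / real (Suc k)) ^ m) = ennreal c"
        using c by (subst ennreal_mult[symmetric]) (auto simp: power_divide simp del: of_nat_Suc)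
      ultimately show ?thesis using True by simp
    qed auto
    have "ennreal c * (emeasure \<mu> ?B * emeasure \<nu> ?B)
        = (\<integral>\<^sup>+x. \<integral>\<^sup>+y. ennreal c * (indicator ?B x * indicator ?B y) \<partial>\<nu> \<partial>\<mu>)"
      by (simp add: nn_integral_cmult nn_integral_multc)
    also have "\<dots> \<le> (\<integral>\<^sup>+x. \<integral>\<^sup>+y. ennreal ?r * hit (x - y) (1 / real (Suc k)) \<partial>\<nu> \<partial>\<mu>)"
      by (intro nn_integral_mono pt)
    also have "\<dots> = (\<integral>\<^sup>+V. proj_coincidence k \<mu> \<nu> V \<partial>\<gamma>)"
      by (simp add: proj_coincidence_integral fin nn_integral_cmult del: of_nat_Suc)
    finally show ?case .
  qed
  have "0 < ennreal c * (emeasure \<mu> ?B * emeasure \<nu> ?B)"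
    using c R by (simp add: ennreal_zero_less_mult_iff)
  also have "\<dots> \<le> liminf (\<lambda>k. \<integral>\<^sup>+V. proj_coincidence k \<mu> \<nu> V \<partial>\<gamma>)" using ev by (rule Liminf_bounded)
  also have "\<dots> \<le> limsup (\<lambda>k. \<integral>\<^sup>+V. proj_coincidence k \<mu> \<nu> V \<partial>\<gamma>)" by (rule Liminf_le_Limsup) simp
  finally show ?thesis .
qed

text \<open>Fatou's lemma controls a liminf and nothing stronger, which is why the density results
  on a single plane start from a finite liminf.\<close>

lemma AE_liminf_proj_coincidence_finite:
  assumes s: "sets \<mu> = sets borel" and fin: "finite_measure \<mu>" and E: "energy (real m) \<mu> < \<infinity>"
  shows "(\<integral>\<^sup>+V. liminf (\<lambda>k. proj_coincidence k \<mu> \<mu> V) \<partial>\<gamma>) < \<infinity>"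
    and "AE V in \<gamma>. liminf (\<lambda>k. proj_coincidence k \<mu> \<mu> V) < \<infinity>"
proof -
  note [measurable] = measurable_proj_coincidence[OF s s fin fin]
  obtain C where C: "\<And>k. (\<integral>\<^sup>+V. proj_coincidence k \<mu> \<mu> V \<partial>\<gamma>) \<le> ennreal C * energy (real m) \<mu>"
    using proj_coincidence_integral_le_energy s fin by metis
  have "(\<integral>\<^sup>+V. liminf (\<lambda>k. proj_coincidence k \<mu> \<mu> V) \<partial>\<gamma>) \<le> liminf (\<lambda>k. \<integral>\<^sup>+V. proj_coincidence k \<mu> \<mu> V \<partial>\<gamma>)"
    by (rule nn_integral_liminf) measurable
  also have "\<dots> \<le> ennreal C * energy (real m) \<mu>"
    by (rule order_trans[OF Liminf_le_Limsup Limsup_bounded]) (use C in auto)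
  also have "\<dots> < \<infinity>" using E by (simp add: ennreal_mult_less_top)
  finally show fin': "(\<integral>\<^sup>+V. liminf (\<lambda>k. proj_coincidence k \<mu> \<mu> V) \<partial>\<gamma>) < \<infinity>" .
  have "AE V in \<gamma>. liminf (\<lambda>k. proj_coincidence k \<mu> \<mu> V) \<noteq> \<infinity>"
    using fin' by (intro nn_integral_PInf_AE) auto
  then show "AE V in \<gamma>. liminf (\<lambda>k. proj_coincidence k \<mu> \<mu> V) < \<infinity>"
    by eventually_elim (simp add: less_top)
qed

end

section \<open>Positivity over the Grassmannian\<close>

theorem theorem3p2:
  fixes \<mu> \<nu> :: "'a::euclidean_space measure" and m :: nat and \<gamma> :: "'a set measure"
  assumes "1 \<le> m" "m < DIM('a)"
    and "invariant_grass_measure m \<gamma>"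
    and "sets \<mu> = sets borel" "finite_measure \<mu>" "emeasure \<mu> (space \<mu>) \<noteq> 0" "compact (spt \<mu>)"
    and "sets \<nu> = sets borel" "finite_measure \<nu>" "emeasure \<nu> (space \<nu>) \<noteq> 0" "compact (spt \<nu>)"
    and "energy (real m) \<mu> < \<infinity>" "energy (real m) \<nu> < \<infinity>"
  shows "(\<integral>\<^sup>+ V. (\<integral>\<^sup>+ v. proj_density V \<mu> v * proj_density V \<nu> v \<partial>lebV V) \<partial>\<gamma>) > 0
         \<and> emeasure \<gamma> {V \<in> Grass m.
           emeasure (lebV V) (proj V ` spt \<mu> \<inter> proj V ` spt \<nu>) > 0} > 0"
proof -
  interpret invariant_grassmannian m \<gamma> by unfold_locales fact+
  note s\<mu> = assms(4) and fin\<mu> = assms(5) and s\<nu> = assms(8) and fin\<nu> = assms(9)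
  note [measurable] = measurable_proj_coincidence[OF s\<mu> s\<mu> fin\<mu> fin\<mu>]
    measurable_proj_coincidence[OF s\<nu> s\<nu> fin\<nu> fin\<nu>] measurable_proj_coincidence[OF s\<mu> s\<nu> fin\<mu> fin\<nu>]
  define W\<mu> where "W\<mu> V = liminf (\<lambda>k. proj_coincidence k \<mu> \<mu> V)" for V
  define W\<nu> where "W\<nu> V = liminf (\<lambda>k. proj_coincidence k \<nu> \<nu> V)" for V
  have [measurable]: "W\<mu> \<in> borel_measurable \<gamma>" "W\<nu> \<in> borel_measurable \<gamma>"
    unfolding W\<mu>_def W\<nu>_def by measurable
  define c C where "c = (2 / real m) ^ m" and "C = (2 ^ m :: real)"
  \<comment> \<open>\<open>F\<close> is measurable in V, whereas \<open>G\<close> involves a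
    derivative chosen for each plane and its measurability is not established. Positivity is
    therefore proved for \<open>F\<close> and transferred.\<close>
  define F where "F V = limsup (\<lambda>k. proj_coincidence k \<mu> \<nu> V)" for V
  define G where "G V = (\<integral>\<^sup>+ v. proj_density V \<mu> v * proj_density V \<nu> v \<partial>lebV V)" for V
  have F_meas [measurable]: "F \<in> borel_measurable \<gamma>" unfolding F_def by measurable

  have bounds: "proj_coincidence k \<mu> \<nu> V \<le> ennreal (C * (2 / c)) * (W\<mu> V + W\<nu> V)" "F V \<le> ennreal C * G V"
    if V: "V \<in> Grass m" and W: "W\<mu> V < \<infinity>" "W\<nu> V < \<infinity>" for V k
  proof -
    note sub = GrassD(1)[OF V]
    interpret ahlfors_regular "lebV V" V m c C
      unfolding c_def C_def using GrassD[OF V] assms(1) by (rule ahlfors_regular_lebV)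
    have pr: "sets (distr \<rho> borel (proj V)) = sets borel" "finite_measure (distr \<rho> borel (proj V))"
        "emeasure (distr \<rho> borel (proj V)) (- V) = 0"
      if r: "sets \<rho> = sets borel" "finite_measure \<rho>" for \<rho>
    proof -
      have pm: "proj V \<in> measurable \<rho> borel"
        using measurable_proj[OF sub] measurable_cong_sets[OF r(1) refl] by blast
      show "sets (distr \<rho> borel (proj V)) = sets borel" by simp
      show "finite_measure (distr \<rho> borel (proj V))" using r(2) pm by (rule finite_measure.finite_measure_distr)
      have "proj V -` (- V) \<inter> space \<rho> = {}" using proj_in[OF sub] by auto
      then show "emeasure (distr \<rho> borel (proj V)) (- V) = 0"
        using pm V_borel by (subst emeasure_distr) auto
    qed
    have eq: "scaled_coincidence m k (distr \<mu> borel (proj V)) (distr \<mu> borel (proj V)) = proj_coincidence k \<mu> \<mu> V"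
      "scaled_coincidence m k (distr \<nu> borel (proj V)) (distr \<nu> borel (proj V)) = proj_coincidence k \<nu> \<nu> V"
      "scaled_coincidence m k (distr \<mu> borel (proj V)) (distr \<nu> borel (proj V)) = proj_coincidence k \<mu> \<nu> V" for k
      using proj_coincidence_eq[OF V] s\<mu> s\<nu> fin\<mu> fin\<nu> by auto
    note cb = coincidence_bounds[OF pr[OF s\<mu> fin\<mu>] _ pr[OF s\<nu> fin\<nu>], unfolded eq, folded W\<mu>_def W\<nu>_def, OF W]
    show "proj_coincidence k \<mu> \<nu> V \<le> ennreal (C * (2 / c)) * (W\<mu> V + W\<nu> V)" by (rule cb(1))
    show "F V \<le> ennreal C * G V" using cb(2) by (simp only: F_def G_def proj_density_def)
  qed

  have AE_W: "AE V in \<gamma>. V \<in> Grass m \<and> W\<mu> V < \<infinity> \<and> W\<nu> V < \<infinity>"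
    using AE_liminf_proj_coincidence_finite(2)[OF s\<mu> fin\<mu> assms(12)]
      AE_liminf_proj_coincidence_finite(2)[OF s\<nu> fin\<nu> assms(13)] AE_space
    unfolding W\<mu>_def W\<nu>_def by eventually_elim simp

  have F_pos: "(\<integral>\<^sup>+V. F V \<partial>\<gamma>) > 0"
  proof -
    have "0 < limsup (\<lambda>k. \<integral>\<^sup>+V. proj_coincidence k \<mu> \<nu> V \<partial>\<gamma>)"
      using assms by (intro proj_coincidence_integral_lower)
    also have "\<dots> \<le> (\<integral>\<^sup>+V. F V \<partial>\<gamma>)"
      unfolding F_def
    proof (rule nn_integral_limsup[where w="\<lambda>V. ennreal (C * (2 / c)) * (W\<mu> V + W\<nu> V)"])
      show "AE V in \<gamma>. proj_coincidence k \<mu> \<nu> V \<le> ennreal (C * (2 / c)) * (W\<mu> V + W\<nu> V)" for k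
        using AE_W by eventually_elim (use bounds(1) in blast)
      have "(\<integral>\<^sup>+V. ennreal (C * (2 / c)) * (W\<mu> V + W\<nu> V) \<partial>\<gamma>)
          = ennreal (C * (2 / c)) * ((\<integral>\<^sup>+V. W\<mu> V \<partial>\<gamma>) + (\<integral>\<^sup>+V. W\<nu> V \<partial>\<gamma>))"
        by (simp add: nn_integral_cmult nn_integral_add)
      also have "\<dots> < \<infinity>"
        using AE_liminf_proj_coincidence_finite(1)[OF s\<mu> fin\<mu> assms(12)]
          AE_liminf_proj_coincidence_finite(1)[OF s\<nu> fin\<nu> assms(13)]
        unfolding W\<mu>_def W\<nu>_def by (simp add: ennreal_mult_less_top)
      finally show "(\<integral>\<^sup>+V. ennreal (C * (2 / c)) * (W\<mu> V + W\<nu> V) \<partial>\<gamma>) < \<infinity>" .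
    qed measurable
    finally show ?thesis .
  qed

  have AE_FG: "AE V in \<gamma>. V \<in> Grass m \<and> ennreal (1 / C) * F V \<le> G V"
    using AE_W
  proof eventually_elim
    case (elim V)
    then have "ennreal (1 / C) * F V \<le> ennreal (1 / C) * (ennreal C * G V)"
      by (intro mult_left_mono bounds(2)) auto
    also have "\<dots> = G V"
      by (simp add: C_def mult.assoc[symmetric] ennreal_mult[symmetric])
    finally show ?case using elim by simp
  qed

  have "0 < ennreal (1 / C) * (\<integral>\<^sup>+V. F V \<partial>\<gamma>)"
    using F_pos by (simp add: ennreal_zero_less_mult_iff C_def)
  also have "\<dots> = (\<integral>\<^sup>+V. ennreal (1 / C) * F V \<partial>\<gamma>)" by (simp add: nn_integral_cmult)
  \<comment> \<open>Monotonicity of the nonnegative integral holds for arbitrary functions, so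
    \<open>G\<close> only has to dominate almost everywhere.\<close>
  also have "\<dots> \<le> (\<integral>\<^sup>+V. G V \<partial>\<gamma>)"
    using AE_FG by (intro nn_integral_mono_AE) (auto elim: eventually_mono)
  finally have part1: "(\<integral>\<^sup>+V. G V \<partial>\<gamma>) > 0" .

  let ?S = "{V \<in> Grass m. emeasure (lebV V) (proj V ` spt \<mu> \<inter> proj V ` spt \<nu>) > 0}"
  have S: "?S \<in> sets \<gamma>" using assms by (intro overlap_sets)
  have inS: "V \<in> ?S" if V: "V \<in> Grass m" and G: "G V > 0" for V
  proof -
    note sub = GrassD(1)[OF V]
    have cont: "proj V ` K \<in> sets borel" if "compact K" for K
      using compact_proj_image[OF sub that] by (rule borel_compact)
    have null: "emeasure (distr \<rho> borel (proj V)) (- (proj V ` spt \<rho>)) = 0"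
      if r: "sets \<rho> = sets borel" "compact (spt \<rho>)" for \<rho>
    proof -
      have pm: "proj V \<in> measurable \<rho> borel"
        using measurable_proj[OF sub] measurable_cong_sets[OF r(1) refl] by blast
      have "emeasure (distr \<rho> borel (proj V)) (- (proj V ` spt \<rho>))
          = emeasure \<rho> (proj V -` (- (proj V ` spt \<rho>)) \<inter> space \<rho>)"
        using cont[OF r(2)] pm by (intro emeasure_distr) auto
      also have "\<dots> \<le> emeasure \<rho> (- spt \<rho>)"
        using emeasure_compl_spt[OF r(1)] by (intro emeasure_mono) (auto simp: null_sets_def)
      also have "\<dots> = 0" using emeasure_compl_spt[OF r(1)] by (simp add: null_sets_def)
      finally show ?thesis by simp
    qed
    have "emeasure (lebV V) (proj V ` spt \<mu> \<inter> proj V ` spt \<nu>) > 0"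
      using G unfolding G_def proj_density_def
      by (intro overlap_pos_of_density_product[OF _ cont cont null null])
         (use assms in \<open>auto simp: lebV_eq_coord_measure\<close>)
    then show ?thesis using V by simp
  qed
  have part2: "emeasure \<gamma> ?S > 0"
  proof (rule ccontr)
    assume "\<not> ?thesis"
    then have "?S \<in> null_sets \<gamma>" using S by (auto simp: null_sets_def)
    then have "AE V in \<gamma>. V \<notin> ?S" by (rule AE_not_in)
    \<comment> \<open>Off \<open>?S\<close> the value \<open>G V\<close> is zero, hence so is its
      minorant \<open>F V\<close>. If \<open>?S\<close> were null, the measurable function
      \<open>F\<close> would have integral zero.\<close>
    with AE_FG have "AE V in \<gamma>. F V = 0"
    proof eventually_elim
      case (elim V)
      then have "\<not> G V > 0" using inS[of V] by blast
      then have "ennreal (1 / C) * F V = 0" using elim by simp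
      then show ?case by (simp add: C_def)
    qed
    then have "(\<integral>\<^sup>+V. F V \<partial>\<gamma>) = 0" by (subst nn_integral_0_iff_AE) auto
    then show False using F_pos by simp
  qed
  show ?thesis using part1 part2 by (simp only: G_def)
qed

end
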